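(* Let $(\mathcal{M},g,\nabla,\nabla^* )$ be a dualistic structure on a smooth manifold of dimension $d\ge2$, and let $\alpha>0$. (1) Suppose that $\nabla$ and $\nabla^*$ are both projectively flat and both have constant sectional curvature $-\alpha<0$ with respect to $g$. Then, near each point of $\mathcal{M}$, there exist affine coordinate systems $\xi$ and $\eta$ for $\nabla$ and $\nabla^*$ respectively, and (locally) $\alpha$-exponentially concave functions $\varphi(\xi)$ and $\psi(\eta)$, satisfying the generalized Fenchel identity $$\varphi(\xi)+\psi(\eta)\equiv c^{(\alpha)}(\xi,\eta)=\tfrac1\alpha\log(1+\alpha\,\xi\cdot\eta),$$ where $\xi,\eta$ are the coordinates of the same point. Moreover, writing $\xi_q$, $\eta_p$ for the coordinates of points $q$, $p$, the formula $$\mathbf{D}[q:p]=c^{(\alpha)}(\xi_q,\eta_p)-\varphi(\xi_q)-\psi(\eta_p)$$ defines locally a divergence which induces the given dualistic structure $(g,\nabla,\nabla^* )$. (2) Suppose instead that $\nabla$ and $\nabla^*$ are both projectively flat and both have constant sectional curvature $+\alpha>0$ with respect to $g$. Then the analogous statements hold: near each point there exist affine coordinate systems $\xi$ and $\eta$ for $\nabla$ and $\nabla^*$ respectively, and (locally) $\alpha$-exponentially convex functions $\varphi(\xi)$, $\psi(\eta)$ with $\varphi(\xi)+\psi(\eta)\equiv c^{(\alpha)}(\xi,\eta)$, and $\mathbf{D}[q:p]=\varphi(\xi_q)+\psi(\eta_p)-c^{(\alpha)}(\xi_q,\eta_p)$ defines locally a divergence which induces the given dualistic structure.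
   Context: A dualistic structure on a smooth manifold consists of a Riemannian metric $g=\langle\cdot,\cdot\rangle$ and torsion-free affine connections $\nabla,\nabla^*$ with $Z\langle X,Y\rangle=\langle\nabla_ZX,Y\rangle+\langle X,\nabla^*_ZY\rangle$ for all vector fields $X,Y,Z$. A torsion-free connection $\nabla$ is projectively flat if there are a flat torsion-free connection $\widetilde\nabla$ and a $1$-form $\tau$ with $\nabla_XY=\widetilde\nabla_XY+\tau(X)Y+\tau(Y)X$. It has constant sectional curvature $k$ with respect to $g$ if its curvature tensor $R(X,Y)Z=\nabla_X\nabla_YZ-\nabla_Y\nabla_XZ-\nabla_{[X,Y]}Z$ satisfies $R(X,Y)Z=k(\langle Y,Z\rangle X-\langle X,Z\rangle Y)$. An affine coordinate system for a projectively flat connection is a local coordinate system in which its geodesics are straight lines up to time reparameterization. A function $\varphi$ is $\alpha$-exponentially concave (convex) if $e^{\alpha\varphi}$ is concave (convex); locally so means that each point has a convex neighbourhood (in the coordinates) on which this holds. Divergence inducing a dualistic structure: in any local coordinates $\xi$, $g_{ij}=-\partial_{\xi^i}\partial_{\xi'^j}\mathbf{D}[\xi:\xi']|_{\xi'=\xi}$, $\langle\nabla_{\partial_i}\partial_j,\partial_k\rangle=-\partial_{\xi^i}\partial_{\xi^j}\partial_{\xi'^k}\mathbf{D}[\xi:\xi']|_{\xi'=\xi}$, $\langle\nabla^*_{\partial_i}\partial_j,\partial_k\rangle=-\partial_{\xi'^i}\partial_{\xi'^j}\partial_{\xi^k}\mathbf{D}[\xi:\xi']|_{\xi'=\xi}$,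 where $\mathbf{D}[\xi:\xi']$ stands for $\mathbf{D}[q:p]$ with $q,p$ having coordinates $\xi,\xi'$. *)

theory Defs
  imports "HOL-Analysis.Analysis"
begin

section \<open>Smooth maps between Euclidean spaces\<close>

text \<open>Both notions are meant for an open set \<open>S\<close>.\<close>

primrec C_k_on :: "nat \<Rightarrow> 'e::euclidean_space set \<Rightarrow> ('e \<Rightarrow> 'f::real_normed_vector) \<Rightarrow> bool" where
  "C_k_on 0 S f \<longleftrightarrow> continuous_on S f"
| "C_k_on (Suc k) S f \<longleftrightarrow> (\<forall>x\<in>S. f differentiable (at x)) \<and>
     (\<forall>v. C_k_on k S (\<lambda>x. frechet_derivative f (at x) v))"

definition smooth_on :: "'e::euclidean_space set \<Rightarrow> ('e \<Rightarrow> 'f::real_normed_vector) \<Rightarrow> bool" where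
  "smooth_on S f \<longleftrightarrow> (\<forall>k. C_k_on k S f)"

definition partial_deriv :: "'n::finite \<Rightarrow> (real^'n \<Rightarrow> real) \<Rightarrow> real^'n \<Rightarrow> real" where
  "partial_deriv i f x = frechet_derivative f (at x) (axis i 1)"


section \<open>Smooth manifolds\<close>

text \<open>The points of the manifold are the elements of a topological type \<open>'a\<close>; its dimension
  is \<open>CARD('n)\<close>. A chart is an open domain together with its coordinate map, whose values outside
  the domain are irrelevant.\<close>

type_synonym ('a, 'n) chart = "'a set \<times> ('a \<Rightarrow> real^'n)"

definition topological_chart :: "('a::topological_space, 'n::finite) chart \<Rightarrow> bool" where
  "topological_chart = (\<lambda>(U, x). open U \<and> open (x ` U) \<and> homeomorphism U (x ` U) x (inv_into U x))"

definition smoothly_compatible ::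
  "('a::topological_space, 'n::finite) chart \<Rightarrow> ('a, 'n) chart \<Rightarrow> bool" where
  "smoothly_compatible = (\<lambda>(U, x) (V, y).
     smooth_on (x ` (U \<inter> V)) (y \<circ> inv_into U x) \<and> smooth_on (y ` (U \<inter> V)) (x \<circ> inv_into V y))"

definition smooth_atlas ::
  "('a::{t2_space, second_countable_topology}, 'n::finite) chart set \<Rightarrow> bool" where
  "smooth_atlas A \<longleftrightarrow> (\<Union>c\<in>A. fst c) = UNIV \<and> (\<forall>c\<in>A. topological_chart c) \<and>
     (\<forall>c\<in>A. \<forall>c'\<in>A. smoothly_compatible c c')"

text \<open>The local coordinate systems are the charts of the maximal atlas containing \<open>A\<close>.\<close>

definition local_coords :: "('a::topological_space, 'n::finite) chart set \<Rightarrow> ('a, 'n) chart \<Rightarrow> bool" where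
  "local_coords A c \<longleftrightarrow> topological_chart c \<and> (\<forall>c'\<in>A. smoothly_compatible c c')"

definition smooth_fun ::
  "('a::topological_space, 'n::finite) chart set \<Rightarrow> 'a set \<Rightarrow> ('a \<Rightarrow> real) \<Rightarrow> bool" where
  "smooth_fun A U f \<longleftrightarrow> open U \<and> (\<forall>(V, x)\<in>A. smooth_on (x ` (U \<inter> V)) (f \<circ> inv_into V x))"

definition smooth_near ::
  "('a::topological_space, 'n::finite) chart set \<Rightarrow> 'a \<Rightarrow> ('a \<Rightarrow> real) \<Rightarrow> bool" where
  "smooth_near A p f \<longleftrightarrow> (\<exists>U. p \<in> U \<and> smooth_fun A U f)"


section \<open>Tangent vectors and vector fields\<close>

text \<open>A tangent vector at \<open>p\<close> is a directional derivative acting on functions that are smooth near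
  \<open>p\<close>. It is given the value 0 on all other functions, so that two tangent vectors at \<open>p\<close> are equal
  as soon as they agree on the functions smooth near \<open>p\<close>.\<close>

type_synonym 'a tangent = "('a \<Rightarrow> real) \<Rightarrow> real"
type_synonym 'a vfield = "'a \<Rightarrow> 'a tangent"

definition chart_vec ::
  "('a::topological_space, 'n::finite) chart set \<Rightarrow> ('a, 'n) chart \<Rightarrow> real^'n \<Rightarrow> 'a vfield" where
  "chart_vec A = (\<lambda>(U, x) w p f. if smooth_near A p f
     then frechet_derivative (f \<circ> inv_into U x) (at (x p)) w else 0)"

definition tangent_space ::
  "('a::topological_space, 'n::finite) chart set \<Rightarrow> 'a \<Rightarrow> 'a tangent set" where
  "tangent_space A p = {chart_vec A c w p | c w. c \<in> A \<and> p \<in> fst c}"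

text \<open>The coordinate vector field of index \<open>i\<close>; only its values on the domain of the chart matter.\<close>

definition coord_field ::
  "('a::topological_space, 'n::finite) chart set \<Rightarrow> ('a, 'n) chart \<Rightarrow> 'n \<Rightarrow> 'a vfield" where
  "coord_field A c i = chart_vec A c (axis i 1)"

definition vector_field ::
  "('a::topological_space, 'n::finite) chart set \<Rightarrow> 'a set \<Rightarrow> 'a vfield \<Rightarrow> bool" where
  "vector_field A U X \<longleftrightarrow> open U \<and> (\<forall>p\<in>U. X p \<in> tangent_space A p) \<and>
     (\<forall>V f. V \<subseteq> U \<and> smooth_fun A V f \<longrightarrow> smooth_fun A V (\<lambda>p. X p f))"

definition lie_bracket ::
  "('a::topological_space, 'n::finite) chart set \<Rightarrow> 'a vfield \<Rightarrow> 'a vfield \<Rightarrow> 'a vfield" where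
  "lie_bracket A X Y = (\<lambda>p f. if smooth_near A p f
     then X p (\<lambda>q. Y q f) - Y p (\<lambda>q. X q f) else 0)"

definition one_form ::
  "('a::topological_space, 'n::finite) chart set \<Rightarrow> ('a \<Rightarrow> 'a tangent \<Rightarrow> real) \<Rightarrow> bool" where
  "one_form A \<tau> \<longleftrightarrow>
     (\<forall>p. \<forall>v\<in>tangent_space A p. \<forall>w\<in>tangent_space A p. \<forall>a b.
        \<tau> p (\<lambda>f. a * v f + b * w f) = a * \<tau> p v + b * \<tau> p w) \<and>
     (\<forall>U X. vector_field A U X \<longrightarrow> smooth_fun A U (\<lambda>p. \<tau> p (X p)))"

definition riemannian_metric ::
  "('a::topological_space, 'n::finite) chart set \<Rightarrow>
   ('a \<Rightarrow> 'a tangent \<Rightarrow> 'a tangent \<Rightarrow> real) \<Rightarrow> bool" where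
  "riemannian_metric A g \<longleftrightarrow>
     (\<forall>p. \<forall>u\<in>tangent_space A p. \<forall>v\<in>tangent_space A p. \<forall>w\<in>tangent_space A p. \<forall>a b.
        g p (\<lambda>f. a * u f + b * v f) w = a * g p u w + b * g p v w) \<and>
     (\<forall>p. \<forall>v\<in>tangent_space A p. \<forall>w\<in>tangent_space A p. g p v w = g p w v) \<and>
     (\<forall>p. \<forall>v\<in>tangent_space A p. v \<noteq> (\<lambda>f. 0) \<longrightarrow> 0 < g p v v) \<and>
     (\<forall>U X Y. vector_field A U X \<and> vector_field A U Y \<longrightarrow> smooth_fun A U (\<lambda>p. g p (X p) (Y p)))"


section \<open>Affine connections\<close>

text \<open>\<open>nab p v Y\<close> is the covariant derivative at \<open>p\<close>, in the direction of the tangent vector \<open>v\<close>, of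
  a vector field \<open>Y\<close> defined near \<open>p\<close>. A connection is thus made to act on vector fields on open
  subsets (coordinate fields, for instance), which is why its locality is one of the axioms.\<close>

type_synonym 'a connection = "'a \<Rightarrow> 'a tangent \<Rightarrow> 'a vfield \<Rightarrow> 'a tangent"

definition cov :: "'a connection \<Rightarrow> 'a vfield \<Rightarrow> 'a vfield \<Rightarrow> 'a vfield" where
  "cov nab X Y = (\<lambda>p. nab p (X p) Y)"

definition affine_connection ::
  "('a::topological_space, 'n::finite) chart set \<Rightarrow> 'a connection \<Rightarrow> bool" where
  "affine_connection A nab \<longleftrightarrow>
     (\<forall>U X Y. vector_field A U X \<and> vector_field A U Y \<longrightarrow> vector_field A U (cov nab X Y)) \<and>
     (\<forall>U Y. vector_field A U Y \<longrightarrow> (\<forall>p\<in>U. \<forall>v\<in>tangent_space A p. \<forall>w\<in>tangent_space A p. \<forall>a b.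
        nab p (\<lambda>f. a * v f + b * w f) Y = (\<lambda>f. a * nab p v Y f + b * nab p w Y f))) \<and>
     (\<forall>U Y Z. vector_field A U Y \<and> vector_field A U Z \<longrightarrow> (\<forall>p\<in>U. \<forall>v\<in>tangent_space A p.
        nab p v (\<lambda>q f. Y q f + Z q f) = (\<lambda>f. nab p v Y f + nab p v Z f))) \<and>
     (\<forall>U h Y. smooth_fun A U h \<and> vector_field A U Y \<longrightarrow> (\<forall>p\<in>U. \<forall>v\<in>tangent_space A p.
        nab p v (\<lambda>q f. h q * Y q f) = (\<lambda>f. v h * Y p f + h p * nab p v Y f))) \<and>
     (\<forall>U Y Z. vector_field A U Y \<and> vector_field A U Z \<and> (\<forall>q\<in>U. Y q = Z q) \<longrightarrow>
        (\<forall>p\<in>U. \<forall>v\<in>tangent_space A p. nab p v Y = nab p v Z))"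

definition torsion_free ::
  "('a::topological_space, 'n::finite) chart set \<Rightarrow> 'a connection \<Rightarrow> bool" where
  "torsion_free A nab \<longleftrightarrow> (\<forall>U X Y. vector_field A U X \<and> vector_field A U Y \<longrightarrow>
     (\<forall>p\<in>U. \<forall>f. cov nab X Y p f - cov nab Y X p f = lie_bracket A X Y p f))"

definition curvature ::
  "('a::topological_space, 'n::finite) chart set \<Rightarrow> 'a connection \<Rightarrow>
   'a vfield \<Rightarrow> 'a vfield \<Rightarrow> 'a vfield \<Rightarrow> 'a vfield" where
  "curvature A nab X Y Z = (\<lambda>p f. cov nab X (cov nab Y Z) p f - cov nab Y (cov nab X Z) p f
     - cov nab (lie_bracket A X Y) Z p f)"

definition flat_connection ::
  "('a::topological_space, 'n::finite) chart set \<Rightarrow> 'a connection \<Rightarrow> bool" where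
  "flat_connection A nab \<longleftrightarrow>
     (\<forall>U X Y Z. vector_field A U X \<and> vector_field A U Y \<and> vector_field A U Z \<longrightarrow>
        (\<forall>p\<in>U. \<forall>f. curvature A nab X Y Z p f = 0))"

definition projectively_flat ::
  "('a::topological_space, 'n::finite) chart set \<Rightarrow> 'a connection \<Rightarrow> bool" where
  "projectively_flat A nab \<longleftrightarrow> (\<exists>nab0 \<tau>.
     affine_connection A nab0 \<and> torsion_free A nab0 \<and> flat_connection A nab0 \<and> one_form A \<tau> \<and>
     (\<forall>U X Y. vector_field A U X \<and> vector_field A U Y \<longrightarrow>
        (\<forall>p\<in>U. \<forall>f. cov nab X Y p f
            = cov nab0 X Y p f + \<tau> p (X p) * Y p f + \<tau> p (Y p) * X p f)))"

definition constant_sectional_curvature ::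
  "('a::topological_space, 'n::finite) chart set \<Rightarrow> ('a \<Rightarrow> 'a tangent \<Rightarrow> 'a tangent \<Rightarrow> real) \<Rightarrow>
   'a connection \<Rightarrow> real \<Rightarrow> bool" where
  "constant_sectional_curvature A g nab k \<longleftrightarrow>
     (\<forall>U X Y Z. vector_field A U X \<and> vector_field A U Y \<and> vector_field A U Z \<longrightarrow>
        (\<forall>p\<in>U. \<forall>f. curvature A nab X Y Z p f
            = k * (g p (Y p) (Z p) * X p f - g p (X p) (Z p) * Y p f)))"

definition dualistic_structure ::
  "('a::topological_space, 'n::finite) chart set \<Rightarrow> ('a \<Rightarrow> 'a tangent \<Rightarrow> 'a tangent \<Rightarrow> real) \<Rightarrow>
   'a connection \<Rightarrow> 'a connection \<Rightarrow> bool" where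
  "dualistic_structure A g nab nab' \<longleftrightarrow> riemannian_metric A g \<and>
     affine_connection A nab \<and> torsion_free A nab \<and>
     affine_connection A nab' \<and> torsion_free A nab' \<and>
     (\<forall>U X Y Z. vector_field A U X \<and> vector_field A U Y \<and> vector_field A U Z \<longrightarrow>
        (\<forall>p\<in>U. Z p (\<lambda>q. g q (X q) (Y q))
            = g p (cov nab Z X p) (Y p) + g p (X p) (cov nab' Z Y p)))"


section \<open>Geodesics and affine coordinate systems\<close>

definition christoffel ::
  "('a::topological_space, 'n::finite) chart set \<Rightarrow> 'a connection \<Rightarrow> ('a, 'n) chart \<Rightarrow>
   'n \<Rightarrow> 'n \<Rightarrow> 'n \<Rightarrow> 'a \<Rightarrow> real" where
  "christoffel A nab c k i j p = cov nab (coord_field A c i) (coord_field A c j) p (\<lambda>q. snd c q $ k)"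

text \<open>Affinely parametrized geodesics, on open time intervals; constant ones are included.\<close>

definition geodesic ::
  "('a::topological_space, 'n::finite) chart set \<Rightarrow> 'a connection \<Rightarrow> real set \<Rightarrow> (real \<Rightarrow> 'a) \<Rightarrow> bool" where
  "geodesic A nab I \<gamma> \<longleftrightarrow> open I \<and> is_interval I \<and> continuous_on I \<gamma> \<and>
     (\<forall>(V, x)\<in>A. \<exists>\<gamma>1 \<gamma>2. \<forall>t\<in>I. \<gamma> t \<in> V \<longrightarrow>
        ((x \<circ> \<gamma>) has_vector_derivative \<gamma>1 t) (at t) \<and>
        (\<gamma>1 has_vector_derivative \<gamma>2 t) (at t) \<and>
        (\<forall>k. \<gamma>2 t $ k
           + (\<Sum>i\<in>UNIV. \<Sum>j\<in>UNIV. christoffel A nab (V, x) k i j (\<gamma> t) * \<gamma>1 t $ i * \<gamma>1 t $ j) = 0))"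

text \<open>In an affine coordinate system each geodesic runs along a straight line (degenerate, with
  \<open>v = 0\<close>, for a constant geodesic); \<open>s\<close> is the change of the time parameter.\<close>

definition affine_coords ::
  "('a::topological_space, 'n::finite) chart set \<Rightarrow> 'a connection \<Rightarrow> ('a, 'n) chart \<Rightarrow> bool" where
  "affine_coords A nab c \<longleftrightarrow> local_coords A c \<and>
     (\<forall>I \<gamma>. geodesic A nab I \<gamma> \<and> \<gamma> ` I \<subseteq> fst c \<longrightarrow>
        (\<exists>a v s. (\<forall>t\<in>I. snd c (\<gamma> t) = a + s t *\<^sub>R v) \<and>
           (\<forall>t\<in>I. \<exists>s'>0. (s has_real_derivative s') (at t))))"


section \<open>Exponential concavity and convexity\<close>

definition exp_concave_on :: "real \<Rightarrow> 'e::real_vector set \<Rightarrow> ('e \<Rightarrow> real) \<Rightarrow> bool" where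
  "exp_concave_on \<alpha> S \<phi> \<longleftrightarrow> concave_on S (\<lambda>x. exp (\<alpha> * \<phi> x))"

definition exp_convex_on :: "real \<Rightarrow> 'e::real_vector set \<Rightarrow> ('e \<Rightarrow> real) \<Rightarrow> bool" where
  "exp_convex_on \<alpha> S \<phi> \<longleftrightarrow> convex_on S (\<lambda>x. exp (\<alpha> * \<phi> x))"

text \<open>Convexity of the neighbourhood \<open>N\<close> is part of \<open>concave_on\<close> and \<open>convex_on\<close>.\<close>

definition locally_exp_concave_on ::
  "real \<Rightarrow> 'e::real_normed_vector set \<Rightarrow> ('e \<Rightarrow> real) \<Rightarrow> bool" where
  "locally_exp_concave_on \<alpha> S \<phi> \<longleftrightarrow>
     (\<forall>x\<in>S. \<exists>N. open N \<and> x \<in> N \<and> N \<subseteq> S \<and> exp_concave_on \<alpha> N \<phi>)"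

definition locally_exp_convex_on ::
  "real \<Rightarrow> 'e::real_normed_vector set \<Rightarrow> ('e \<Rightarrow> real) \<Rightarrow> bool" where
  "locally_exp_convex_on \<alpha> S \<phi> \<longleftrightarrow>
     (\<forall>x\<in>S. \<exists>N. open N \<and> x \<in> N \<and> N \<subseteq> S \<and> exp_convex_on \<alpha> N \<phi>)"


section \<open>Divergences\<close>

text \<open>Meaningful where the argument of the logarithm is positive.\<close>

definition log_cost :: "real \<Rightarrow> real^'n::finite \<Rightarrow> real^'n \<Rightarrow> real" where
  "log_cost \<alpha> x y = ln (1 + \<alpha> * (x \<bullet> y)) / \<alpha>"

text \<open>The nondegeneracy often required of a divergence is contained in \<open>induces\<close> below, for
  a Riemannian metric \<open>g\<close>.\<close>

definition divergence_on ::
  "('a::topological_space, 'n::finite) chart set \<Rightarrow> 'a set \<Rightarrow> ('a \<Rightarrow> 'a \<Rightarrow> real) \<Rightarrow> bool" where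
  "divergence_on A U D \<longleftrightarrow> open U \<and>
     (\<forall>q\<in>U. \<forall>p\<in>U. 0 \<le> D q p \<and> (D q p = 0 \<longleftrightarrow> q = p)) \<and>
     (\<forall>(V, x)\<in>A. \<forall>(W, y)\<in>A. smooth_on (x ` (U \<inter> V) \<times> y ` (U \<inter> W))
        (\<lambda>(a, b). D (inv_into V x a) (inv_into W y b)))"

text \<open>In the three formulas \<open>a\<close>, \<open>a'\<close> are coordinates of the first argument of \<open>D\<close>, and
  \<open>b\<close>, \<open>b'\<close> coordinates of the second one.\<close>

definition induces ::
  "('a::topological_space, 'n::finite) chart set \<Rightarrow> 'a set \<Rightarrow> ('a \<Rightarrow> 'a \<Rightarrow> real) \<Rightarrow>
   ('a \<Rightarrow> 'a tangent \<Rightarrow> 'a tangent \<Rightarrow> real) \<Rightarrow> 'a connection \<Rightarrow> 'a connection \<Rightarrow> bool" where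
  "induces A U D g nab nab' \<longleftrightarrow>
     (\<forall>V x. local_coords A (V, x) \<longrightarrow> (\<forall>r\<in>U \<inter> V.
        let Dx = (\<lambda>a b. D (inv_into V x a) (inv_into V x b)); E = coord_field A (V, x) in
        (\<forall>i j. g r (E i r) (E j r)
           = - partial_deriv i (\<lambda>a. partial_deriv j (\<lambda>b. Dx a b) (x r)) (x r)) \<and>
        (\<forall>i j k. g r (cov nab (E i) (E j) r) (E k r)
           = - partial_deriv i (\<lambda>a. partial_deriv j (\<lambda>a'.
                 partial_deriv k (\<lambda>b. Dx a' b) (x r)) a) (x r)) \<and>
        (\<forall>i j k. g r (cov nab' (E i) (E j) r) (E k r)
           = - partial_deriv i (\<lambda>b. partial_deriv j (\<lambda>b'.
                 partial_deriv k (\<lambda>a. Dx a b') (x r)) b) (x r))))"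

end

theory Submission
  imports Defs
begin

text \<open>Let \<open>k\<close> be the common curvature, \<open>k = - \<alpha>\<close> or \<open>k = \<alpha>\<close>. For a connection of constant curvature
  whose dual is torsion-free, the equation \<open>Hess f = - k f g\<close> is, as a first-order system for the pair
  \<open>(f, df)\<close>, a flat linear connection on a bundle of rank \<open>d + 1\<close>; so near each point it has a
  \<open>(d + 1)\<close>-dimensional space of solutions. Let \<open>f 0, \<dots>, f d\<close> and \<open>h 0, \<dots>, h d\<close> be suitably dual
  solutions for \<open>nab\<close> and \<open>nab'\<close>, and let \<open>P q p\<close> be the sum of \<open>f 0 q * h 0 p\<close> and of all
  \<open>\<alpha> * f i q * h i p\<close> (the index \<open>None\<close> plays the part of 0). Uniqueness for a linear system
  shows that on the diagonal \<open>P = 1\<close>, both first differentials of \<open>P\<close> vanish and its mixed second differential is \<open>k g\<close>; moreover the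
  Hessian of \<open>P\<close> in either argument is \<open>- k P g\<close>, whence \<open>- k (P - 1) > 0\<close> off the diagonal.

  The coordinates are \<open>\<xi> i = f i / f 0\<close> and \<open>\<eta> i = h i / h 0\<close>, with potentials \<open>- ln (f 0) / \<alpha>\<close> and
  \<open>- ln (h 0) / \<alpha>\<close>. Then \<open>1 + \<alpha> (\<xi> q \<bullet> \<eta> p) = P q p / (f 0 q * h 0 p)\<close>, so that the
  divergence is \<open>- ln P / k\<close>, and the sign of \<open>P - 1\<close> gives at once its positivity and the supporting
  affine functions of \<open>1 / f 0\<close>. Along a geodesic all \<open>f i\<close> solve the same second-order linear
  equation, so their Wronskians with \<open>f 0\<close> are constant and \<open>\<xi>\<close> runs along a straight line.\<close>

section \<open>Calculus of \<open>C_k\<close> maps\<close>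

text \<open>Flatness of the system for \<open>(f, df)\<close> splits into blocks: symmetry of
  \<open>g\<close> together with vanishing torsion, the equation of constant curvature, and the
  Codazzi equation, which holds because the dual connection is torsion-free. The values of
  \<open>P\<close> on the diagonal come from the same two systems: the matrix of the pairings of the
  1-jets and the matrix diag(1, k g) solve one and the same linear equation, the latter by duality,
  so they need to agree at one point only.

  Two demands shape what follows. The coordinates must belong to the maximal atlas, so \<xi> has to
  be injective and open with a smooth inverse; injectivity is read off from the sign of
  \<open>P - 1\<close>, and nondegeneracy of the derivative from the mixed second differential of
  \<open>P\<close>. The divergence must induce the structure in every chart, so the relations
  between the solutions are restated for tangent vectors and vector fields, away from the chart in
  which they were found. The setting is symmetric in the two connections, so every fact on \<xi>
  yields one on \<eta>.\<close>

lemma has_derivative_frechet: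
  assumes "f differentiable (at x)"
  shows "(f has_derivative frechet_derivative f (at x)) (at x)"
  using assms frechet_derivative_works by blast

lemma frechet_derivative_eqI:
  assumes "(f has_derivative f') (at x)"
  shows "frechet_derivative f (at x) = f'"
  using frechet_derivative_at[OF assms] by simp

lemma frechet_derivative_cong_open:
  assumes "open S" "x \<in> S" "\<And>y. y \<in> S \<Longrightarrow> f y = g y"
  shows "frechet_derivative f (at x) = frechet_derivative g (at x)"
proof -
  have "(f has_derivative d) (at x) \<longleftrightarrow> (g has_derivative d) (at x)" for d
    using has_derivative_transform_within_open[OF _ assms(1,2), where f=f and g=g and f'=d]
      has_derivative_transform_within_open[OF _ assms(1,2), where f=g and g=f and f'=d] assms(3)
    by (metis (no_types, lifting))
  then show ?thesis by (simp add: frechet_derivative_def)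
qed

lemma C_k_on_SucD:
  assumes "C_k_on (Suc k) S f"
  shows "x \<in> S \<Longrightarrow> (f has_derivative frechet_derivative f (at x)) (at x)"
    and "C_k_on k S (\<lambda>x. frechet_derivative f (at x) v)"
  using assms has_derivative_frechet by auto

lemma C_k_on_subset: "C_k_on k S f \<Longrightarrow> T \<subseteq> S \<Longrightarrow> C_k_on k T f"
  by (induction k arbitrary: f) (auto intro: continuous_on_subset)

lemma C_k_on_cong:
  assumes "open S" "\<And>x. x \<in> S \<Longrightarrow> f x = g x" "C_k_on k S f"
  shows "C_k_on k S g"
  using assms(2,3)
proof (induction k arbitrary: f g)
  case 0
  then show ?case using continuous_on_cong[of S S f g] by simp
next
  case (Suc k)
  have "g differentiable (at x)" if "x \<in> S" for x
    using has_derivative_transform_within_open[OF C_k_on_SucD(1)[OF Suc.prems(2) that] assms(1) that]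
      Suc.prems(1) unfolding differentiable_def by blast
  moreover have "C_k_on k S (\<lambda>x. frechet_derivative g (at x) v)" for v
  proof (rule Suc.IH)
    show "C_k_on k S (\<lambda>x. frechet_derivative f (at x) v)" using Suc.prems(2) by simp
    show "frechet_derivative f (at x) v = frechet_derivative g (at x) v" if "x \<in> S" for x
      using fun_cong[OF frechet_derivative_cong_open[OF assms(1) that Suc.prems(1)]] .
  qed
  ultimately show ?case by simp
qed

text \<open>\<open>frechet_derivative\<close> is a chosen value; this rule lets a derivative given
  by a formula on the open set stand for it. Most inductions on \<open>k\<close> below are closed by
  it.\<close>

lemma C_k_on_SucI:
  assumes "open S" "\<And>x. x \<in> S \<Longrightarrow> (f has_derivative f' x) (at x)" "\<And>v. C_k_on k S (\<lambda>x. f' x v)"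
  shows "C_k_on (Suc k) S f"
proof -
  have "C_k_on k S (\<lambda>x. frechet_derivative f (at x) v)" for v
    by (rule C_k_on_cong[OF assms(1) _ assms(3)[of v]])
      (simp add: frechet_derivative_eqI[OF assms(2)])
  then show ?thesis using assms(2) by (auto simp: differentiable_def)
qed

lemma C_k_on_lower: "C_k_on (Suc k) S f \<Longrightarrow> C_k_on k S f"
proof (induction k arbitrary: f)
  case 0
  then have "\<forall>x\<in>S. f differentiable (at x)" by simp
  then show ?case
    by (simp add: continuous_at_imp_continuous_on differentiable_imp_continuous_within)
next
  case (Suc k)
  have "C_k_on k S (\<lambda>x. frechet_derivative f (at x) v)" for v
    using Suc.prems by (intro Suc.IH) simp
  then show ?case using Suc.prems by simp
qed

lemma C_k_on_imp_continuous: "C_k_on k S f \<Longrightarrow> continuous_on S f"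
proof (induction k)
  case (Suc k)
  show ?case by (rule Suc.IH[OF C_k_on_lower[OF Suc.prems]])
qed simp

text \<open>Regularity of a change of charts is verified near each point, through an atlas chart
  that depends on the point; this glues the local statements.\<close>

lemma C_k_on_local:
  assumes "\<And>x. x \<in> S \<Longrightarrow> \<exists>T. open T \<and> x \<in> T \<and> C_k_on k T f"
  shows "C_k_on k S f"
  using assms
proof (induction k arbitrary: f)
  case 0
  show ?case unfolding C_k_on.simps continuous_on_eq_continuous_within
  proof
    fix x assume "x \<in> S"
    then obtain T where "open T" "x \<in> T" "continuous_on T f" using 0 by auto
    then show "continuous (at x within S) f"
      by (meson continuous_at_imp_continuous_at_within continuous_on_eq_continuous_at)
  qed
next
  case (Suc k)
  have "C_k_on k S (\<lambda>x. frechet_derivative f (at x) v)" for v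
  proof (rule Suc.IH)
    fix x assume "x \<in> S"
    from Suc.prems[OF this] show "\<exists>T. open T \<and> x \<in> T \<and> C_k_on k T (\<lambda>x. frechet_derivative f (at x) v)"
      by auto
  qed
  moreover have "\<forall>x\<in>S. f differentiable (at x)" using Suc.prems by auto
  ultimately show ?case by simp
qed

section \<open>Closure of C_k maps under algebraic operations\<close>

lemma C_k_on_const [simp]: "C_k_on k S (\<lambda>x. c)"
  by (induction k arbitrary: c) auto

lemma C_k_on_add:
  assumes "open S" "C_k_on k S f" "C_k_on k S g"
  shows "C_k_on k S (\<lambda>x. f x + g x)"
  using assms(2,3)
proof (induction k arbitrary: f g)
  case (Suc k)
  show ?case
    by (rule C_k_on_SucI[OF assms(1), where f' = "\<lambda>x v. frechet_derivative f (at x) v + frechet_derivative g (at x) v"])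
      (use Suc C_k_on_SucD in \<open>blast intro: has_derivative_add\<close>)+
qed (auto intro: continuous_intros)

lemma C_k_on_sum:
  assumes "open S" "\<And>i. i \<in> I \<Longrightarrow> C_k_on k S (f i)"
  shows "C_k_on k S (\<lambda>x. \<Sum>i\<in>I. f i x)"
  using assms(2) by (induction I rule: infinite_finite_induct) (auto intro: C_k_on_add[OF assms(1)])

lemma C_k_on_linear:
  assumes "open S" "bounded_linear L" "C_k_on k S f"
  shows "C_k_on k S (\<lambda>x. L (f x))"
  using assms(3)
proof (induction k arbitrary: f)
  case 0
  then show ?case using bounded_linear.continuous_on[OF assms(2)] by simp
next
  case (Suc k)
  show ?case
    by (rule C_k_on_SucI[OF assms(1), where f' = "\<lambda>x v. L (frechet_derivative f (at x) v)"])
      (use Suc C_k_on_SucD bounded_linear.has_derivative[OF assms(2)] in blast)+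
qed

lemma C_k_on_bounded_linear: 
  assumes "bounded_linear L" shows "C_k_on k S L"
proof (cases k)
  case 0 then show ?thesis using assms linear_continuous_on by auto
next
  case (Suc l)
  have "frechet_derivative L (at x) = L" for x
    by (rule frechet_derivative_eqI) (rule bounded_linear_imp_has_derivative[OF assms])
  then show ?thesis using Suc assms by (auto simp: bounded_linear_imp_differentiable)
qed

lemma C_k_on_bilinear:
  assumes "open S" "bounded_bilinear b" "C_k_on k S f" "C_k_on k S g"
  shows "C_k_on k S (\<lambda>x. b (f x) (g x))"
  using assms(3,4)
proof (induction k arbitrary: f g)
  case 0
  then show ?case using bounded_bilinear.continuous_on[OF assms(2)] by simp
next
  case (Suc k)
  show ?case
  proof (rule C_k_on_SucI[OF assms(1)])
    fix x assume "x \<in> S"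
    show "((\<lambda>x. b (f x) (g x)) has_derivative (\<lambda>v. b (f x) (frechet_derivative g (at x) v)
        + b (frechet_derivative f (at x) v) (g x))) (at x)"
      using bounded_bilinear.FDERIV[OF assms(2) C_k_on_SucD(1)[OF Suc.prems(1) \<open>x \<in> S\<close>]
          C_k_on_SucD(1)[OF Suc.prems(2) \<open>x \<in> S\<close>]] .
  next
    fix v
    show "C_k_on k S (\<lambda>x. b (f x) (frechet_derivative g (at x) v)
        + b (frechet_derivative f (at x) v) (g x))"
      using Suc.prems[THEN C_k_on_lower] Suc.prems[THEN C_k_on_SucD(2)]
      by (intro C_k_on_add[OF assms(1)] Suc.IH)
  qed
qed

lemmas C_k_on_mult = C_k_on_bilinear[OF _ bounded_bilinear_mult]
lemmas C_k_on_scaleR = C_k_on_bilinear[OF _ bounded_bilinear_scaleR]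

lemma C_k_on_prod:
  fixes f :: "'i \<Rightarrow> 'e::euclidean_space \<Rightarrow> real"
  assumes "open S" "\<And>i. i \<in> I \<Longrightarrow> C_k_on k S (f i)"
  shows "C_k_on k S (\<lambda>x. \<Prod>i\<in>I. f i x)"
  using assms(2) by (induction I rule: infinite_finite_induct) (auto intro: C_k_on_mult[OF assms(1)])

lemma C_k_on_inverse:
  fixes f :: "'e::euclidean_space \<Rightarrow> real"
  assumes "open S" "\<And>x. x \<in> S \<Longrightarrow> f x \<noteq> 0" "C_k_on k S f"
  shows "C_k_on k S (\<lambda>x. inverse (f x))"
  using assms(3)
proof (induction k)
  case 0
  then show ?case using assms(2) by (auto intro: continuous_intros)
next
  case (Suc k)
  \<comment> \<open>The derivative of 1 / f contains 1 / f again; the induction hypothesis supplies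
    it at order \<open>k\<close>.\<close>
  have IH: "C_k_on k S (\<lambda>x. inverse (f x))" using Suc C_k_on_lower by blast
  show ?case
  proof (rule C_k_on_SucI[OF assms(1)])
    fix x assume "x \<in> S"
    then show "((\<lambda>x. inverse (f x)) has_derivative (\<lambda>v. - 1 *
        (inverse (f x) * frechet_derivative f (at x) v * inverse (f x)))) (at x)"
      using Deriv.has_derivative_inverse[OF assms(2) C_k_on_SucD(1)[OF Suc.prems], of x] by simp
  next
    fix v
    show "C_k_on k S (\<lambda>x. - 1 * (inverse (f x) * frechet_derivative f (at x) v * inverse (f x)))"
      using Suc.prems IH by (intro C_k_on_mult[OF assms(1)]) auto
  qed
qed

lemma C_k_on_divide:
  fixes f :: "'e::euclidean_space \<Rightarrow> real"
  assumes "open S" "\<And>x. x \<in> S \<Longrightarrow> g x \<noteq> 0" "C_k_on k S f" "C_k_on k S g"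
  shows "C_k_on k S (\<lambda>x. f x / g x)"
  using C_k_on_mult[OF assms(1,3) C_k_on_inverse[OF assms(1,2,4)]] by (simp add: divide_inverse)

text \<open>The derivative of ln f is a quotient of maps already treated, so a single
  differentiation replaces the induction.\<close>

lemma C_k_on_ln:
  fixes f :: "'e::euclidean_space \<Rightarrow> real"
  assumes "open S" "\<And>x. x \<in> S \<Longrightarrow> f x > 0" "C_k_on k S f"
  shows "C_k_on k S (\<lambda>x. ln (f x))"
proof (cases k)
  case 0
  then show ?thesis using assms by (fastforce intro: continuous_intros)
next
  case (Suc l)
  then have C: "C_k_on (Suc l) S f" using assms(3) by simp
  have nz: "f x \<noteq> 0" if "x \<in> S" for x using assms(2)[OF that] by simp
  show ?thesis unfolding Suc
  proof (rule C_k_on_SucI[OF assms(1)])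
    fix x assume "x \<in> S"
    then show "((\<lambda>x. ln (f x)) has_derivative (\<lambda>v. frechet_derivative f (at x) v / f x)) (at x)"
      using has_derivative_ln[OF assms(2) C_k_on_SucD(1)[OF C], of x]
      by (simp add: divide_inverse)
  next
    fix v
    show "C_k_on l S (\<lambda>x. frechet_derivative f (at x) v / f x)"
      by (rule C_k_on_divide[OF assms(1) nz C_k_on_SucD(2)[OF C] C_k_on_lower[OF C]])
  qed
qed

lemma C_k_on_componentwise:
  assumes "open S" "\<And>b. b \<in> Basis \<Longrightarrow> C_k_on k S (\<lambda>x. f x \<bullet> b)"
  shows "C_k_on k S (f :: 'e::euclidean_space \<Rightarrow> 'f::euclidean_space)"
proof -
  have "C_k_on k S (\<lambda>x. \<Sum>b\<in>Basis. (f x \<bullet> b) *\<^sub>R b)"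
    by (rule C_k_on_sum[OF assms(1)]) (rule C_k_on_scaleR[OF assms(1) assms(2) C_k_on_const])
  then show ?thesis unfolding euclidean_representation .
qed

lemma C_k_on_vec:
  fixes f :: "'e::euclidean_space \<Rightarrow> real^'n"
  assumes "open S" "\<And>i. C_k_on k S (\<lambda>x. f x $ i)"
  shows "C_k_on k S f"
  by (rule C_k_on_componentwise[OF assms(1)]) (auto simp: Basis_vec_def inner_axis assms(2))

lemma C_k_on_vec_nth:
  fixes f :: "'e::euclidean_space \<Rightarrow> real^'n"
  assumes "open S" "C_k_on k S f"
  shows "C_k_on k S (\<lambda>x. f x $ i)"
  using C_k_on_linear[OF assms(1) bounded_linear_vec_nth assms(2)] .

section \<open>Composition, determinants and inverse maps\<close>

lemma linear_eq_sum_Basis: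
  assumes "linear f"
  shows "f v = (\<Sum>b\<in>Basis. (v \<bullet> b) *\<^sub>R f b)"
proof -
  have "f v = f (\<Sum>b\<in>Basis. (v \<bullet> b) *\<^sub>R b)" by (simp add: euclidean_representation)
  then show ?thesis using assms by (simp add: linear_sum linear_cmul)
qed

text \<open>\<open>C_k_on\<close> controls derivatives in fixed directions, while the chain rule
  evaluates the derivative of \<open>f\<close> in the varying direction
  \<open>frechet_derivative g (at x) v\<close>. Expanding that direction in the basis leaves fixed
  directions with scalar coefficients.\<close>

lemma C_k_on_compose:
  fixes f :: "'f::euclidean_space \<Rightarrow> 'g::real_normed_vector" and g :: "'e::euclidean_space \<Rightarrow> 'f"
  assumes "open S" "open T" "\<And>x. x \<in> S \<Longrightarrow> g x \<in> T" "C_k_on k T f" "C_k_on k S g"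
  shows "C_k_on k S (\<lambda>x. f (g x))"
  using assms(4,5)
proof (induction k arbitrary: f)
  case 0
  then show ?case using assms(3) continuous_on_compose2[of T f S g] by auto
next
  case (Suc k)
  show ?case
  proof (rule C_k_on_SucI[OF assms(1)])
    fix x assume x: "x \<in> S"
    let ?D = "frechet_derivative f (at (g x))" and ?E = "frechet_derivative g (at x)"
    have D: "(f has_derivative ?D) (at (g x))" using C_k_on_SucD(1)[OF Suc.prems(1)] assms(3) x by blast
    have "?D (?E v) = (\<Sum>b\<in>Basis. (?E v \<bullet> b) *\<^sub>R ?D b)" for v
      by (rule linear_eq_sum_Basis) (rule has_derivative_linear[OF D])
    then show "((\<lambda>x. f (g x)) has_derivative (\<lambda>v. \<Sum>b\<in>Basis. (?E v \<bullet> b) *\<^sub>R ?D b)) (at x)"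
      using has_derivative_compose[OF C_k_on_SucD(1)[OF Suc.prems(2) x] D] by simp
  next
    fix v
    have "C_k_on k S (\<lambda>x. frechet_derivative f (at (g x)) b)" for b
      by (rule Suc.IH[OF C_k_on_SucD(2)[OF Suc.prems(1)] C_k_on_lower[OF Suc.prems(2)]])
    moreover have "C_k_on k S (\<lambda>x. frechet_derivative g (at x) v \<bullet> b)" for b
      by (rule C_k_on_linear[OF assms(1) bounded_linear_inner_left C_k_on_SucD(2)[OF Suc.prems(2)]])
    ultimately show "C_k_on k S (\<lambda>x. \<Sum>b\<in>Basis. (frechet_derivative g (at x) v \<bullet> b) *\<^sub>R
        frechet_derivative f (at (g x)) b)"
      by (intro C_k_on_sum C_k_on_scaleR assms(1))
  qed
qed

lemma C_k_on_det:
  fixes M :: "'e::euclidean_space \<Rightarrow> real^'n^'n"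
  assumes "open S" "\<And>i j. C_k_on k S (\<lambda>x. M x $ i $ j)"
  shows "C_k_on k S (\<lambda>x. det (M x))"
  unfolding det_def
  by (rule C_k_on_sum[OF assms(1)], rule C_k_on_mult[OF assms(1) C_k_on_const],
      rule C_k_on_prod[OF assms(1)], rule assms(2))

text \<open>The inverse of the Jacobian matrix is written out by Cramer's rule, so that its entries
  are as often differentiable as those of the matrix.\<close>

lemma C_k_on_inverse_map:
  fixes f :: "real^'n \<Rightarrow> real^'n"
  assumes "open S" "open T" and f: "\<And>k. C_k_on k S f" and g: "continuous_on T g"
    and gS: "\<And>y. y \<in> T \<Longrightarrow> g y \<in> S" and fg: "\<And>y. y \<in> T \<Longrightarrow> f (g y) = y"
    and inj: "\<And>x v. x \<in> S \<Longrightarrow> frechet_derivative f (at x) v = 0 \<Longrightarrow> v = 0"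
  shows "C_k_on k T g"
proof -
  define M where "M x = matrix (frechet_derivative f (at x))" for x
  have df: "(f has_derivative frechet_derivative f (at x)) (at x)" if "x \<in> S" for x
    using C_k_on_SucD(1)[OF f that] .
  have Mv: "M x *v v = frechet_derivative f (at x) v" if "x \<in> S" for x v
    unfolding M_def by (rule fun_cong[OF matrix_vector_mul(2)[OF has_derivative_linear[OF df[OF that]]]])
  have det: "det (M x) \<noteq> 0" if "x \<in> S" for x
  proof -
    have "\<exists>B. B ** M x = mat 1" using inj[OF that] Mv[OF that] by (simp add: matrix_left_invertible_ker)
    then show ?thesis by (simp add: invertible_left_inverse[symmetric] invertible_det_nz)
  qed
  define R where "R v x = (\<chi> k. det (\<chi> i j. if j = k then v $ i else M x $ i $ j) / det (M x))" for v x
  have R: "M x *v R v x = v" if "x \<in> S" for x v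
    unfolding R_def by (rule iffD2[OF cramer[OF det[OF that]] refl])
  have Rlin: "linear (\<lambda>v. R v x)" and R': "R (M x *v v) x = v" if "x \<in> S" for x v
  proof -
    have "R (M x *v v) x = v" for v
      using cramer[OF det[OF that], of v "M x *v v"] unfolding R_def by (rule iffD1[THEN sym]) (rule refl)
    then show "R (M x *v v) x = v" .
    have "R (M x *v R v x + M x *v R w x) x = R v x + R w x" "R (c *\<^sub>R (M x *v R v x)) x = c *\<^sub>R R v x" for v w c
      using \<open>\<And>v. R (M x *v v) x = v\<close>[of "R v x + R w x"] \<open>\<And>v. R (M x *v v) x = v\<close>[of "c *\<^sub>R R v x"]
      by (simp_all add: matrix_vector_right_distrib matrix_vector_mult_scaleR)
    then show "linear (\<lambda>v. R v x)" unfolding R[OF that] by (intro linearI)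
  qed
  \<comment> \<open>Continuity of \<open>g\<close> and invertibility of the derivative of
    \<open>f\<close> suffice to differentiate the inverse.\<close>
  have dg: "(g has_derivative (\<lambda>v. R v (g y))) (at y)" if y: "y \<in> T" for y
  proof (rule has_derivative_inverse_basic[where f = f and g = g, OF df[OF gS[OF y]]])
    show "bounded_linear (\<lambda>v. R v (g y))"
      using Rlin[OF gS[OF y]] linear_conv_bounded_linear by blast
    show "(\<lambda>v. R v (g y)) \<circ> frechet_derivative f (at (g y)) = id"
      using R'[OF gS[OF y]] unfolding Mv[OF gS[OF y]] by (intro ext) simp
    show "continuous (at y) g" using g y \<open>open T\<close> continuous_on_eq_continuous_at by blast
  qed (use assms y in auto)
  have CM: "C_k_on k S (\<lambda>x. M x $ i $ j)" for k i j
  proof -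
    have "(\<lambda>x. M x $ i $ j) = (\<lambda>x. frechet_derivative f (at x) (axis j 1) $ i)"
      by (simp add: M_def matrix_def)
    then show ?thesis using C_k_on_vec_nth[OF \<open>open S\<close> C_k_on_SucD(2)[OF f]] by metis
  qed
  have CR: "C_k_on k S (R v)" for k v
    unfolding R_def
  proof (rule C_k_on_vec[OF \<open>open S\<close>], unfold vec_lambda_beta, intro C_k_on_divide[OF \<open>open S\<close>] C_k_on_det[OF \<open>open S\<close>])
    show "C_k_on k S (\<lambda>x. (\<chi> i j. if j = l then v $ i else M x $ i $ j) $ i $ j)" for i j l
      by (cases "j = l") (simp_all add: CM)
  qed (auto simp: CM det)
  \<comment> \<open>Bootstrapping: the derivative of \<open>g\<close> at \<open>y\<close> is
    \<open>R v\<close> at the point \<open>g y\<close>, so each order of regularity of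
    \<open>g\<close> yields the next.\<close>
  show ?thesis
  proof (induction k)
    case (Suc k)
    show ?case
      by (rule C_k_on_SucI[OF \<open>open T\<close> dg])
        (auto intro: C_k_on_compose[OF \<open>open T\<close> \<open>open S\<close> gS CR Suc])
  qed (simp add: g)
qed

text \<open>By the mean value theorem both iterated derivatives are limits of this difference quotient,
  which is symmetric in \<open>v\<close> and \<open>w\<close>.\<close>

lemma second_difference:
  fixes f :: "'e::euclidean_space \<Rightarrow> real"
  assumes C: "C_k_on 2 S f" and t: "t > 0"
    and S: "\<And>a b. 0 \<le> a \<Longrightarrow> a \<le> t \<Longrightarrow> 0 \<le> b \<Longrightarrow> b \<le> t \<Longrightarrow> x + a *\<^sub>R v + b *\<^sub>R w \<in> S"
  obtains a b where "0 \<le> a" "a \<le> t" "0 \<le> b" "b \<le> t"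
    "f (x + t *\<^sub>R v + t *\<^sub>R w) - f (x + t *\<^sub>R v) - f (x + t *\<^sub>R w) + f x =
     t^2 * frechet_derivative (\<lambda>y. frechet_derivative f (at y) v) (at (x + a *\<^sub>R v + b *\<^sub>R w)) w"
proof -
  define F where "F y = frechet_derivative f (at y) v" for y
  have C': "C_k_on (Suc (Suc 0)) S f" using C by (simp add: numeral_2_eq_2)
  have d1: "(f has_derivative frechet_derivative f (at y)) (at y)" if "y \<in> S" for y
    using C_k_on_SucD(1)[OF C' that] .
  have d2: "(F has_derivative frechet_derivative F (at y)) (at y)" if "y \<in> S" for y
    unfolding F_def using C_k_on_SucD(1)[OF C_k_on_SucD(2)[OF C'] that] .
  \<comment> \<open>The second difference is the increment of
    \<open>f (x + s v + t w) - f (x + s v)\<close> between \<open>s = 0\<close> and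
    \<open>s = t\<close>. The mean value theorem is applied to it in \<open>s\<close>, and
    afterwards to \<open>F\<close> along \<open>w\<close>.\<close>
  have "((\<lambda>s. f (x + s *\<^sub>R v + t *\<^sub>R w) - f (x + s *\<^sub>R v)) has_real_derivative
      F (x + s *\<^sub>R v + t *\<^sub>R w) - F (x + s *\<^sub>R v)) (at s)" if "0 \<le> s" "s \<le> t" for s
  proof -
    have e: "F y * r = frechet_derivative f (at y) (r *\<^sub>R v)" if "y \<in> S" for y r
      using linear_cmul[OF has_derivative_linear[OF d1[OF that]], of r v] by (simp add: F_def)
    have s: "x + s *\<^sub>R v + t *\<^sub>R w \<in> S" "x + s *\<^sub>R v \<in> S" using S[of s t] S[of s 0] that t by auto
    have "((\<lambda>s. f (x + s *\<^sub>R v + b *\<^sub>R w)) has_derivative (\<lambda>r. F (x + s *\<^sub>R v + b *\<^sub>R w) * r)) (at s)"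
      if "x + s *\<^sub>R v + b *\<^sub>R w \<in> S" for b
      unfolding e[OF that]
      by (rule has_derivative_compose[where f = "\<lambda>s. x + s *\<^sub>R v + b *\<^sub>R w" and g = f, OF _ d1[OF that]])
        (auto intro!: derivative_eq_intros)
    from this[of t] this[of 0] s show ?thesis
      by (intro DERIV_diff) (simp_all add: has_field_derivative_def)
  qed
  from MVT2[of 0 t, OF t this] obtain a where a: "0 < a" "a < t" 
    "f (x + t *\<^sub>R v + t *\<^sub>R w) - f (x + t *\<^sub>R v) - (f (x + t *\<^sub>R w) - f x) =
      t * (F (x + a *\<^sub>R v + t *\<^sub>R w) - F (x + a *\<^sub>R v))" by auto
  have "((\<lambda>s. F (x + a *\<^sub>R v + s *\<^sub>R w)) has_real_derivative
      frechet_derivative F (at (x + a *\<^sub>R v + s *\<^sub>R w)) w) (at s)" if "0 \<le> s" "s \<le> t" for s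
  proof -
    have s: "x + a *\<^sub>R v + s *\<^sub>R w \<in> S" using S[of a s] a that by auto
    have e: "frechet_derivative F (at (x + a *\<^sub>R v + s *\<^sub>R w)) w * r 
        = frechet_derivative F (at (x + a *\<^sub>R v + s *\<^sub>R w)) (r *\<^sub>R w)" for r
      using linear_cmul[OF has_derivative_linear[OF d2[OF s]], of r w] by simp
    show ?thesis unfolding has_field_derivative_def e
      by (rule has_derivative_compose[where f = "\<lambda>s. x + a *\<^sub>R v + s *\<^sub>R w" and g = F, OF _ d2[OF s]])
        (auto intro!: derivative_eq_intros)
  qed
  from MVT2[of 0 t, OF t this] obtain b where b: "0 < b" "b < t" 
    "F (x + a *\<^sub>R v + t *\<^sub>R w) - F (x + a *\<^sub>R v)
      = t * frechet_derivative F (at (x + a *\<^sub>R v + b *\<^sub>R w)) w" by auto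
  have "f (x + t *\<^sub>R v + t *\<^sub>R w) - f (x + t *\<^sub>R v) - f (x + t *\<^sub>R w) + f x =
     t^2 * frechet_derivative F (at (x + a *\<^sub>R v + b *\<^sub>R w)) w"
    using a(3) b(3) by (simp add: power2_eq_square algebra_simps)
  then show thesis using that[of a b] a b unfolding F_def by simp
qed

lemma second_derivative_symmetric:
  fixes f :: "'e::euclidean_space \<Rightarrow> real"
  assumes "open S" "C_k_on 2 S f" "x \<in> S"
  shows "frechet_derivative (\<lambda>y. frechet_derivative f (at y) v) (at x) w
       = frechet_derivative (\<lambda>y. frechet_derivative f (at y) w) (at x) v"
proof (rule ccontr)
  define H where "H v w y = frechet_derivative (\<lambda>y. frechet_derivative f (at y) v) (at y) w" for v w y
  assume "\<not> ?thesis"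
  then have ne: "\<bar>H v w x - H w v x\<bar> > 0" (is "?e > 0") by (simp add: H_def)
  have "continuous_on S (H v w)" for v w using assms(2) by (simp add: numeral_2_eq_2 H_def)
  then have "isCont (H v w) x" for v w
    using continuous_on_eq_continuous_at[OF assms(1)] assms(3) by blast
  then have "\<forall>e>0. \<exists>d>0. \<forall>y. norm (y - x) < d \<longrightarrow> \<bar>H v w y - H v w x\<bar> < e" for v w
    unfolding continuous_at_eps_delta by (simp add: dist_norm)
  from this[of v w, rule_format, of "?e/2"] this[of w v, rule_format, of "?e/2"] ne
  obtain d1 d2 where d: "d1 > 0" "d2 > 0"
    "\<And>y. norm (y - x) < d1 \<Longrightarrow> \<bar>H v w y - H v w x\<bar> < ?e/2"
    "\<And>y. norm (y - x) < d2 \<Longrightarrow> \<bar>H w v y - H w v x\<bar> < ?e/2" by auto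
  obtain d3 where d3: "d3 > 0" "ball x d3 \<subseteq> S" using assms open_contains_ball by blast
  define D where "D = Min {d1, d2, d3}"
  have D: "D > 0" "D \<le> d1" "D \<le> d2" "D \<le> d3" using d d3 by (auto simp: D_def)
  \<comment> \<open>All points \<open>x + a v + b w\<close> with \<open>a\<close> and
    \<open>b\<close> between 0 and \<open>t\<close> lie within \<open>D\<close> of \<open>x\<close>.
    The summand 1 keeps the denominator positive when \<open>v\<close> and \<open>w\<close> vanish,
    and makes the bound strict.\<close>
  define t where "t = D / (norm v + norm w + 1)"
  have nn: "norm v + norm w + 1 > 0" by (smt (verit) norm_ge_zero)
  have t: "t > 0" using D nn by (simp add: t_def)
  have near: "norm (a *\<^sub>R v + b *\<^sub>R w) < D" if "0 \<le> a" "a \<le> t" "0 \<le> b" "b \<le> t" for a b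
  proof -
    have "norm (a *\<^sub>R v + b *\<^sub>R w) \<le> t * norm v + t * norm w"
      using that by (intro norm_triangle_le add_mono) (auto intro: mult_right_mono)
    also have "\<dots> < t * (norm v + norm w + 1)" using t by (simp add: algebra_simps)
    also have "\<dots> = D" using nn by (simp add: t_def)
    finally show ?thesis .
  qed
  have inS: "x + a *\<^sub>R v + b *\<^sub>R w \<in> S" if "0 \<le> a" "a \<le> t" "0 \<le> b" "b \<le> t" for a b
  proof -
    have "dist x (x + z) = norm z" for z by (simp add: dist_norm)
    then show ?thesis using near[OF that] D by (intro subsetD[OF d3(2)]) (simp add: add.assoc)
  qed
  have inS': "x + a *\<^sub>R w + b *\<^sub>R v \<in> S" if "0 \<le> a" "a \<le> t" "0 \<le> b" "b \<le> t" for a b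
    using inS[of b a] that by (simp add: add.commute add.left_commute)
  obtain a b where ab: "0 \<le> a" "a \<le> t" "0 \<le> b" "b \<le> t"
    "f (x + t *\<^sub>R v + t *\<^sub>R w) - f (x + t *\<^sub>R v) - f (x + t *\<^sub>R w) + f x = t^2 * H v w (x + a *\<^sub>R v + b *\<^sub>R w)"
    unfolding H_def by (rule second_difference[OF assms(2) t, of x v w, OF inS])
  obtain a' b' where ab': "0 \<le> a'" "a' \<le> t" "0 \<le> b'" "b' \<le> t"
    "f (x + t *\<^sub>R w + t *\<^sub>R v) - f (x + t *\<^sub>R w) - f (x + t *\<^sub>R v) + f x = t^2 * H w v (x + a' *\<^sub>R w + b' *\<^sub>R v)"
    unfolding H_def by (rule second_difference[OF assms(2) t, of x w v, OF inS'])
  have "t^2 * H v w (x + a *\<^sub>R v + b *\<^sub>R w) = t^2 * H w v (x + a' *\<^sub>R w + b' *\<^sub>R v)"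
    unfolding ab(5)[symmetric] ab'(5)[symmetric] by (simp add: algebra_simps)
  then have "H v w (x + a *\<^sub>R v + b *\<^sub>R w) = H w v (x + a' *\<^sub>R w + b' *\<^sub>R v)" using t by simp
  moreover have "\<bar>H v w (x + a *\<^sub>R v + b *\<^sub>R w) - H v w x\<bar> < ?e/2"
    using near[OF ab(1-4)] D by (intro d(3)) (simp add: add.assoc)
  moreover have "\<bar>H w v (x + a' *\<^sub>R w + b' *\<^sub>R v) - H w v x\<bar> < ?e/2"
    using near[of b' a'] ab' D by (intro d(4)) (simp add: add.assoc add.commute)
  ultimately show False by (simp add: abs_if split: if_splits)
qed

lemma linear_eq_sum_axis:
  fixes f :: "real^'n \<Rightarrow> 'v::real_vector"
  assumes "linear f"
  shows "f v = (\<Sum>i\<in>UNIV. v $ i *\<^sub>R f (axis i 1))"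
proof -
  have "f v = f (\<Sum>i\<in>UNIV. v $ i *\<^sub>R axis i 1)"
    by (simp only: basis_expansion[of v] flip: scalar_mult_eq_scaleR)
  then show ?thesis using assms by (simp add: linear_sum linear_cmul)
qed

section \<open>Integrability of flat linear systems\<close>

text \<open>Cartan's homotopy formula for the 1-form \<open>w\<close>: \<open>K\<close> integrates
  \<open>w\<close> along the rays from \<open>a\<close>, and its differential is \<open>w\<close>
  plus an integral of the exterior derivative of \<open>w\<close>. This error term is kept, since
  the forms built from Picard iterates become closed only in the limit.\<close>

lemma homotopy_operator:
  fixes w :: "'n::finite \<Rightarrow> real^'n \<Rightarrow> 'v::euclidean_space" and a :: "real^'n"
  assumes S: "open S" "convex S" "a \<in> S" and w: "\<And>i. C_k_on 1 S (w i)"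
  defines "p \<equiv> \<lambda>x t. a + t *\<^sub>R (x - a)"
  defines "D \<equiv> \<lambda>i x v. frechet_derivative (w i) (at x) v"
  defines "K \<equiv> \<lambda>x. integral {0..1} (\<lambda>t. \<Sum>i\<in>UNIV. (x - a) $ i *\<^sub>R w i (p x t))"
  defines "K' \<equiv> \<lambda>x i. w i x + integral {0..1} (\<lambda>t. t *\<^sub>R (\<Sum>l\<in>UNIV. (x - a) $ l *\<^sub>R
       (D l (p x t) (axis i 1) - D i (p x t) (axis l 1))))"
  shows "x \<in> S \<Longrightarrow> (K has_derivative (\<lambda>v. \<Sum>i\<in>UNIV. v $ i *\<^sub>R K' x i)) (at x)"
    and "C_k_on 1 S K"
proof -
  have pS: "p x t \<in> S" if "x \<in> S" "0 \<le> t" "t \<le> 1" for x t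
  proof -
    have "p x t = (1 - t) *\<^sub>R a + t *\<^sub>R x" by (simp add: p_def algebra_simps)
    then show ?thesis using convexD_alt[OF S(2,3) that] by simp
  qed
  have wD: "(w i has_derivative D i x) (at x)" if "x \<in> S" for i x
    unfolding D_def using w[of i] that C_k_on_SucD(1)[of 0 S "w i" x] by simp
  have cD: "continuous_on S (\<lambda>x. D i x v)" for i v
    unfolding D_def using w[of i] by simp
  have cw: "continuous_on S (w i)" for i using C_k_on_imp_continuous[OF w] .
  have linD: "linear (D i x)" if "x \<in> S" for i x using has_derivative_linear[OF wD[OF that]] .
  have cp: "continuous_on (S \<times> cbox 0 1) (\<lambda>z. g (p (fst z) (snd z)))" if "continuous_on S g" for g :: "real^'n \<Rightarrow> 'v"
    by (rule continuous_on_compose2[OF that]) (use pS in \<open>auto intro!: continuous_intros simp: p_def\<close>)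
  have cp1: "continuous_on {0..1} (\<lambda>t. g (p x t))" if "continuous_on S g" "x \<in> S" for g :: "real^'n \<Rightarrow> 'v" and x
    by (rule continuous_on_compose2[OF that(1)]) (use that pS in \<open>auto intro!: continuous_intros simp: p_def\<close>)
  \<comment> \<open>Derivative in \<open>x\<close> of the integrand of \<open>K\<close>: the first
    term comes from the factor \<open>x - a\<close>, the second from \<open>p x t\<close>, whose
    derivative in \<open>x\<close> is multiplication by \<open>t\<close>.\<close>
  define G where "G x t = (\<lambda>v. \<Sum>i\<in>UNIV. v $ i *\<^sub>R w i (p x t) + (x - a) $ i *\<^sub>R t *\<^sub>R D i (p x t) v)" for x t
  have linG: "bounded_linear (G x t)" if "x \<in> S" "0 \<le> t" "t \<le> 1" for x t
    unfolding G_def using has_derivative_bounded_linear[OF wD[OF pS[OF that]]]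
    by (intro bounded_linear_sum bounded_linear_add bounded_linear_compose[OF bounded_linear_scaleR_right]
        bounded_linear_compose[OF bounded_linear_scaleR_left bounded_linear_vec_nth])
  have leib: "(K has_derivative integral (cbox 0 1) (\<lambda>t. Blinfun (G x t))) (at x within S)" if x: "x \<in> S" for x
    unfolding K_def cbox_interval[symmetric]
  proof (rule leibniz_rule[OF _ _ _ x S(2)])
    fix x t assume x: "x \<in> S" and "t \<in> cbox (0::real) 1"
    then have t: "0 \<le> t" "t \<le> 1" by auto
    have "((\<lambda>x. w i (p x t)) has_derivative (\<lambda>v. D i (p x t) (t *\<^sub>R v))) (at x within S)" for i
      by (rule has_derivative_compose[where f = "\<lambda>x. p x t" and g = "w i", OF _ wD[OF pS[OF x t]]])
        (auto simp: p_def intro!: derivative_eq_intros)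
    moreover have "((\<lambda>x. (x - a) $ i) has_derivative (\<lambda>v. v $ i)) (at x within S)" for i
      by (rule bounded_linear.has_derivative[OF bounded_linear_vec_nth]) (auto intro!: derivative_eq_intros)
    ultimately have "((\<lambda>x. \<Sum>i\<in>UNIV. (x - a) $ i *\<^sub>R w i (p x t)) has_derivative
      (\<lambda>v. \<Sum>i\<in>UNIV. (x - a) $ i *\<^sub>R D i (p x t) (t *\<^sub>R v) + v $ i *\<^sub>R w i (p x t))) (at x within S)"
      by (intro has_derivative_sum has_derivative_scaleR)
    then show "((\<lambda>x. \<Sum>i\<in>UNIV. (x - a) $ i *\<^sub>R w i (p x t)) has_derivative
        blinfun_apply (Blinfun (G x t))) (at x within S)"
      unfolding bounded_linear_Blinfun_apply[OF linG[OF x t]]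
      by (simp add: G_def linear_cmul[OF linD[OF pS[OF x t]]] add.commute)
  next
    fix x assume "x \<in> S"
    then show "(\<lambda>t. \<Sum>i\<in>UNIV. (x - a) $ i *\<^sub>R w i (p x t)) integrable_on cbox 0 1"
      by (auto intro!: integrable_continuous_real continuous_intros cp1[OF cw])
  next
    show "continuous_on (S \<times> cbox 0 1) (\<lambda>(x, t). Blinfun (G x t))"
    proof (rule continuous_on_blinfun_componentwise)
      fix v :: "real^'n"
      have "continuous_on (S \<times> cbox 0 1) (\<lambda>z. G (fst z) (snd z) v)"
        unfolding G_def by (intro continuous_intros cp[OF cw] cp[OF cD])
      then show "continuous_on (S \<times> cbox 0 1) (\<lambda>z. blinfun_apply (case z of (x, t) \<Rightarrow> Blinfun (G x t)) v)"
        by (rule continuous_on_eq) (auto simp: bounded_linear_Blinfun_apply linG)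
    qed
  qed
  have eq: "blinfun_apply (integral (cbox 0 1) (\<lambda>t. Blinfun (G x t))) v = (\<Sum>i\<in>UNIV. v $ i *\<^sub>R K' x i)"
    if x: "x \<in> S" for x v
  proof -
    have cG: "continuous_on (cbox 0 1) (\<lambda>t. Blinfun (G x t))"
    proof (rule continuous_on_blinfun_componentwise)
      fix v :: "real^'n"
      have "continuous_on (cbox 0 1) (\<lambda>t. G x t v)"
        unfolding G_def using x by (auto intro!: continuous_intros cp1 cw cD)
      then show "continuous_on (cbox 0 1) (\<lambda>t. blinfun_apply (Blinfun (G x t)) v)"
        by (rule continuous_on_eq) (use x in \<open>auto simp: bounded_linear_Blinfun_apply linG\<close>)
    qed
    \<comment> \<open>\<open>H t i\<close> is the contraction of the exterior derivative with
      \<open>x - a\<close>. Adding it turns the derivative of \<open>w i\<close> along the ray into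
      the derivatives of all \<open>w l\<close> in direction \<open>i\<close>, which are the ones
      that occur in \<open>G\<close>.\<close>
    define H where "H t i = (\<Sum>l\<in>UNIV. (x - a) $ l *\<^sub>R
       (D l (p x t) (axis i 1) - D i (p x t) (axis l 1)))" for t i
    have "blinfun_apply (integral (cbox 0 1) (\<lambda>t. Blinfun (G x t))) v 
        = integral (cbox 0 1) (\<lambda>t. blinfun_apply (Blinfun (G x t)) v)"
      by (rule blinfun_apply_integral[OF integrable_continuous[OF cG]])
    also have "\<dots> = integral {0..1} (\<lambda>t. G x t v)"
      by (simp add: cbox_interval, rule integral_cong) (simp add: bounded_linear_Blinfun_apply linG[OF x])
    also have "\<dots> = integral {0..1} (\<lambda>t. \<Sum>i\<in>UNIV. v $ i *\<^sub>R
          ((w i (p x t) + t *\<^sub>R D i (p x t) (x - a)) + t *\<^sub>R H t i))"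
    proof (rule integral_cong)
      fix t :: real assume "t \<in> {0..1}"
      then have P: "p x t \<in> S" using pS x by auto
      have "D i (p x t) (x - a) + H t i = (\<Sum>l\<in>UNIV. (x - a) $ l *\<^sub>R D l (p x t) (axis i 1))" for i
        unfolding H_def linear_eq_sum_axis[OF linD[OF P], of i "x - a"]
        by (simp flip: sum.distrib scaleR_right_distrib)
      then have "(\<Sum>i\<in>UNIV. v $ i *\<^sub>R ((w i (p x t) + t *\<^sub>R D i (p x t) (x - a)) + t *\<^sub>R H t i)) =
        (\<Sum>i\<in>UNIV. v $ i *\<^sub>R (w i (p x t) + t *\<^sub>R (\<Sum>l\<in>UNIV. (x - a) $ l *\<^sub>R D l (p x t) (axis i 1))))"
        by (simp flip: scaleR_right_distrib add: add.assoc)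
      also have "\<dots> = (\<Sum>i\<in>UNIV. v $ i *\<^sub>R w i (p x t)) +
          (\<Sum>i\<in>UNIV. \<Sum>l\<in>UNIV. (x - a) $ l *\<^sub>R t *\<^sub>R v $ i *\<^sub>R D l (p x t) (axis i 1))"
        by (simp add: scaleR_right_distrib sum.distrib scaleR_sum_right ac_simps)
      also have "(\<Sum>i\<in>UNIV. \<Sum>l\<in>UNIV. (x - a) $ l *\<^sub>R t *\<^sub>R v $ i *\<^sub>R D l (p x t) (axis i 1)) =
         (\<Sum>l\<in>UNIV. (x - a) $ l *\<^sub>R t *\<^sub>R D l (p x t) v)"
        unfolding linear_eq_sum_axis[OF linD[OF P], of _ v]
        by (subst sum.swap) (simp add: scaleR_sum_right)
      finally show "G x t v = (\<Sum>i\<in>UNIV. v $ i *\<^sub>R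
          ((w i (p x t) + t *\<^sub>R D i (p x t) (x - a)) + t *\<^sub>R H t i))"
        by (simp add: G_def sum.distrib)
    qed
    also have "((\<lambda>t. \<Sum>i\<in>UNIV. v $ i *\<^sub>R ((w i (p x t) + t *\<^sub>R D i (p x t) (x - a)) + t *\<^sub>R H t i))
        has_integral (\<Sum>i\<in>UNIV. v $ i *\<^sub>R K' x i)) {0..1}"
    proof (intro has_integral_sum has_integral_cmul)
      fix i
      \<comment> \<open>The integrand is the derivative of \<open>t\<close> times
        \<open>w i (p x t)\<close>, with boundary values \<open>w i x\<close> and 0.\<close>
      have "((\<lambda>t. w i (p x t) + t *\<^sub>R D i (p x t) (x - a)) has_integral
         (1 *\<^sub>R w i (p x 1) - 0 *\<^sub>R w i (p x 0))) {0..1}"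
      proof (rule fundamental_theorem_of_calculus)
        fix t :: real assume t: "t \<in> {0..1}"
        then have P: "p x t \<in> S" using pS x by auto
        have "((\<lambda>t. w i (p x t)) has_derivative (\<lambda>s. D i (p x t) (s *\<^sub>R (x - a)))) (at t within {0..1})"
          by (rule has_derivative_compose[where f = "\<lambda>t. p x t" and g = "w i", OF _ wD[OF P]])
            (auto simp: p_def intro!: derivative_eq_intros)
        then have "((\<lambda>t. w i (p x t)) has_vector_derivative D i (p x t) (x - a)) (at t within {0..1})"
          unfolding has_vector_derivative_def by (simp add: linear_cmul[OF linD[OF P]])
        then show "((\<lambda>t. t *\<^sub>R w i (p x t)) has_vector_derivative
            (w i (p x t) + t *\<^sub>R D i (p x t) (x - a))) (at t within {0..1})"
          by (auto intro!: derivative_eq_intros simp: add.commute)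
      qed simp
      moreover have "((\<lambda>t. t *\<^sub>R H t i) has_integral integral {0..1} (\<lambda>t. t *\<^sub>R H t i)) {0..1}"
        unfolding H_def using x
        by (intro integrable_integral integrable_continuous_real continuous_intros cp1[OF cD]) auto
      moreover have "p x 1 = x" by (simp add: p_def)
      ultimately show "((\<lambda>t. w i (p x t) + t *\<^sub>R D i (p x t) (x - a) + t *\<^sub>R H t i) has_integral K' x i) {0..1}"
        using has_integral_add[of "\<lambda>t. w i (p x t) + t *\<^sub>R D i (p x t) (x - a)" _ _ "\<lambda>t. t *\<^sub>R H t i"]
        by (simp add: K'_def H_def)
    qed auto
    then have "integral {0..1} (\<lambda>t. \<Sum>i\<in>UNIV. v $ i *\<^sub>R ((w i (p x t) + t *\<^sub>R D i (p x t) (x - a)) + t *\<^sub>R H t i))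
        = (\<Sum>i\<in>UNIV. v $ i *\<^sub>R K' x i)" by (rule integral_unique)
    finally show ?thesis .
  qed
  show d: "(K has_derivative (\<lambda>v. \<Sum>i\<in>UNIV. v $ i *\<^sub>R K' x i)) (at x)" if "x \<in> S" for x
  proof -
    have "blinfun_apply (integral (cbox 0 1) (\<lambda>t. Blinfun (G x t))) = (\<lambda>v. \<Sum>i\<in>UNIV. v $ i *\<^sub>R K' x i)"
      using eq[OF that] by (rule ext)
    with leib[OF that] show ?thesis using at_within_open[OF that S(1)] by simp
  qed
  have "continuous_on S (\<lambda>x. K' x i)" for i
  proof -
    have "continuous_on S (\<lambda>x. integral (cbox 0 1) (\<lambda>t. t *\<^sub>R (\<Sum>l\<in>UNIV. (x - a) $ l *\<^sub>R
       (D l (p x t) (axis i 1) - D i (p x t) (axis l 1)))))"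
      by (rule integral_continuous_on_param) (auto simp: case_prod_unfold intro!: continuous_intros cp[OF cD, unfolded cbox_interval])
    then show ?thesis unfolding K'_def by (auto intro!: continuous_intros cw)
  qed
  then show "C_k_on 1 S K"
    unfolding One_nat_def by (intro C_k_on_SucI[OF S(1) d]) (auto intro!: continuous_intros)
qed

section \<open>Estimates for the Picard iteration\<close>

lemma bounded_bilinear_matrix_vector_mult:
  "bounded_bilinear ((*v) :: real^'n::finite^'m::finite \<Rightarrow> _)"
  unfolding bilinear_conv_bounded_bilinear[symmetric] bilinear_def
  by (intro allI conjI linearI) 
    (simp_all add: matrix_vector_mult_add_rdistrib matrix_vector_right_distrib
      matrix_vector_mult_scaleR scaleR_matrix_vector_assoc)

lemma sum_axis_scaleR:
  fixes z :: "'n::finite \<Rightarrow> 'v::real_vector"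
  shows "(\<Sum>j\<in>UNIV. axis i (1::real) $ j *\<^sub>R z j) = z i"
proof -
  have "axis i (1::real) $ j *\<^sub>R z j = (if j = i then z j else 0)" for j by (simp add: axis_def)
  then show ?thesis by (simp add: sum.delta)
qed

text \<open>The explicit rate, and not only the limit, is needed: with one \<open>c\<close> for all
  points of the ball it makes the convergence of the iterates uniform.\<close>

lemma geometric_limit:
  fixes f :: "nat \<Rightarrow> 'v::banach"
  assumes "\<And>n. norm (f (Suc n) - f n) \<le> c * (1/2)^n"
  shows "\<exists>l. \<forall>n. norm (f n - l) \<le> 2 * c * (1/2)^n"
proof -
  have c: "0 \<le> c" using order_trans[OF norm_ge_zero assms[of 0]] by simp
  \<comment> \<open>The partial sum of the geometric series is kept exactly, so that the induction
    on \<open>k\<close> closes.\<close>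
  have diff: "norm (f (n + k) - f n) \<le> 2 * c * (1/2)^n * (1 - (1/2)^k)" for n k
  proof (induction k)
    case (Suc k)
    have "norm (f (n + Suc k) - f n) \<le> norm (f (Suc (n + k)) - f (n + k)) + norm (f (n + k) - f n)"
      using norm_triangle_ineq[of "f (Suc (n + k)) - f (n + k)" "f (n + k) - f n"] by simp
    also have "\<dots> \<le> c * (1/2)^(n + k) + 2 * c * (1/2)^n * (1 - (1/2)^k)"
      by (intro add_mono assms Suc)
    also have "\<dots> = 2 * c * (1/2)^n * (1 - (1/2)^Suc k)" by (simp add: algebra_simps power_add)
    finally show ?case .
  qed simp
  have bd: "norm (f m - f n) \<le> 2 * c * (1/2)^n" if "n \<le> m" for m n
  proof -
    have "norm (f m - f n) \<le> 2 * c * (1/2)^n * (1 - (1/2)^(m - n))" using diff[of n "m - n"] that by simp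
    also have "\<dots> \<le> 2 * c * (1/2)^n * 1" using c by (intro mult_left_mono) auto
    finally show ?thesis by simp
  qed
  have lim0: "(\<lambda>n. 2 * c * (1/2)^n) \<longlonglongrightarrow> 0"
    by (rule tendsto_mult_right_zero) (rule LIMSEQ_power_zero, simp)
  have "Cauchy f"
  proof (rule CauchyI')
    fix e :: real assume "0 < e"
    then obtain N where N: "2 * c * (1/2)^n < e" if "n \<ge> N" for n
      using order_tendstoD(2)[OF lim0] unfolding eventually_sequentially by blast
    have "dist (f m) (f n) < e" if "m \<ge> N" "n > m" for m n
      using bd[of m n] N[OF that(1)] that by (simp add: dist_norm norm_minus_commute)
    then show "\<exists>M. \<forall>m\<ge>M. \<forall>n>m. dist (f m) (f n) < e" by blast
  qed
  then obtain l where l: "f \<longlonglongrightarrow> l" using Cauchy_convergent convergent_def by blast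
  have "norm (f n - l) \<le> 2 * c * (1/2)^n" for n
  proof (rule LIMSEQ_le_const2)
    show "(\<lambda>m. norm (f n - f m)) \<longlonglongrightarrow> norm (f n - l)" by (intro tendsto_intros l)
    show "\<exists>N. \<forall>m\<ge>N. norm (f n - f m) \<le> 2 * c * (1/2)^n" using bd by (metis norm_minus_commute)
  qed
  then show ?thesis by blast
qed

lemma continuous_family_locally_bounded:
  fixes A :: "'i::finite \<Rightarrow> 'e::heine_borel \<Rightarrow> 'v::real_normed_vector"
  assumes "open S" "a \<in> S" "\<And>i. continuous_on S (A i)"
  obtains r M where "0 < r" "0 < M" "ball a r \<subseteq> S" "\<And>x i. x \<in> ball a r \<Longrightarrow> norm (A i x) \<le> M"
proof -
  obtain r where r: "0 < r" "cball a r \<subseteq> S" using assms open_contains_cball by blast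
  have "\<exists>B. \<forall>x\<in>cball a r. norm (A i x) \<le> B" for i
  proof -
    have "bounded (A i ` cball a r)"
      using continuous_on_subset[OF assms(3) r(2)] by (intro compact_imp_bounded compact_continuous_image) auto
    then show ?thesis by (auto simp: bounded_iff)
  qed
  then obtain B where B: "norm (A i x) \<le> B i" if "x \<in> cball a r" for i x by metis
  \<comment> \<open>The sum bounds the finitely many members at once; the summand 1 makes the bound
    positive.\<close>
  define M where "M = (\<Sum>i\<in>UNIV. \<bar>B i\<bar>) + 1"
  have "norm (A i x) \<le> M" if "x \<in> ball a r" for i x
  proof -
    have "norm (A i x) \<le> \<bar>B i\<bar>" using B[of x i] that by (auto simp: less_imp_le)
    also have "\<dots> \<le> (\<Sum>i\<in>UNIV. \<bar>B i\<bar>)" by (rule member_le_sum) auto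
    finally show ?thesis by (simp add: M_def)
  qed
  moreover have "0 < M" unfolding M_def by (smt (verit) sum_nonneg abs_ge_zero)
  moreover have "ball a r \<subseteq> S" using r(2) ball_subset_cball by blast
  ultimately show thesis using that r by blast
qed

lemma matrix_family_locally_bounded:
  fixes A :: "'n::finite \<Rightarrow> real^'n \<Rightarrow> real^'m::finite^'m"
  assumes "open S" "a \<in> S" "\<And>i. continuous_on S (A i)"
  obtains r M where "0 < r" "0 < M" "ball a r \<subseteq> S"
    "\<And>x i u. x \<in> ball a r \<Longrightarrow> norm (A i x *v u) \<le> M * norm u"
proof -
  obtain r B where r: "0 < r" "0 < B" "ball a r \<subseteq> S" and B: "\<And>x i. x \<in> ball a r \<Longrightarrow> norm (A i x) \<le> B"
    using continuous_family_locally_bounded[of S a A] assms by blast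
  obtain K where K: "0 < K" "norm (P *v u) \<le> norm P * norm u * K" for P :: "real^'m^'m" and u
    using bounded_bilinear.pos_bounded[OF bounded_bilinear_matrix_vector_mult] by blast
  have "norm (A i x *v u) \<le> (B * K) * norm u" if "x \<in> ball a r" for i x u
  proof -
    have "norm (A i x *v u) \<le> norm (A i x) * (norm u * K)" using K(2)[of "A i x" u] by simp
    also have "\<dots> \<le> B * (norm u * K)" using B[OF that] K(1) by (intro mult_right_mono) auto
    finally show ?thesis by (simp add: mult.commute mult.left_commute)
  qed
  then show thesis using that[of r "B * K"] r K(1) by simp
qed

text \<open>Picard iteration along the rays from \<open>a\<close>. In the derivative of an iterate, as given by
  \<open>homotopy_operator\<close>, flatness cancels everything except the defects \<open>E n = dF n - A (F n)\<close> of the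
  previous step; so the defects tend to 0 together with the increments of the iterates.\<close>

theorem linear_frobenius:
  fixes A :: "'n::finite \<Rightarrow> real^'n \<Rightarrow> real^'m::finite^'m"
  assumes S0: "open S0" "a \<in> S0" and C: "\<And>i. C_k_on 1 S0 (A i)"
    and flat: "\<And>x i j. x \<in> S0 \<Longrightarrow>
      frechet_derivative (A i) (at x) (axis j 1) + A i x ** A j x =
      frechet_derivative (A j) (at x) (axis i 1) + A j x ** A i x"
  obtains r where "0 < r" "ball a r \<subseteq> S0"
    "\<And>u0. \<exists>F. F a = u0 \<and> (\<forall>x\<in>ball a r. (F has_derivative (\<lambda>h. \<Sum>i\<in>UNIV. h $ i *\<^sub>R (A i x *v F x))) (at x))"
proof -
  obtain r0 M where r0: "0 < r0" "0 < M" "ball a r0 \<subseteq> S0"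
    "\<And>x i u. x \<in> ball a r0 \<Longrightarrow> norm (A i x *v u) \<le> M * norm u"
    by (rule matrix_family_locally_bounded[of S0 a A, OF S0 C_k_on_imp_continuous[OF C]]) blast
  define N where "N = real CARD('n)"
  have N: "N > 0" unfolding N_def by simp
  \<comment> \<open>With \<open>N * r * M\<close> at most 1/4, an iteration multiplies the
    increments by at most 1/4, hence certainly by at most 1/2, and the two terms of the curl
    multiply the defects by at most 1/2.\<close>
  define r where "r = min r0 (1 / (4 * N * M))"
  have r: "0 < r" "r \<le> r0" "N * r * M \<le> 1/4"
  proof -
    have "N * r * M \<le> N * (1 / (4 * N * M)) * M"
      using N r0 by (intro mult_right_mono mult_left_mono) (auto simp: r_def)
    then show "N * r * M \<le> 1/4" using N r0 by simp
  qed (use N r0 in \<open>auto simp: r_def\<close>)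
  define S where "S = ball a r"
  have S: "open S" "convex S" "a \<in> S" "S \<subseteq> S0" using r r0 by (auto simp: S_def)
  have AM: "norm (A i x *v u) \<le> M * norm u" if "x \<in> S" for i x u
    using r0(4)[of x i u] that r by (simp add: S_def)
  have cA: "C_k_on 1 S (A i)" for i using C_k_on_subset[OF C S(4)] .
  define p where "p x t = a + t *\<^sub>R (x - a)" for x t
  have pS: "p x t \<in> S" if "x \<in> S" "0 \<le> t" "t \<le> 1" for x t
  proof -
    have "p x t = (1 - t) *\<^sub>R a + t *\<^sub>R x" by (simp add: p_def algebra_simps)
    then show ?thesis using convexD_alt[OF S(2,3) that] by simp
  qed
  have xa: "\<bar>(x - a) $ l\<bar> \<le> r" if "x \<in> S" for x l
    using component_le_norm_cart[of "x - a" l] that by (simp add: S_def dist_norm norm_minus_commute)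
  have sumbd: "norm (\<Sum>l\<in>UNIV. (x - a) $ l *\<^sub>R v l) \<le> N * r * B"
    if "x \<in> S" "\<And>l. norm (v l) \<le> B" for x and v :: "'n \<Rightarrow> real^'m" and B
  proof -
    have "norm (\<Sum>l\<in>UNIV. (x - a) $ l *\<^sub>R v l) \<le> (\<Sum>l\<in>(UNIV::'n set). r * B)"
      using that(2) xa[OF that(1)] r(1) by (intro sum_norm_le) (auto intro!: mult_mono)
    then show ?thesis by (simp add: N_def)
  qed
  have "\<exists>F. F a = u0 \<and> (\<forall>x\<in>ball a r. (F has_derivative (\<lambda>h. \<Sum>i\<in>UNIV. h $ i *\<^sub>R (A i x *v F x))) (at x))" for u0
  proof -
    define T where "T = (\<lambda>F x. u0 + integral {0..1} (\<lambda>t. \<Sum>i\<in>UNIV. (x - a) $ i *\<^sub>R (A i (p x t) *v F (p x t))))"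
    define F where "F n = (T ^^ n) (\<lambda>x. u0)" for n
    have F0: "F 0 = (\<lambda>x. u0)" and FS: "F (Suc n) = T (F n)" for n by (auto simp: F_def)
    define w where "w n i x = A i x *v F n x" for n i x
    have FSw: "F (Suc n) = (\<lambda>x. u0 + integral {0..1} (\<lambda>t. \<Sum>i\<in>UNIV. (x - a) $ i *\<^sub>R w n i (p x t)))" for n
      by (simp add: FS T_def w_def)
    have cw: "C_k_on 1 S (w n i)" if "C_k_on 1 S (F n)" for n i
      unfolding w_def by (rule C_k_on_bilinear[OF S(1) bounded_bilinear_matrix_vector_mult cA that])
    have cF: "C_k_on 1 S (F n)" for n
    proof (induction n)
      case (Suc n)
      show ?case unfolding FSw p_def
        by (rule C_k_on_add[OF S(1) C_k_on_const homotopy_operator(2)[OF S(1-3) cw[OF Suc]]])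
    qed (simp only: F0 C_k_on_const)
    have dF: "(F n has_derivative frechet_derivative (F n) (at x)) (at x)" if "x \<in> S" for n x
      using C_k_on_SucD(1)[of 0 S "F n"] cF[of n] that by simp
    have dA: "(A i has_derivative frechet_derivative (A i) (at x)) (at x)" if "x \<in> S" for i x
      using C_k_on_SucD(1)[of 0 S "A i"] cA[of i] that by simp
    define E where "E n i x = frechet_derivative (F n) (at x) (axis i 1) - A i x *v F n x" for n i x
    have dw: "frechet_derivative (w n i) (at x) v = A i x *v frechet_derivative (F n) (at x) v
        + frechet_derivative (A i) (at x) v *v F n x" if "x \<in> S" for n i x v
      using frechet_derivative_eqI[OF bounded_bilinear.FDERIV[OF bounded_bilinear_matrix_vector_mult
            dA[OF that] dF[OF that]]] unfolding w_def by metis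
    \<comment> \<open>The quadratic terms \<open>A l ** A i\<close> that flatness asks for appear on
      writing the derivative of \<open>F n\<close> as the defect \<open>E n\<close> plus
      \<open>A\<close> applied to \<open>F n\<close>.\<close>
    have curl: "frechet_derivative (w n l) (at x) (axis i 1) - frechet_derivative (w n i) (at x) (axis l 1)
        = A l x *v E n i x - A i x *v E n l x" if "x \<in> S" for n i l x
    proof -
      have "(frechet_derivative (A l) (at x) (axis i 1) + A l x ** A i x) *v F n x =
        (frechet_derivative (A i) (at x) (axis l 1) + A i x ** A l x) *v F n x"
        using flat[of x l i] that S(4) by auto
      then show ?thesis unfolding dw[OF that] E_def
        by (simp add: matrix_vector_mult_add_rdistrib matrix_vector_mult_diff_distrib
            matrix_vector_mul_assoc algebra_simps)
    qed
    have dFS: "frechet_derivative (F (Suc n)) (at x) (axis i 1) = w n i x +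
       integral {0..1} (\<lambda>t. t *\<^sub>R (\<Sum>l\<in>UNIV. (x - a) $ l *\<^sub>R
         (A l (p x t) *v E n i (p x t) - A i (p x t) *v E n l (p x t))))" if x: "x \<in> S" for n i x
    proof -
      have "frechet_derivative (F (Suc n)) (at x) = (\<lambda>v. \<Sum>j\<in>UNIV. v $ j *\<^sub>R (w n j x + 
          integral {0..1} (\<lambda>t. t *\<^sub>R (\<Sum>l\<in>UNIV. (x - a) $ l *\<^sub>R
          (frechet_derivative (w n l) (at (p x t)) (axis j 1) -
           frechet_derivative (w n j) (at (p x t)) (axis l 1))))))"
        unfolding FSw p_def
        by (rule frechet_derivative_eqI, rule has_derivative_eq_rhs,
            rule has_derivative_add[OF has_derivative_const homotopy_operator(1)[OF S(1-3) cw[OF cF] x]]) simp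
      then have "frechet_derivative (F (Suc n)) (at x) (axis i 1) = w n i x + 
          integral {0..1} (\<lambda>t. t *\<^sub>R (\<Sum>l\<in>UNIV. (x - a) $ l *\<^sub>R
          (frechet_derivative (w n l) (at (p x t)) (axis i 1) -
           frechet_derivative (w n i) (at (p x t)) (axis l 1))))"
        by (simp only: sum_axis_scaleR)
      also have "integral {0..1} (\<lambda>t. t *\<^sub>R (\<Sum>l\<in>UNIV. (x - a) $ l *\<^sub>R
          (frechet_derivative (w n l) (at (p x t)) (axis i 1) -
           frechet_derivative (w n i) (at (p x t)) (axis l 1)))) =
           integral {0..1} (\<lambda>t. t *\<^sub>R (\<Sum>l\<in>UNIV. (x - a) $ l *\<^sub>R
         (A l (p x t) *v E n i (p x t) - A i (p x t) *v E n l (p x t))))"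
        by (rule integral_cong) (simp add: curl pS[OF x])
      finally show ?thesis .
    qed
    have cp1: "continuous_on {0..1} (\<lambda>t. g (p x t))" if "continuous_on S g" "x \<in> S" for g :: "real^'n \<Rightarrow> real^'m" and x
      by (rule continuous_on_compose2[OF that(1)]) (use that pS in \<open>auto intro!: continuous_intros simp: p_def\<close>)
    have cE: "continuous_on S (E n i)" for n i
      unfolding E_def using cF[of n] C_k_on_imp_continuous[OF cw[OF cF]]
      by (intro continuous_intros) (auto simp: w_def)
    have cAE: "continuous_on S (\<lambda>x. A l x *v E n i x)" for n i l
      by (rule bounded_bilinear.continuous_on[OF bounded_bilinear_matrix_vector_mult
            C_k_on_imp_continuous[OF cA] cE])
    have cwn: "continuous_on S (w n i)" for n i using C_k_on_imp_continuous[OF cw[OF cF]] .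
    define c where "c = N * r * (M * norm u0)"
    have d: "norm (F (Suc n) x - F n x) \<le> c * (1/2)^n" if "x \<in> S" for n x
      using that
    proof (induction n arbitrary: x)
      case 0
      have "norm (F (Suc 0) x - F 0 x) = norm (integral {0..1} (\<lambda>t. \<Sum>i\<in>UNIV. (x - a) $ i *\<^sub>R w 0 i (p x t)))"
        by (simp only: FSw F0) simp
      also have "\<dots> \<le> c * (1 - 0)"
      proof (rule integral_bound)
        show "continuous_on {0..1} (\<lambda>t. \<Sum>i\<in>UNIV. (x - a) $ i *\<^sub>R w 0 i (p x t))"
          by (intro continuous_intros cp1[OF cwn 0])
        show "norm (\<Sum>i\<in>UNIV. (x - a) $ i *\<^sub>R w 0 i (p x t)) \<le> c" if "t \<in> {0..1}" for t
          unfolding c_def using that AM pS[OF 0] by (intro sumbd[OF 0]) (simp add: w_def F0)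
      qed simp
      finally show ?case by simp
    next
      case (Suc n)
      have "F (Suc (Suc n)) x - F (Suc n) x = integral {0..1} (\<lambda>t. \<Sum>i\<in>UNIV. (x - a) $ i *\<^sub>R w (Suc n) i (p x t))
           - integral {0..1} (\<lambda>t. \<Sum>i\<in>UNIV. (x - a) $ i *\<^sub>R w n i (p x t))"
        by (subst FSw, subst FSw) simp
      also have "\<dots> = integral {0..1} (\<lambda>t. (\<Sum>i\<in>UNIV. (x - a) $ i *\<^sub>R w (Suc n) i (p x t)) - 
           (\<Sum>i\<in>UNIV. (x - a) $ i *\<^sub>R w n i (p x t)))"
        by (rule integral_diff[symmetric]) 
           (intro integrable_continuous_real continuous_intros cp1[OF cwn Suc.prems])+
      also have "norm \<dots> \<le> (N * r * (M * (c * (1/2)^n))) * (1 - 0)"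
      proof (rule integral_bound)
        show "continuous_on {0..1} (\<lambda>t. (\<Sum>i\<in>UNIV. (x - a) $ i *\<^sub>R w (Suc n) i (p x t)) - 
           (\<Sum>i\<in>UNIV. (x - a) $ i *\<^sub>R w n i (p x t)))"
          by (intro continuous_intros cp1[OF cwn Suc.prems])
        fix t :: real assume t: "t \<in> {0..1}"
        then have P: "p x t \<in> S" using pS Suc.prems by auto
        have "norm (w (Suc n) i (p x t) - w n i (p x t)) \<le> M * (c * (1/2)^n)" for i
        proof -
          have "norm (w (Suc n) i (p x t) - w n i (p x t)) = norm (A i (p x t) *v (F (Suc n) (p x t) - F n (p x t)))"
            by (simp add: w_def matrix_vector_mult_diff_distrib)
          also have "\<dots> \<le> M * norm (F (Suc n) (p x t) - F n (p x t))" by (rule AM[OF P])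
          also have "\<dots> \<le> M * (c * (1/2)^n)" using Suc.IH[OF P] r0 by (intro mult_left_mono) auto
          finally show ?thesis .
        qed
        from sumbd[OF Suc.prems this]
        show "norm ((\<Sum>i\<in>UNIV. (x - a) $ i *\<^sub>R w (Suc n) i (p x t)) - 
           (\<Sum>i\<in>UNIV. (x - a) $ i *\<^sub>R w n i (p x t))) \<le> N * r * (M * (c * (1/2)^n))"
          by (simp add: sum_subtractf scaleR_right_diff_distrib)
      qed simp
      also have "\<dots> = (N * r * M) * (c * (1/2)^n)" by simp
      also have "\<dots> \<le> (1/2) * (c * (1/2)^n)"
        using r N r0 by (intro mult_right_mono) (auto simp: c_def)
      finally show ?case by simp
    qed
    define C where "C = M * norm u0"
    have C0: "C \<ge> 0" using r0 by (simp add: C_def)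
    \<comment> \<open>With \<open>e n\<close> for the bound, the recursion is
      \<open>e (n + 1) \<le> e n / 2 + (C / 4) * (1/2)^n\<close>. The second term decays at the rate
      of the homogeneous solution; this resonance produces the factor \<open>n + 1\<close>.\<close>
    have e: "norm (E n i x) \<le> (real n + 1) * C * (1/2)^n" if "x \<in> S" for n i x
      using that
    proof (induction n arbitrary: x i)
      case 0
      then show ?case using AM[OF 0, of i u0] by (simp add: E_def F0 C_def)
    next
      case (Suc n)
      define J where "J = integral {0..1} (\<lambda>t. t *\<^sub>R (\<Sum>l\<in>UNIV. (x - a) $ l *\<^sub>R
         (A l (p x t) *v E n i (p x t) - A i (p x t) *v E n l (p x t))))"
      let ?B = "(real n + 1) * C * (1/2)^n"
      have "norm J \<le> (N * r * (M * ?B + M * ?B)) * (1 - 0)"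
        unfolding J_def
      proof (rule integral_bound)
        show "continuous_on {0..1} (\<lambda>t. t *\<^sub>R (\<Sum>l\<in>UNIV. (x - a) $ l *\<^sub>R
         (A l (p x t) *v E n i (p x t) - A i (p x t) *v E n l (p x t))))"
          by (intro continuous_intros cp1[OF cAE Suc.prems])
        fix t :: real assume t: "t \<in> {0..1}"
        then have P: "p x t \<in> S" using pS Suc.prems by auto
        have "norm (A l (p x t) *v E n j (p x t)) \<le> M * ?B" for l j
          by (rule order_trans[OF AM[OF P]], rule mult_left_mono[OF Suc.IH[OF P]]) (use r0 in simp)
        then have "norm (A l (p x t) *v E n i (p x t) - A i (p x t) *v E n l (p x t)) \<le> M * ?B + M * ?B" for l
          by (intro order_trans[OF norm_triangle_ineq4] add_mono) auto
        from sumbd[OF Suc.prems this]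
        show "norm (t *\<^sub>R (\<Sum>l\<in>UNIV. (x - a) $ l *\<^sub>R
         (A l (p x t) *v E n i (p x t) - A i (p x t) *v E n l (p x t)))) \<le> N * r * (M * ?B + M * ?B)"
          using t by (simp add: mult_left_le_one_le order_trans[OF mult_left_le_one_le])
      qed simp
      then have "norm J \<le> 2 * (N * r * M) * ?B" by (simp add: algebra_simps)
      also have "\<dots> \<le> (1/2) * ?B" using r C0 by (intro mult_right_mono) auto
      finally have J: "norm J \<le> (1/2) * ?B" .
      have "E (Suc n) i x = A i x *v (F n x - F (Suc n) x) + J"
        unfolding E_def dFS[OF Suc.prems] J_def w_def by (simp add: matrix_vector_mult_diff_distrib)
      then have "norm (E (Suc n) i x) \<le> norm (A i x *v (F n x - F (Suc n) x)) + norm J"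
        by (simp add: norm_triangle_ineq)
      also have "\<dots> \<le> M * norm (F n x - F (Suc n) x) + (1/2) * ?B"
        by (intro add_mono AM[OF Suc.prems] J)
      also have "\<dots> \<le> M * (c * (1/2)^n) + (1/2) * ?B"
        using d[OF Suc.prems, of n] r0 C0 by (intro add_mono mult_left_mono) (auto simp: norm_minus_commute)
      also have "M * (c * (1/2)^n) = (N * r * M) * C * (1/2)^n" by (simp add: c_def C_def)
      also have "\<dots> \<le> (1/4) * C * (1/2)^n" using r C0 by (intro mult_right_mono) auto
      also have "(1/4) * C * (1/2)^n + (1/2) * ?B \<le> (real (Suc n) + 1) * C * (1/2)^Suc n"
        using C0 by (simp add: algebra_simps)
      finally show ?case by simp
    qed
    have "\<exists>l. \<forall>n. norm (F n x - l) \<le> 2 * c * (1/2)^n" if "x \<in> S" for x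
      using geometric_limit[of "\<lambda>n. F n x" c] d[OF that] by blast
    then obtain L where L: "norm (F n x - L x) \<le> 2 * c * (1/2)^n" if "x \<in> S" for n x by metis
    have lim0: "(\<lambda>n. N * ((real n + 1) * C * (1/2)^n + M * (2 * c * (1/2)^n))) \<longlonglongrightarrow> 0"
    proof -
      have h: "(\<lambda>n. (1/2::real)^n) \<longlonglongrightarrow> 0" by (rule LIMSEQ_power_zero) simp
      have "(\<lambda>n. N * C * (real n * (1/2)^n) + (N * C + N * M * 2 * c) * (1/2)^n) \<longlonglongrightarrow> N * C * 0 + (N * C + N * M * 2 * c) * 0"
        by (intro tendsto_intros powser_times_n_limit_0 h) simp
      then show ?thesis by (simp add: algebra_simps)
    qed
    have Llim: "(\<lambda>n. F n x) \<longlonglongrightarrow> L x" if "x \<in> S" for x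
    proof (rule LIM_zero_cancel, rule Lim_null_comparison)
      show "\<forall>\<^sub>F n in sequentially. norm (F n x - L x) \<le> 2 * c * (1/2)^n" using L[OF that] by simp
      show "(\<lambda>n. 2 * c * (1/2)^n) \<longlonglongrightarrow> 0"
        by (rule tendsto_mult_right_zero) (rule LIMSEQ_power_zero, simp)
    qed
    \<comment> \<open>Differentiation under the limit: the derivatives of the iterates converge
      uniformly on the ball to those prescribed by \<open>L\<close>, because the defects and
      \<open>F n - L\<close> both tend to 0 uniformly.\<close>
    have "\<exists>g. \<forall>x\<in>S. (\<lambda>n. F n x) \<longlonglongrightarrow> g x \<and>
       (g has_derivative (\<lambda>h. \<Sum>i\<in>UNIV. h $ i *\<^sub>R (A i x *v L x))) (at x within S)"
    proof (rule has_derivative_sequence[where f = F, OF S(2) _ _ S(3) Llim[OF S(3)]])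
      show "(F n has_derivative frechet_derivative (F n) (at x)) (at x within S)" if "x \<in> S" for n x
        using dF[OF that] has_derivative_at_withinI by blast
      fix \<epsilon> :: real assume "\<epsilon> > 0"
      from order_tendstoD(2)[OF lim0 this]
      show "\<forall>\<^sub>F n in sequentially. \<forall>x\<in>S. \<forall>h. norm (frechet_derivative (F n) (at x) h -
          (\<Sum>i\<in>UNIV. h $ i *\<^sub>R (A i x *v L x))) \<le> \<epsilon> * norm h"
      proof (rule eventually_mono, intro ballI allI)
        fix n x and h :: "real^'n"
        assume n: "N * ((real n + 1) * C * (1/2)^n + M * (2 * c * (1/2)^n)) < \<epsilon>" and x: "x \<in> S"
        let ?B = "(real n + 1) * C * (1/2)^n + M * (2 * c * (1/2)^n)"
        have t: "norm (frechet_derivative (F n) (at x) (axis i 1) - A i x *v L x) \<le> ?B" for i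
        proof -
          have "frechet_derivative (F n) (at x) (axis i 1) - A i x *v L x = E n i x + A i x *v (F n x - L x)"
            by (simp add: E_def matrix_vector_mult_diff_distrib)
          also have "norm \<dots> \<le> ?B"
            by (intro norm_triangle_le add_mono e[OF x] order_trans[OF AM[OF x]] mult_left_mono[OF L[OF x]])
              (use r0 in simp)
          finally show ?thesis .
        qed
        have "frechet_derivative (F n) (at x) h - (\<Sum>i\<in>UNIV. h $ i *\<^sub>R (A i x *v L x))
           = (\<Sum>i\<in>UNIV. h $ i *\<^sub>R (frechet_derivative (F n) (at x) (axis i 1) - A i x *v L x))"
          unfolding linear_eq_sum_axis[OF has_derivative_linear[OF dF[OF x]], of n h]
          by (simp add: sum_subtractf scaleR_right_diff_distrib)
        also have "norm \<dots> \<le> (\<Sum>i\<in>(UNIV::'n set). norm h * ?B)"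
          using t component_le_norm_cart[of h] by (intro sum_norm_le) (auto intro!: mult_mono)
        also have "\<dots> = (N * ?B) * norm h" by (simp add: N_def)
        also have "\<dots> \<le> \<epsilon> * norm h" using n by (intro mult_right_mono) auto
        finally show "norm (frechet_derivative (F n) (at x) h - (\<Sum>i\<in>UNIV. h $ i *\<^sub>R (A i x *v L x))) \<le> \<epsilon> * norm h" .
      qed
    qed
    then obtain g where g: "\<And>x. x \<in> S \<Longrightarrow> (\<lambda>n. F n x) \<longlonglongrightarrow> g x"
       "\<And>x. x \<in> S \<Longrightarrow> (g has_derivative (\<lambda>h. \<Sum>i\<in>UNIV. h $ i *\<^sub>R (A i x *v L x))) (at x within S)" by blast
    have gL: "g x = L x" if "x \<in> S" for x using LIMSEQ_unique[OF g(1) Llim] that by blast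
    \<comment> \<open>At \<open>x = a\<close> the integrand of every iterate vanishes.\<close>
    have "F n a = u0" for n by (cases n) (simp_all add: F0 FSw)
    then have "L a = u0" using Llim[OF S(3)] by (simp add: LIMSEQ_const_iff)
    then show ?thesis using g(2) gL S at_within_open[OF _ S(1)]
      by (intro exI[of _ g]) (auto simp: S_def[symmetric])
  qed
  then show thesis using that[of r] r S by (auto simp: S_def)
qed

section \<open>The equation \<open>Hess f = - k f g\<close> in coordinates\<close>

text \<open>On the closed ball with \<open>x\<close> on its boundary the norm of \<open>F\<close>
  has a maximum, at \<open>y\<close> say; the mean value inequality gives
  \<open>norm (F y) \<le> C * r * norm (F y)\<close>, and \<open>C * r < 1\<close>. Smallness of the
  ball takes the place of a Gronwall estimate.\<close>

lemma linear_ode_zero: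
  fixes F :: "'e::euclidean_space \<Rightarrow> 'v::real_normed_vector"
  assumes d: "\<And>x. x \<in> ball a r \<Longrightarrow> (F has_derivative F' x) (at x)"
    and bd: "\<And>x h. x \<in> ball a r \<Longrightarrow> norm (F' x h) \<le> C * norm (F x) * norm h"
    and "F a = 0" "0 \<le> C" "C * r < 1" and x: "x \<in> ball a r"
  shows "F x = 0"
proof -
  define T where "T = cball a (dist a x)"
  have T: "T \<subseteq> ball a r" "compact T" "x \<in> T" "a \<in> T" "convex T" using x by (auto simp: T_def)
  have "continuous_on T (\<lambda>x. norm (F x))"
    by (intro continuous_on_norm continuous_at_imp_continuous_on ballI)
      (rule has_derivative_continuous[OF d[OF subsetD[OF T(1)]]])
  then obtain y where y: "y \<in> T" "\<And>z. z \<in> T \<Longrightarrow> norm (F z) \<le> norm (F y)"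
    using continuous_attains_sup[of T "\<lambda>x. norm (F x)"] T by blast
  have "norm (F y - F a) \<le> (C * norm (F y)) * norm (y - a)"
  proof (rule differentiable_bound[OF T(5) _ _ y(1) T(4)])
    show "(F has_derivative F' z) (at z within T)" if "z \<in> T" for z
      using d T(1) that has_derivative_at_withinI by blast
    show "onorm (F' z) \<le> C * norm (F y)" if "z \<in> T" for z
    proof (rule onorm_bound)
      fix h
      have "norm (F' z h) \<le> C * norm (F z) * norm h" using bd T(1) that by blast
      also have "\<dots> \<le> C * norm (F y) * norm h"
        using y(2)[OF that] \<open>0 \<le> C\<close> by (intro mult_right_mono mult_left_mono) auto
      finally show "norm (F' z h) \<le> C * norm (F y) * norm h" .
    qed (use \<open>0 \<le> C\<close> in simp)
  qed
  also have "\<dots> \<le> (C * norm (F y)) * r"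
    using y(1) T(1) \<open>0 \<le> C\<close> by (intro mult_left_mono) (auto simp: dist_norm norm_minus_commute dest!: subsetD)
  finally have "norm (F y) \<le> (C * r) * norm (F y)" using \<open>F a = 0\<close> by (simp add: mult.commute mult.left_commute)
  then have "(1 - C * r) * norm (F y) \<le> 0" by (simp add: algebra_simps)
  then have "norm (F y) \<le> 0" using \<open>C * r < 1\<close> by (simp add: mult_le_0_iff)
  then show ?thesis using y(2)[OF T(3)] by simp
qed

lemma bounded_bilinear_matrix_matrix_mult:
  "bounded_bilinear ((**) :: real^'n::finite^'m::finite \<Rightarrow> real^'k::finite^'n \<Rightarrow> _)"
  unfolding bilinear_conv_bounded_bilinear[symmetric] bilinear_def
  by (intro allI conjI linearI)
    (simp_all add: matrix_add_ldistrib vec_eq_iff matrix_matrix_mult_def sum.distrib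
      distrib_left distrib_right sum_distrib_left mult.assoc mult.left_commute)

lemma sum_option: "(\<Sum>s\<in>UNIV. f s) = f None + (\<Sum>i\<in>UNIV. f (Some i))"
  for f :: "'n::finite option \<Rightarrow> 'b::comm_monoid_add"
  by (simp add: UNIV_option_conv sum.reindex)

lemma frechet_derivative_vec_nth:
  assumes "(f has_derivative f') (at x)"
  shows "frechet_derivative (\<lambda>x. f x $ i) (at x) = (\<lambda>v. f' v $ i)"
  by (rule frechet_derivative_eqI[OF bounded_linear.has_derivative[OF bounded_linear_vec_nth assms]])

lemma partial_deriv_eqI: "(f has_derivative f') (at x) \<Longrightarrow> partial_deriv i f x = f' (axis i 1)"
  unfolding partial_deriv_def by (simp add: frechet_derivative_eqI)

lemma frechet_derivative_partial:
  assumes "f differentiable (at x)"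
  shows "frechet_derivative f (at x) v = (\<Sum>i\<in>UNIV. v $ i * partial_deriv i f x)"
  using linear_eq_sum_axis[OF linear_frechet_derivative[OF assms], of v] by (simp add: partial_deriv_def)

lemma partial_deriv_cong_open:
  assumes "open S" "x \<in> S" "\<And>y. y \<in> S \<Longrightarrow> f y = g y"
  shows "partial_deriv i f x = partial_deriv i g x"
  unfolding partial_deriv_def by (simp add: frechet_derivative_cong_open[OF assms])

lemma C_k_on_partial_deriv: "C_k_on (Suc k) S f \<Longrightarrow> C_k_on k S (partial_deriv i f)"
  unfolding partial_deriv_def[abs_def] by (rule C_k_on_SucD(2))

text \<open>The matrices of the connection on pairs \<open>(f, df)\<close> (the first entry has index \<open>None\<close>) whose
  parallel sections are the solutions of \<open>Hess f = - k f g\<close>.\<close>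

definition tractor :: "('n \<Rightarrow> 'n \<Rightarrow> 'n \<Rightarrow> real^'n::finite \<Rightarrow> real) \<Rightarrow> ('n \<Rightarrow> 'n \<Rightarrow> real^'n \<Rightarrow> real) \<Rightarrow> real \<Rightarrow>
    'n \<Rightarrow> real^'n \<Rightarrow> real^'n option^'n option" where
  "tractor \<Gamma> g k i x = (\<chi> s t. case s of
      None \<Rightarrow> (case t of None \<Rightarrow> 0 | Some l \<Rightarrow> if l = i then 1 else 0)
    | Some j \<Rightarrow> (case t of None \<Rightarrow> - (k * g i j x) | Some l \<Rightarrow> \<Gamma> l i j x))"

lemma tractor_nth [simp]:
  "tractor \<Gamma> g k i x $ None $ None = 0"
  "tractor \<Gamma> g k i x $ None $ Some l = (if l = i then 1 else 0)"
  "tractor \<Gamma> g k i x $ Some j $ None = - (k * g i j x)"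
  "tractor \<Gamma> g k i x $ Some j $ Some l = \<Gamma> l i j x"
  by (simp_all add: tractor_def)

text \<open>Chart expression of a dualistic structure of constant curvature.
  \<open>\<Gamma> l i j\<close> is component \<open>l\<close> of the derivative of the
  \<open>j\<close>-th coordinate field along the \<open>i\<close>-th, and \<open>curv\<close> is
  component \<open>n\<close> of \<open>R(E_j, E_i) E_q = k (g_iq E_j - g_jq E_i)\<close>.\<close>

locale dual_model =
  fixes S :: "(real^'n::finite) set"
    and \<Gamma> \<Gamma>' :: "'n \<Rightarrow> 'n \<Rightarrow> 'n \<Rightarrow> real^'n \<Rightarrow> real"
    and g :: "'n \<Rightarrow> 'n \<Rightarrow> real^'n \<Rightarrow> real" and k :: real
  assumes S: "open S"
    and smooth: "C_k_on m S (\<Gamma> l i j)" "C_k_on m S (\<Gamma>' l i j)" "C_k_on m S (g i j)"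
    and torsion: "x \<in> S \<Longrightarrow> \<Gamma> l i j x = \<Gamma> l j i x" "x \<in> S \<Longrightarrow> \<Gamma>' l i j x = \<Gamma>' l j i x"
    and g_sym: "x \<in> S \<Longrightarrow> g i j x = g j i x"
    and g_pos: "x \<in> S \<Longrightarrow> v \<noteq> 0 \<Longrightarrow> 0 < (\<Sum>i\<in>UNIV. \<Sum>j\<in>UNIV. v $ i * v $ j * g i j x)"
    and dual: "x \<in> S \<Longrightarrow> partial_deriv q (g i j) x =
        (\<Sum>l\<in>UNIV. \<Gamma> l q i x * g l j x) + (\<Sum>l\<in>UNIV. \<Gamma>' l q j x * g i l x)"
    and curv: "x \<in> S \<Longrightarrow> partial_deriv j (\<Gamma> n i q) x - partial_deriv i (\<Gamma> n j q) x
        + (\<Sum>l\<in>UNIV. \<Gamma> l i q x * \<Gamma> n j l x - \<Gamma> l j q x * \<Gamma> n i l x)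
        = k * (g i q x * (if j = n then 1 else 0) - g j q x * (if i = n then 1 else 0))"
    and curv': "x \<in> S \<Longrightarrow> partial_deriv j (\<Gamma>' n i q) x - partial_deriv i (\<Gamma>' n j q) x
        + (\<Sum>l\<in>UNIV. \<Gamma>' l i q x * \<Gamma>' n j l x - \<Gamma>' l j q x * \<Gamma>' n i l x)
        = k * (g i q x * (if j = n then 1 else 0) - g j q x * (if i = n then 1 else 0))"
begin

lemma swap: "dual_model S \<Gamma>' \<Gamma> g k"
proof
  fix x q i j assume x: "x \<in> S"
  have "partial_deriv q (g i j) x = partial_deriv q (g j i) x"
    by (rule partial_deriv_cong_open[OF S x g_sym])
  then show "partial_deriv q (g i j) x =
        (\<Sum>l\<in>UNIV. \<Gamma>' l q i x * g l j x) + (\<Sum>l\<in>UNIV. \<Gamma> l q j x * g i l x)"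
    using dual[OF x] g_sym[OF x] by simp
qed (use S smooth torsion g_sym g_pos curv curv' in auto)

lemma C_tractor: "C_k_on m S (tractor \<Gamma> g k i)"
proof (rule C_k_on_componentwise[OF S], clarsimp simp: Basis_vec_def inner_axis)
  fix s t
  show "C_k_on m S (\<lambda>x. tractor \<Gamma> g k i x $ s $ t)"
  proof (cases s)
    case None then show ?thesis by (cases t) auto
  next
    case (Some j)
    have "C_k_on m S (\<lambda>x. (- k) * g i j x)" by (rule C_k_on_mult[OF S C_k_on_const smooth(3)])
    then show ?thesis using Some smooth(1) by (cases t) (simp_all)
  qed
qed

text \<open>By blocks: the row \<open>None\<close> expresses the symmetry of \<open>g\<close> and of
  \<open>\<Gamma>\<close> in the lower indices; the block (\<open>Some\<close>, \<open>None\<close>)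
  is the Codazzi equation; the block (\<open>Some\<close>, \<open>Some\<close>) is the curvature
  equation, whose right-hand side arises from the products of the entries \<open>- k g\<close> with
  the unit entries.\<close>

lemma tractor_flat:
  assumes x: "x \<in> S"
  shows "frechet_derivative (tractor \<Gamma> g k i) (at x) (axis j 1) + tractor \<Gamma> g k i x ** tractor \<Gamma> g k j x =
      frechet_derivative (tractor \<Gamma> g k j) (at x) (axis i 1) + tractor \<Gamma> g k j x ** tractor \<Gamma> g k i x"
proof -
  let ?A = "tractor \<Gamma> g k"
  have d: "(?A i has_derivative frechet_derivative (?A i) (at x)) (at x)" for i
    by (rule C_k_on_SucD(1)[OF C_tractor x])
  have D: "frechet_derivative (?A i) (at x) (axis j 1) $ s $ t = partial_deriv j (\<lambda>x. ?A i x $ s $ t) x" for i j s t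
    unfolding partial_deriv_def
    using frechet_derivative_vec_nth[OF bounded_linear.has_derivative[OF bounded_linear_vec_nth d]] by metis
  have M: "(?A i x ** ?A j x) $ s $ t = ?A i x $ s $ None * ?A j x $ None $ t
      + (\<Sum>l\<in>UNIV. ?A i x $ s $ Some l * ?A j x $ Some l $ t)" for i j s t
    by (simp add: matrix_matrix_mult_def sum_option)
  have c: "partial_deriv j (\<lambda>x. 0) x = 0" "partial_deriv j (\<lambda>x. if P then 1 else 0) x = 0" for j P
    by (simp_all add: partial_deriv_def)
  have pg: "partial_deriv j (\<lambda>x. - (k * g i q x)) x = - (k * partial_deriv j (g i q) x)" for i j q
    by (rule trans[OF partial_deriv_eqI[OF has_derivative_minus[OF has_derivative_mult_right[OF C_k_on_SucD(1)[OF smooth(3) x]]]]])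
      (simp add: partial_deriv_def)
  \<comment> \<open>Difference of two instances of \<open>dual\<close>: the terms with
    \<open>\<Gamma>'\<close> cancel, the dual connection being torsion-free.\<close>
  have codazzi: "partial_deriv j (g i q) x + (\<Sum>l\<in>UNIV. \<Gamma> l i q x * g j l x) =
      partial_deriv i (g j q) x + (\<Sum>l\<in>UNIV. \<Gamma> l j q x * g i l x)" for q
  proof -
    have "partial_deriv j (g i q) x = partial_deriv j (g q i) x" 
         "partial_deriv i (g j q) x = partial_deriv i (g q j) x"
      by (rule partial_deriv_cong_open[OF S x g_sym], assumption)+
    then show ?thesis
      using dual[OF x, of j q i] dual[OF x, of i q j] torsion(2)[OF x, of _ i j] g_sym[OF x, of i] g_sym[OF x, of j]
      by simp
  qed
  show ?thesis
  proof (clarsimp simp: vec_eq_iff D M)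
    fix s t :: "'n option"
    show "partial_deriv j (\<lambda>x. ?A i x $ s $ t) x + (?A i x $ s $ None * ?A j x $ None $ t
      + (\<Sum>l\<in>UNIV. ?A i x $ s $ Some l * ?A j x $ Some l $ t)) =
       partial_deriv i (\<lambda>x. ?A j x $ s $ t) x + (?A j x $ s $ None * ?A i x $ None $ t
      + (\<Sum>l\<in>UNIV. ?A j x $ s $ Some l * ?A i x $ Some l $ t))"
    proof (cases s)
      case None
      then show ?thesis using torsion(1)[OF x, of _ i j] g_sym[OF x, of i j]
        by (cases t) (simp_all add: c sum_negf if_distrib[where f = "\<lambda>c. c * _"] cong: if_cong)
    next
      case s: (Some q)
      show ?thesis
      proof (cases t)
        case None
        have e: "(\<Sum>l\<in>UNIV. \<Gamma> l i q x * - (k * g j l x)) = - (k * (\<Sum>l\<in>UNIV. \<Gamma> l i q x * g j l x))" for i j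
          unfolding sum_distrib_left sum_negf[symmetric] by (rule sum.cong) auto
        have "- (k * (partial_deriv j (g i q) x + (\<Sum>l\<in>UNIV. \<Gamma> l i q x * g j l x))) =
              - (k * (partial_deriv i (g j q) x + (\<Sum>l\<in>UNIV. \<Gamma> l j q x * g i l x)))"
          unfolding codazzi ..
        then show ?thesis unfolding None s tractor_nth pg e by (simp add: distrib_left)
      next
        case (Some n)
        have "partial_deriv j (\<Gamma> n i q) x - k * g i q x * (if j = n then 1 else 0) + (\<Sum>l\<in>UNIV. \<Gamma> l i q x * \<Gamma> n j l x) =
              partial_deriv i (\<Gamma> n j q) x - k * g j q x * (if i = n then 1 else 0) + (\<Sum>l\<in>UNIV. \<Gamma> l j q x * \<Gamma> n i l x)"
          using curv[OF x, of j n i q] by (simp add: sum_subtractf right_diff_distrib mult.assoc)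
        then show ?thesis unfolding Some s tractor_nth by (cases "j = n"; cases "i = n") auto
      qed
    qed
  qed
qed

end

definition hess_solution :: "('n \<Rightarrow> 'n \<Rightarrow> 'n \<Rightarrow> real^'n::finite \<Rightarrow> real) \<Rightarrow> ('n \<Rightarrow> 'n \<Rightarrow> real^'n \<Rightarrow> real) \<Rightarrow> real \<Rightarrow>
    (real^'n) set \<Rightarrow> (real^'n \<Rightarrow> real) \<Rightarrow> bool" where
  "hess_solution \<Gamma> g k B f \<longleftrightarrow> smooth_on B f \<and> (\<forall>x\<in>B. \<forall>i j. partial_deriv i (partial_deriv j f) x =
     (\<Sum>l\<in>UNIV. \<Gamma> l i j x * partial_deriv l f x) - k * f x * g i j x)"

definition tractor_parallel where
  "tractor_parallel \<Gamma> g k B F \<longleftrightarrow>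
    (\<forall>x\<in>B. (F has_derivative (\<lambda>h. \<Sum>i\<in>UNIV. h $ i *\<^sub>R (tractor \<Gamma> g k i x *v F x))) (at x))"

lemma tractor_parallel_partial:
  assumes "tractor_parallel \<Gamma> g k B F" "x \<in> B"
  shows "((\<lambda>x. F x $ s) has_derivative (\<lambda>h. \<Sum>i\<in>UNIV. h $ i * (tractor \<Gamma> g k i x *v F x) $ s)) (at x)"
    and "partial_deriv i (\<lambda>x. F x $ s) x = (tractor \<Gamma> g k i x *v F x) $ s"
    and "(tractor \<Gamma> g k i x *v F x) $ None = F x $ Some i"
    and "(tractor \<Gamma> g k i x *v F x) $ Some j = (\<Sum>l\<in>UNIV. \<Gamma> l i j x * F x $ Some l) - k * F x $ None * g i j x"
proof -
  have d: "(F has_derivative (\<lambda>h. \<Sum>i\<in>UNIV. h $ i *\<^sub>R (tractor \<Gamma> g k i x *v F x))) (at x)"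
    using assms unfolding tractor_parallel_def by blast
  show D: "((\<lambda>x. F x $ s) has_derivative (\<lambda>h. \<Sum>i\<in>UNIV. h $ i * (tractor \<Gamma> g k i x *v F x) $ s)) (at x)"
    using bounded_linear.has_derivative[OF bounded_linear_vec_nth d, of s] by simp
  show "partial_deriv i (\<lambda>x. F x $ s) x = (tractor \<Gamma> g k i x *v F x) $ s"
    using partial_deriv_eqI[OF D, of i] sum_axis_scaleR[of i "\<lambda>i. (tractor \<Gamma> g k i x *v F x) $ s"] by simp
  show "(tractor \<Gamma> g k i x *v F x) $ None = F x $ Some i"
    by (simp add: matrix_vector_mult_def sum_option if_distrib[where f = "\<lambda>c. c * _"] cong: if_cong)
  show "(tractor \<Gamma> g k i x *v F x) $ Some j = (\<Sum>l\<in>UNIV. \<Gamma> l i j x * F x $ Some l) - k * F x $ None * g i j x"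
    by (simp add: matrix_vector_mult_def sum_option algebra_simps)
qed

text \<open>Bootstrapping: the derivative of a parallel section is a smooth matrix applied to the
  section itself.\<close>

lemma tractor_parallel_smooth:
  assumes B: "open B" and A: "\<And>m i. C_k_on m B (tractor \<Gamma> g k i)" and F: "tractor_parallel \<Gamma> g k B F"
  shows "C_k_on m B F"
proof (induction m)
  case 0
  show ?case using F unfolding tractor_parallel_def
    by (simp add: continuous_at_imp_continuous_on) (meson continuous_at_imp_continuous_on has_derivative_continuous)
next
  case (Suc m)
  show ?case
  proof (rule C_k_on_SucI[OF B])
    show "(F has_derivative (\<lambda>h. \<Sum>i\<in>UNIV. h $ i *\<^sub>R (tractor \<Gamma> g k i x *v F x))) (at x)" if "x \<in> B" for x
      using F that unfolding tractor_parallel_def by blast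
    show "C_k_on m B (\<lambda>x. \<Sum>i\<in>UNIV. v $ i *\<^sub>R (tractor \<Gamma> g k i x *v F x))" for v
      by (rule C_k_on_sum[OF B], rule C_k_on_scaleR[OF B C_k_on_const],
          rule C_k_on_bilinear[OF B bounded_bilinear_matrix_vector_mult A Suc])
  qed
qed

text \<open>The row \<open>None\<close> of the system forces the entries \<open>Some j\<close> to be
  the partial derivatives of the entry \<open>None\<close>; the other rows are then the Hessian
  equation.\<close>

lemma tractor_parallel_hess:
  assumes B: "open B" and A: "\<And>m i. C_k_on m B (tractor \<Gamma> g k i)" and F: "tractor_parallel \<Gamma> g k B F"
  shows "hess_solution \<Gamma> g k B (\<lambda>x. F x $ None)"
    and "x \<in> B \<Longrightarrow> partial_deriv j (\<lambda>x. F x $ None) x = F x $ Some j"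
proof -
  note T = tractor_parallel_partial[OF F]
  show *: "partial_deriv j (\<lambda>x. F x $ None) x = F x $ Some j" if "x \<in> B" for x j
    using T(2,3)[OF that] by simp
  have "partial_deriv i (partial_deriv j (\<lambda>x. F x $ None)) x = partial_deriv i (\<lambda>x. F x $ Some j) x" if "x \<in> B" for x i j
    by (rule partial_deriv_cong_open[OF B that *])
  then show "hess_solution \<Gamma> g k B (\<lambda>x. F x $ None)"
    unfolding hess_solution_def smooth_on_def using T(2,4) *
      C_k_on_vec_nth[OF B tractor_parallel_smooth[OF B A F]] by simp
qed

section \<open>Pairing the solutions for the two connections\<close>

lemma has_derivative_vecI:
  fixes f :: "'a::real_normed_vector \<Rightarrow> 'b::euclidean_space^'n"
  assumes "\<And>i. ((\<lambda>x. f x $ i) has_derivative (\<lambda>v. f' v $ i)) (at x)"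
  shows "(f has_derivative f') (at x)"
  unfolding has_derivative_componentwise_within[of f]
  by (auto simp: Basis_vec_def inner_axis intro!: has_derivative_inner_left assms)

text \<open>The weight is 1 at \<open>None\<close> and \<alpha> elsewhere: division by the entries
  at \<open>None\<close> turns the pairing into 1 plus \<alpha> times an inner product, the argument
  of the logarithm in \<open>log_cost\<close>.\<close>

definition pairing :: "real \<Rightarrow> ('n::finite option \<Rightarrow> real) \<Rightarrow> ('n option \<Rightarrow> real) \<Rightarrow> real" where
  "pairing \<alpha> u v = u None * v None + \<alpha> * (\<Sum>i\<in>UNIV. u (Some i) * v (Some i))"

lemma pairing_eq_sum: "pairing \<alpha> u v = (\<Sum>s\<in>UNIV. (case s of None \<Rightarrow> 1 | Some i \<Rightarrow> \<alpha>) * u s * v s)"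
  by (simp add: pairing_def sum_option sum_distrib_left mult.assoc)

text \<open>Values that the pairings of 1-jets are to take at a single point: the index
  \<open>None\<close> stands for the function, \<open>Some i\<close> for its derivative in direction
  \<open>i\<close>.\<close>

definition gram :: "('n \<Rightarrow> 'n \<Rightarrow> real^'n::finite \<Rightarrow> real) \<Rightarrow> real \<Rightarrow> real^'n \<Rightarrow> real^'n option^'n option" where
  "gram g k x = (\<chi> s t. case s of
      None \<Rightarrow> (case t of None \<Rightarrow> 1 | Some j \<Rightarrow> 0)
    | Some i \<Rightarrow> (case t of None \<Rightarrow> 0 | Some j \<Rightarrow> k * g i j x))"

lemma gram_nth [simp]:
  "gram g k x $ None $ None = 1" "gram g k x $ None $ Some j = 0"
  "gram g k x $ Some i $ None = 0" "gram g k x $ Some i $ Some j = k * g i j x"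
  by (simp_all add: gram_def)

context dual_model
begin

lemma parallel_sections:
  assumes "a \<in> S"
  obtains r where "0 < r" "ball a r \<subseteq> S"
    "\<And>u. \<exists>F. F a = u \<and> tractor_parallel \<Gamma> g k (ball a r) F"
  using linear_frobenius[of S a "tractor \<Gamma> g k", OF S assms C_tractor tractor_flat]
  unfolding tractor_parallel_def by blast

text \<open>diag(1, k g) is parallel for the product of the two systems. In the block of
  \<open>g\<close> this is the duality of the connections; in the mixed entries the unit entries of
  one system cancel the \<open>- k g\<close> of the other.\<close>

lemma gram_derivative:
  assumes x: "x \<in> S"
  shows "(gram g k has_derivative (\<lambda>h. \<Sum>i\<in>UNIV. h $ i *\<^sub>R (tractor \<Gamma> g k i x ** gram g k x
      + gram g k x ** transpose (tractor \<Gamma>' g k i x)))) (at x)"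
proof (intro has_derivative_vecI)
  fix s t :: "'n option"
  have d: "(g i j has_derivative (\<lambda>h. \<Sum>q\<in>UNIV. h $ q * partial_deriv q (g i j) x)) (at x)" for i j
    using C_k_on_SucD(1)[OF smooth(3) x] frechet_derivative_partial[of "g i j" x]
    by (metis (no_types, lifting) differentiableI ext)
  have e: "(tractor \<Gamma> g k q x ** gram g k x + gram g k x ** transpose (tractor \<Gamma>' g k q x)) $ s $ t =
      (case s of None \<Rightarrow> 0 | Some i \<Rightarrow> (case t of None \<Rightarrow> 0 | Some j \<Rightarrow> k * partial_deriv q (g i j) x))" for q
    using g_sym[OF x]
    by (cases s; cases t) (simp_all add: matrix_matrix_mult_def transpose_def sum_option dual[OF x] 
       distrib_left sum_distrib_left mult.left_commute mult.commute if_distrib[where f = "\<lambda>c. c * _"]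
       if_distrib[where f = "\<lambda>c. _ * c"] cong: if_cong)
  show "((\<lambda>x. gram g k x $ s $ t) has_derivative (\<lambda>h. (\<Sum>i\<in>UNIV. h $ i *\<^sub>R (tractor \<Gamma> g k i x ** gram g k x
      + gram g k x ** transpose (tractor \<Gamma>' g k i x))) $ s $ t)) (at x)"
    unfolding sum_component vector_scaleR_component e
    using has_derivative_mult_right[OF d, of k]
    by (cases s; cases t) (simp_all add: sum_distrib_left mult.left_commute)
qed

text \<open>The matrix \<open>W\<close> of the pairings of 1-jets and \<open>gram\<close> satisfy
  the same linear equation, and the initial values at \<open>a\<close> are chosen so that they agree
  there; uniqueness does the rest.\<close>

theorem pairing_identities:
  assumes a: "a \<in> S" and \<alpha>: "\<alpha> \<noteq> 0"
  obtains r F H where "0 < r" "ball a r \<subseteq> S"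
    "\<And>s. tractor_parallel \<Gamma> g k (ball a r) (F s)" "\<And>s. tractor_parallel \<Gamma>' g k (ball a r) (H s)"
    "\<And>s. F s a = axis s 1" "H None a $ None = 1"
    "\<And>x p q. x \<in> ball a r \<Longrightarrow> pairing \<alpha> (\<lambda>s. F s x $ p) (\<lambda>s. H s x $ q) = gram g k x $ p $ q"
proof -
  let ?A = "tractor \<Gamma> g k" and ?A' = "tractor \<Gamma>' g k" and ?T = "gram g k"
  let ?c = "\<lambda>s::'n option. case s of None \<Rightarrow> 1 | Some i \<Rightarrow> \<alpha>"
  obtain r1 where r1: "0 < r1" "ball a r1 \<subseteq> S" "\<And>u. \<exists>F. F a = u \<and> tractor_parallel \<Gamma> g k (ball a r1) F"
    using parallel_sections[OF a] by blast
  obtain r2 where r2: "0 < r2" "ball a r2 \<subseteq> S" "\<And>u. \<exists>F. F a = u \<and> tractor_parallel \<Gamma>' g k (ball a r2) F"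
    using dual_model.parallel_sections[OF swap a] by blast
  obtain r3 M where r3: "0 < r3" "0 < M" "\<And>x i. x \<in> ball a r3 \<Longrightarrow> norm (?A i x) \<le> M"
    by (rule continuous_family_locally_bounded[where A = ?A and S = S and a = a, OF S a C_k_on_imp_continuous[OF C_tractor]]) blast
  have ct: "continuous_on S (\<lambda>x. transpose (?A' i x))" for i
  proof -
    have "linear (transpose :: real^'n option^'n option \<Rightarrow> _)"
      by (rule linearI) (simp_all add: transpose_def vec_eq_iff)
    then show ?thesis
      using linear_continuous_on_compose[OF C_k_on_imp_continuous[OF dual_model.C_tractor[OF swap]]] by blast
  qed
  obtain r4 M' where r4: "0 < r4" "0 < M'" "\<And>x i. x \<in> ball a r4 \<Longrightarrow> norm (transpose (?A' i x)) \<le> M'"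
    by (rule continuous_family_locally_bounded[where A = "\<lambda>i x. transpose (?A' i x)" and S = S and a = a, OF S a ct]) blast
  obtain K where K: "0 < K" "norm (P ** Q) \<le> norm P * norm Q * K" for P Q :: "real^'n option^'n option"
    using bounded_bilinear.pos_bounded[OF bounded_bilinear_matrix_matrix_mult] by blast
  \<comment> \<open>Bound for the linear equation of \<open>W - gram\<close>: one term for each of
    the directions, with \<open>K\<close> the constant of matrix multiplication. The radius chosen
    below makes \<open>C * r\<close> at most 1/2.\<close>
  define C where "C = real CARD('n) * (M * K + M' * K)"
  have C: "C > 0" unfolding C_def using r3 r4 K by (simp add: add_pos_pos)
  define r where "r = Min {r1, r2, r3, r4, 1 / (2 * C)}"
  have r: "0 < r" "r \<le> r1" "r \<le> r2" "r \<le> r3" "r \<le> r4" "r \<le> 1 / (2 * C)"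
    using r1 r2 r3 r4 C by (auto simp: r_def)
  have Cr: "C * r < 1" using mult_left_mono[OF r(6), of C] C by simp
  have "\<exists>F. \<forall>s. F s a = axis s 1 \<and> tractor_parallel \<Gamma> g k (ball a r1) (F s)"
    using r1(3) by (intro choice) blast
  then obtain F where F: "F s a = axis s 1" "tractor_parallel \<Gamma> g k (ball a r1) (F s)" for s by blast
  \<comment> \<open>Since the \<open>F s a\<close> are the unit vectors, row \<open>s\<close> of
    \<open>W a\<close> is \<open>?c s\<close> times \<open>H s a\<close>; hence the division by the
    weight.\<close>
  have "\<exists>H. \<forall>s. H s a = (\<chi> t. ?T a $ s $ t / ?c s) \<and> tractor_parallel \<Gamma>' g k (ball a r2) (H s)"
    using r2(3) by (intro choice) blast
  then obtain H where H: "H s a = (\<chi> t. ?T a $ s $ t / ?c s)" "tractor_parallel \<Gamma>' g k (ball a r2) (H s)" for s by blast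
  have F': "tractor_parallel \<Gamma> g k (ball a r) (F s)" and H': "tractor_parallel \<Gamma>' g k (ball a r) (H s)" for s
    using F(2)[of s] H(2)[of s] r by (auto simp: tractor_parallel_def)
  define W where "W x = (\<chi> p q. pairing \<alpha> (\<lambda>s. F s x $ p) (\<lambda>s. H s x $ q))" for x
  have dW: "(W has_derivative (\<lambda>h. \<Sum>i\<in>UNIV. h $ i *\<^sub>R (?A i x ** W x + W x ** transpose (?A' i x)))) (at x)"
    if x: "x \<in> ball a r" for x
  proof (intro has_derivative_vecI)
    fix p q
    have "((\<lambda>x. \<Sum>s\<in>UNIV. ?c s * F s x $ p * H s x $ q) has_derivative
      (\<lambda>h. \<Sum>s\<in>UNIV. ?c s * F s x $ p * (\<Sum>i\<in>UNIV. h $ i * (?A' i x *v H s x) $ q) +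
         (?c s * (\<Sum>i\<in>UNIV. h $ i * (?A i x *v F s x) $ p)) * H s x $ q)) (at x)"
      by (intro has_derivative_sum has_derivative_mult has_derivative_mult_right
          tractor_parallel_partial(1)[OF F' x] tractor_parallel_partial(1)[OF H' x])
    also have "(\<lambda>h. \<Sum>s\<in>UNIV. ?c s * F s x $ p * (\<Sum>i\<in>UNIV. h $ i * (?A' i x *v H s x) $ q) +
         (?c s * (\<Sum>i\<in>UNIV. h $ i * (?A i x *v F s x) $ p)) * H s x $ q) =
       (\<lambda>h. (\<Sum>i\<in>UNIV. h $ i *\<^sub>R (?A i x ** W x + W x ** transpose (?A' i x))) $ p $ q)"
    proof
      fix h :: "real^'n"
      have "(\<Sum>s\<in>UNIV. ?c s * F s x $ p * (\<Sum>i\<in>UNIV. h $ i * (?A' i x *v H s x) $ q)) =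
         (\<Sum>i\<in>UNIV. h $ i * (\<Sum>s\<in>UNIV. ?c s * F s x $ p * (?A' i x *v H s x) $ q))"
        unfolding sum_distrib_left by (subst sum.swap) (intro sum.cong refl, simp)
      moreover have "(\<Sum>s\<in>UNIV. ?c s * F s x $ p * (?A' i x *v H s x) $ q) = (W x ** transpose (?A' i x)) $ p $ q" for i
        unfolding W_def pairing_eq_sum matrix_matrix_mult_def transpose_def matrix_vector_mult_def vec_lambda_beta
          sum_distrib_left sum_distrib_right by (subst sum.swap) (intro sum.cong refl, simp)
      moreover have "(\<Sum>s\<in>UNIV. ?c s * (\<Sum>i\<in>UNIV. h $ i * (?A i x *v F s x) $ p) * H s x $ q) =
         (\<Sum>i\<in>UNIV. h $ i * (\<Sum>s\<in>UNIV. ?c s * (?A i x *v F s x) $ p * H s x $ q))"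
        unfolding sum_distrib_left sum_distrib_right by (subst sum.swap) (intro sum.cong refl, simp)
      moreover have "(\<Sum>s\<in>UNIV. ?c s * (?A i x *v F s x) $ p * H s x $ q) = (?A i x ** W x) $ p $ q" for i
        unfolding W_def pairing_eq_sum matrix_matrix_mult_def transpose_def matrix_vector_mult_def vec_lambda_beta
          sum_distrib_left sum_distrib_right by (subst sum.swap) (intro sum.cong refl, simp)
      ultimately show "(\<Sum>s\<in>UNIV. ?c s * F s x $ p * (\<Sum>i\<in>UNIV. h $ i * (?A' i x *v H s x) $ q) +
         (?c s * (\<Sum>i\<in>UNIV. h $ i * (?A i x *v F s x) $ p)) * H s x $ q) =
         (\<Sum>i\<in>UNIV. h $ i *\<^sub>R (?A i x ** W x + W x ** transpose (?A' i x))) $ p $ q"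
        by (simp add: sum.distrib distrib_left)
    qed
    finally show "((\<lambda>x. W x $ p $ q) has_derivative
       (\<lambda>h. (\<Sum>i\<in>UNIV. h $ i *\<^sub>R (?A i x ** W x + W x ** transpose (?A' i x))) $ p $ q)) (at x)"
      by (simp add: W_def pairing_eq_sum)
  qed
  have rS: "ball a r \<subseteq> S" using r(2) r1(2) by (meson order_trans subset_ball)
  let ?X = "\<lambda>x. W x - ?T x"
  have X0: "?X x = 0" if "x \<in> ball a r" for x
  proof (rule linear_ode_zero[where F = ?X, OF _ _ _ _ Cr that])
    fix x assume x: "x \<in> ball a r"
    let ?D = "\<lambda>h. \<Sum>i\<in>UNIV. h $ i *\<^sub>R (?A i x ** ?X x + ?X x ** transpose (?A' i x))"
    have "(?X has_derivative (\<lambda>h. (\<Sum>i\<in>UNIV. h $ i *\<^sub>R (?A i x ** W x + W x ** transpose (?A' i x))) -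
       (\<Sum>i\<in>UNIV. h $ i *\<^sub>R (?A i x ** ?T x + ?T x ** transpose (?A' i x))))) (at x)"
      using x rS by (intro has_derivative_diff dW gram_derivative) auto
    also have "(\<lambda>h. (\<Sum>i\<in>UNIV. h $ i *\<^sub>R (?A i x ** W x + W x ** transpose (?A' i x))) -
       (\<Sum>i\<in>UNIV. h $ i *\<^sub>R (?A i x ** ?T x + ?T x ** transpose (?A' i x)))) = ?D"
      by (simp add: fun_eq_iff flip: sum_subtractf scaleR_right_diff_distrib)
        (simp add: bounded_bilinear.diff_left[OF bounded_bilinear_matrix_matrix_mult]
          bounded_bilinear.diff_right[OF bounded_bilinear_matrix_matrix_mult] algebra_simps)
    finally show "(?X has_derivative ?D) (at x)" .
    fix h :: "real^'n"
    have "norm (h $ i *\<^sub>R (?A i x ** ?X x + ?X x ** transpose (?A' i x)))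
        \<le> norm h * ((M * K + M' * K) * norm (?X x))" for i
    proof -
      have "norm (?A i x ** ?X x) \<le> norm (?A i x) * (norm (?X x) * K)" using K(2)[of "?A i x" "?X x"] by (simp add: mult.assoc)
      also have "\<dots> \<le> M * (norm (?X x) * K)" using r3(3)[of x i] x r K(1) by (intro mult_right_mono) auto
      finally have 1: "norm (?A i x ** ?X x) \<le> M * (norm (?X x) * K)" .
      have "norm (?X x ** transpose (?A' i x)) \<le> norm (transpose (?A' i x)) * (norm (?X x) * K)"
        using K(2)[of "?X x" "transpose (?A' i x)"] by (simp add: mult.assoc mult.left_commute)
      also have "\<dots> \<le> M' * (norm (?X x) * K)" using r4(3)[of x i] x r K(1) by (intro mult_right_mono) auto
      finally have 2: "norm (?X x ** transpose (?A' i x)) \<le> M' * (norm (?X x) * K)" .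
      have "norm (?A i x ** ?X x + ?X x ** transpose (?A' i x)) \<le> (M * K + M' * K) * norm (?X x)"
        using norm_triangle_le[OF add_mono[OF 1 2]] by (simp add: algebra_simps)
      moreover have "0 \<le> (M * K + M' * K) * norm (?X x)" using r3 r4 K by simp
      ultimately show ?thesis using component_le_norm_cart[of h i] unfolding norm_scaleR
        by (intro mult_mono) auto
    qed
    then have "norm (?D h) \<le> (\<Sum>i\<in>(UNIV::'n set). norm h * ((M * K + M' * K) * norm (?X x)))"
      by (intro sum_norm_le) auto
    then show "norm (?D h) \<le> C * norm (?X x) * norm h" by (simp add: C_def algebra_simps)
  next
    have "W a $ p $ q = ?T a $ p $ q" for p q
    proof -
      have "W a $ p $ q = (\<Sum>s\<in>UNIV. if s = p then ?c s * H s a $ q else 0)"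
        unfolding W_def vec_lambda_beta pairing_eq_sum by (intro sum.cong refl) (simp add: F(1) axis_def)
      then show ?thesis using \<alpha> by (simp add: H(1) split: option.split)
    qed
    then show "?X a = 0" by (simp add: vec_eq_iff)
  qed (use C in auto)
  have "H None a $ None = 1" by (simp add: H(1))
  then show thesis
  proof (rule that[OF r(1) rS F' H' F(1)])
    show "pairing \<alpha> (\<lambda>s. F s x $ p) (\<lambda>s. H s x $ q) = gram g k x $ p $ q" if "x \<in> ball a r" for x p q
      using X0[OF that] by (simp add: W_def vec_eq_iff)
  qed
qed

end

section \<open>The strict sign of the pairing minus 1 off the diagonal\<close>

lemma has_derivative_partial:
  assumes "C_k_on (Suc m) S f" "x \<in> S"
  shows "(f has_derivative (\<lambda>h. \<Sum>i\<in>UNIV. h $ i * partial_deriv i f x)) (at x)"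
proof -
  have "(f has_derivative frechet_derivative f (at x)) (at x)" by (rule C_k_on_SucD(1)[OF assms])
  moreover have "frechet_derivative f (at x) = (\<lambda>h. \<Sum>i\<in>UNIV. h $ i * partial_deriv i f x)"
    using frechet_derivative_partial[OF differentiableI[OF calculation]] by (rule ext)
  ultimately show ?thesis by simp
qed

lemma partial_deriv_scale:
  assumes "f differentiable (at x)"
  shows "partial_deriv i (\<lambda>x. c * f x) x = c * partial_deriv i f x"
  by (rule partial_deriv_eqI[THEN trans, OF has_derivative_mult_right[OF has_derivative_frechet[OF assms]]])
    (simp add: partial_deriv_def)

lemma partial_deriv_mult_const:
  assumes "f differentiable (at x)"
  shows "partial_deriv i (\<lambda>x. f x * c) x = partial_deriv i f x * c"
  using partial_deriv_scale[OF assms, of i c] by (simp add: mult.commute)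

lemma partial_deriv_sum:
  assumes "\<And>s. s \<in> I \<Longrightarrow> f s differentiable (at x)"
  shows "partial_deriv i (\<lambda>x. \<Sum>s\<in>I. f s x) x = (\<Sum>s\<in>I. partial_deriv i (f s) x)"
  by (rule partial_deriv_eqI[THEN trans, OF has_derivative_sum[OF has_derivative_frechet[OF assms]]])
    (simp_all add: partial_deriv_def)

lemma pairing_partial_left:
  assumes "\<And>s. f s differentiable (at x)"
  shows "partial_deriv i (\<lambda>x. pairing \<alpha> (\<lambda>s. f s x) v) x = pairing \<alpha> (\<lambda>s. partial_deriv i (f s) x) v"
proof -
  have d: "(\<lambda>x. c * f s x) differentiable (at x)" for c s using assms by simp
  then have d2: "(\<lambda>x. c * f s x * e) differentiable (at x)" for c e s by simp
  show ?thesis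
    unfolding pairing_eq_sum
    by (simp add: partial_deriv_sum[OF d2] partial_deriv_mult_const[OF d] partial_deriv_scale[OF assms])
qed

lemma pairing_commute: "pairing \<alpha> u v = pairing \<alpha> v u"
  by (simp add: pairing_def mult.commute)

lemma C_k_on_pairing:
  assumes "open S" "\<And>s. C_k_on m S (u s)" "\<And>s. C_k_on m S (v s)"
  shows "C_k_on m S (\<lambda>x. pairing \<alpha> (\<lambda>s. u s x) (\<lambda>s. v s x))"
  unfolding pairing_eq_sum
  by (rule C_k_on_sum[OF assms(1)], rule C_k_on_mult[OF assms(1) C_k_on_mult[OF assms(1) C_k_on_const assms(2)] assms(3)])

text \<open>The mean value theorem is used twice on the segment from \<open>y\<close> to
  \<open>x\<close>: the derivative along it vanishes at \<open>y\<close> and increases, so it is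
  positive at the intermediate point that gives \<open>\<phi> x - \<phi> y\<close>.\<close>

lemma strict_minimum_of_positive_hessian:
  fixes \<phi> :: "real^'n::finite \<Rightarrow> real"
  assumes B: "open B" "convex B" and C: "C_k_on 2 B \<phi>" and y: "y \<in> B" and grad: "\<And>i. partial_deriv i \<phi> y = 0"
    and hess: "\<And>z v. z \<in> B \<Longrightarrow> v \<noteq> 0 \<Longrightarrow> 0 < (\<Sum>i\<in>UNIV. \<Sum>j\<in>UNIV. v $ i * v $ j * partial_deriv i (partial_deriv j \<phi>) z)"
    and x: "x \<in> B" "x \<noteq> y"
  shows "\<phi> y < \<phi> x"
proof -
  define v where "v = x - y"
  define p where "p t = y + t *\<^sub>R v" for t
  have pB: "p t \<in> B" if "0 \<le> t" "t \<le> 1" for t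
  proof -
    have "p t = (1 - t) *\<^sub>R y + t *\<^sub>R x" by (simp add: p_def v_def algebra_simps)
    then show ?thesis using convexD_alt[OF B(2) y x(1) that] by simp
  qed
  have C2: "C_k_on (Suc (Suc 0)) B \<phi>" using C by (simp add: numeral_2_eq_2)
  have chain: "((\<lambda>t. f (p t)) has_real_derivative (\<Sum>i\<in>UNIV. v $ i * partial_deriv i f (p t))) (at t)"
    if f: "C_k_on (Suc m) B f" and t: "0 \<le> t" "t \<le> 1" for f m t
  proof -
    have "((\<lambda>t. f (p t)) has_derivative (\<lambda>s. \<Sum>i\<in>UNIV. (s *\<^sub>R v) $ i * partial_deriv i f (p t))) (at t)"
      by (rule has_derivative_compose[where f = p and g = f, OF _ has_derivative_partial[OF f pB[OF t]]])
        (auto simp: p_def[abs_def] intro!: derivative_eq_intros)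
    also have "(\<lambda>s. \<Sum>i\<in>UNIV. (s *\<^sub>R v) $ i * partial_deriv i f (p t)) = (*) (\<Sum>i\<in>UNIV. v $ i * partial_deriv i f (p t))"
      unfolding sum_distrib_right by (rule ext, rule sum.cong) auto
    finally show ?thesis by (simp add: has_field_derivative_def)
  qed
  define \<psi>' where "\<psi>' t = (\<Sum>j\<in>UNIV. v $ j * partial_deriv j \<phi> (p t))" for t
  have d1: "((\<lambda>t. \<phi> (p t)) has_real_derivative \<psi>' t) (at t)" if "0 \<le> t" "t \<le> 1" for t
    unfolding \<psi>'_def by (rule chain[OF C2 that])
  have d2: "(\<psi>' has_real_derivative (\<Sum>j\<in>UNIV. v $ j * (\<Sum>i\<in>UNIV. v $ i * partial_deriv i (partial_deriv j \<phi>) (p t)))) (at t)"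
    if "0 \<le> t" "t \<le> 1" for t
    unfolding \<psi>'_def[abs_def] by (intro DERIV_sum DERIV_cmult chain[OF C_k_on_partial_deriv[OF C2] that])
  obtain s where s: "0 < s" "s < 1" "\<phi> (p 1) - \<phi> (p 0) = (1 - 0) * \<psi>' s" using MVT2[of 0 1 "\<lambda>t. \<phi> (p t)" \<psi>', OF zero_less_one d1] by blast
  obtain u where u: "0 < u" "u < s" "\<psi>' s - \<psi>' 0 =
      (s - 0) * (\<Sum>j\<in>UNIV. v $ j * (\<Sum>i\<in>UNIV. v $ i * partial_deriv i (partial_deriv j \<phi>) (p u)))"
    using MVT2[of 0 s \<psi>', OF s(1) d2] s by (metis (no_types, lifting) less_imp_le order_trans)
  have "\<psi>' 0 = 0" using grad by (simp add: \<psi>'_def p_def)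
  moreover have "(\<Sum>j\<in>UNIV. v $ j * (\<Sum>i\<in>UNIV. v $ i * partial_deriv i (partial_deriv j \<phi>) (p u))) =
     (\<Sum>i\<in>UNIV. \<Sum>j\<in>UNIV. v $ i * v $ j * partial_deriv i (partial_deriv j \<phi>) (p u))"
    unfolding sum_distrib_left by (subst sum.swap) (simp add: mult.assoc mult.left_commute)
  moreover have "0 < (\<Sum>i\<in>UNIV. \<Sum>j\<in>UNIV. v $ i * v $ j * partial_deriv i (partial_deriv j \<phi>) (p u))"
    using u s x by (intro hess pB) (auto simp: v_def)
  ultimately have "0 < \<psi>' s" using u s by simp
  then show ?thesis using s by (simp add: p_def v_def)
qed

text \<open>One radius for all \<open>v\<close>: compactness of the unit sphere yields a positive
  minimum, continuity of the coefficients preserves half of it nearby, and homogeneity takes care of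
  the other vectors.\<close>

lemma positive_quadratic_form_near:
  fixes Q :: "'n::finite \<Rightarrow> 'n \<Rightarrow> 'z::metric_space \<Rightarrow> real"
  assumes Z: "open Z" "z0 \<in> Z" and cont: "\<And>i j. continuous_on Z (Q i j)"
    and pos: "\<And>v :: real^'n. v \<noteq> 0 \<Longrightarrow> 0 < (\<Sum>i\<in>UNIV. \<Sum>j\<in>UNIV. v $ i * v $ j * Q i j z0)"
  obtains d where "0 < d"
    "\<And>z v :: real^'n. dist z z0 < d \<Longrightarrow> v \<noteq> 0 \<Longrightarrow> 0 < (\<Sum>i\<in>UNIV. \<Sum>j\<in>UNIV. v $ i * v $ j * Q i j z)"
proof -
  let ?q = "\<lambda>z (v::real^'n). \<Sum>i\<in>UNIV. \<Sum>j\<in>UNIV. v $ i * v $ j * Q i j z"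
  have c: "continuous_on (sphere 0 1) (?q z0)" by (intro continuous_intros)
  have "axis (undefined::'n) (1::real) \<in> sphere 0 1" by simp
  then have ne: "sphere (0::real^'n) 1 \<noteq> {}" by blast
  obtain v0 where v0: "v0 \<in> sphere 0 1" "\<And>v. v \<in> sphere 0 1 \<Longrightarrow> ?q z0 v0 \<le> ?q z0 v"
    using continuous_attains_inf[OF compact_sphere ne c] by blast
  define l where "l = ?q z0 v0"
  have "v0 \<noteq> 0" using v0(1) by auto
  then have l: "l > 0" unfolding l_def by (rule pos)
  define N where "N = real CARD('n)"
  have N: "N > 0" by (simp add: N_def)
  \<comment> \<open>A change of each of the \<open>N * N\<close> coefficients by at most
    \<open>e\<close> changes the form on unit vectors by at most \<open>l / 2\<close>.\<close>
  define e where "e = l / (2 * N * N)"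
  have e: "e > 0" using l N by (simp add: e_def)
  have "\<exists>d>0. \<forall>z. dist z z0 < d \<longrightarrow> dist (Q i j z) (Q i j z0) < e" for i j
    using cont[of i j] Z e unfolding continuous_on_eq_continuous_at[OF Z(1)] continuous_at_eps_delta by blast
  then have "\<exists>d. \<forall>i j. d i j > 0 \<and> (\<forall>z. dist z z0 < d i j \<longrightarrow> dist (Q i j z) (Q i j z0) < e)" by metis
  then obtain d where d: "\<And>i j. d i j > 0" "\<And>i j z. dist z z0 < d i j \<Longrightarrow> dist (Q i j z) (Q i j z0) < e" by blast
  define D where "D = Min (range (\<lambda>(i, j). d i j))"
  have D: "D > 0" "D \<le> d i j" for i j
    using d(1) by (auto simp: D_def intro: Min_le intro!: rev_image_eqI[of "(i, j)"])
  have unit: "0 < ?q z v" if z: "dist z z0 < D" and v: "norm v = 1" for z and v :: "real^'n"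
  proof -
    have "\<bar>v $ i\<bar> \<le> 1" for i using component_le_norm_cart[of v i] v by simp
    then have "\<bar>v $ i * v $ j\<bar> \<le> 1" for i j by (simp add: abs_mult mult_le_one)
    moreover have "\<bar>Q i j z - Q i j z0\<bar> \<le> e" for i j using d(2)[of z i j] z D(2)[of i j] by (simp add: dist_real_def)
    ultimately have "\<bar>v $ i * v $ j * (Q i j z - Q i j z0)\<bar> \<le> 1 * e" for i j
      unfolding abs_mult[of "v $ i * v $ j"] by (intro mult_mono) auto
    then have "\<bar>\<Sum>i\<in>UNIV. \<Sum>j\<in>UNIV. v $ i * v $ j * (Q i j z - Q i j z0)\<bar> \<le> (\<Sum>i\<in>(UNIV::'n set). \<Sum>j\<in>(UNIV::'n set). e)"
      by (intro order_trans[OF sum_abs] sum_mono) auto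
    also have "\<dots> = l / 2" using N by (simp add: e_def N_def)
    finally have "\<bar>?q z v - ?q z0 v\<bar> \<le> l / 2" by (simp add: right_diff_distrib sum_subtractf)
    moreover have "l \<le> ?q z0 v" unfolding l_def using v by (intro v0(2)) simp
    ultimately show ?thesis using l by linarith
  qed
  show thesis
  proof (rule that[OF D(1)])
    fix z and v :: "real^'n" assume z: "dist z z0 < D" and "v \<noteq> 0"
    define w where "w = v /\<^sub>R norm v"
    have "0 < ?q z w" using \<open>v \<noteq> 0\<close> by (intro unit[OF z]) (simp add: w_def)
    also have "?q z v = (norm v)\<^sup>2 * ?q z w"
      using \<open>v \<noteq> 0\<close> by (simp add: w_def sum_distrib_left power2_eq_square field_simps)
    ultimately show "0 < ?q z v" using \<open>v \<noteq> 0\<close> by simp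
  qed
qed

lemma positive_near:
  fixes u :: "'z::metric_space \<Rightarrow> real"
  assumes "open Z" "z0 \<in> Z" "continuous_on Z u" "0 < u z0"
  shows "\<exists>e>0. \<forall>x. dist x z0 < e \<longrightarrow> 0 < u x"
proof -
  have "isCont u z0" using assms continuous_on_eq_continuous_at by blast
  then obtain e where e: "e > 0" "\<And>x. dist x z0 < e \<Longrightarrow> dist (u x) (u z0) < u z0"
    using assms(4) unfolding continuous_at_eps_delta by blast
  have "0 < u x" if "dist x z0 < e" for x using e(2)[OF that] by (simp add: dist_real_def abs_if split: if_splits)
  then show ?thesis using e(1) by blast
qed

theorem (in dual_model) local_solutions:
  assumes a: "a \<in> S" and \<alpha>: "\<alpha> \<noteq> 0" and k: "k \<noteq> 0"
  obtains r and f h :: "'n option \<Rightarrow> real^'n \<Rightarrow> real" where "0 < r" "ball a r \<subseteq> S"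
    "\<And>s. hess_solution \<Gamma> g k (ball a r) (f s)" "\<And>s. hess_solution \<Gamma>' g k (ball a r) (h s)"
    "\<And>x. x \<in> ball a r \<Longrightarrow> 0 < f None x" "\<And>x. x \<in> ball a r \<Longrightarrow> 0 < h None x"
    "\<And>x. x \<in> ball a r \<Longrightarrow> pairing \<alpha> (\<lambda>s. f s x) (\<lambda>s. h s x) = 1"
    "\<And>x i. x \<in> ball a r \<Longrightarrow> pairing \<alpha> (\<lambda>s. partial_deriv i (f s) x) (\<lambda>s. h s x) = 0"
    "\<And>x j. x \<in> ball a r \<Longrightarrow> pairing \<alpha> (\<lambda>s. f s x) (\<lambda>s. partial_deriv j (h s) x) = 0"
    "\<And>x i j. x \<in> ball a r \<Longrightarrow> pairing \<alpha> (\<lambda>s. partial_deriv i (f s) x) (\<lambda>s. partial_deriv j (h s) x) = k * g i j x"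
    "\<And>x y. x \<in> ball a r \<Longrightarrow> y \<in> ball a r \<Longrightarrow> 0 < pairing \<alpha> (\<lambda>s. f s x) (\<lambda>s. h s y)"
    "\<And>x y. x \<in> ball a r \<Longrightarrow> y \<in> ball a r \<Longrightarrow> x \<noteq> y \<Longrightarrow> 0 < - k * (pairing \<alpha> (\<lambda>s. f s x) (\<lambda>s. h s y) - 1)"
proof -
  obtain r0 F H where r0: "0 < r0" "ball a r0 \<subseteq> S"
    and F: "\<And>s. tractor_parallel \<Gamma> g k (ball a r0) (F s)" and H: "\<And>s. tractor_parallel \<Gamma>' g k (ball a r0) (H s)"
    and F0: "\<And>s. F s a = axis s 1" and H0: "H None a $ None = 1"
    and pair: "\<And>x p q. x \<in> ball a r0 \<Longrightarrow> pairing \<alpha> (\<lambda>s. F s x $ p) (\<lambda>s. H s x $ q) = gram g k x $ p $ q"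
    by (rule pairing_identities[OF a \<alpha>]) blast
  let ?B0 = "ball a r0"
  define f where "f s x = F s x $ None" for s x
  define h where "h s x = H s x $ None" for s x
  have CA: "C_k_on m ?B0 (tractor \<Gamma> g k i)" "C_k_on m ?B0 (tractor \<Gamma>' g k i)" for m i
    using C_k_on_subset[OF C_tractor r0(2)] C_k_on_subset[OF dual_model.C_tractor[OF swap] r0(2)] by auto
  have hf: "hess_solution \<Gamma> g k ?B0 (f s)" and hh: "hess_solution \<Gamma>' g k ?B0 (h s)" for s
    unfolding f_def h_def by (rule tractor_parallel_hess(1)[OF open_ball CA(1) F] tractor_parallel_hess(1)[OF open_ball CA(2) H])+
  have Cf: "C_k_on m ?B0 (f s)" and Ch: "C_k_on m ?B0 (h s)" for m s
    using hf hh by (auto simp: hess_solution_def smooth_on_def)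
  have pf: "partial_deriv i (f s) x = F s x $ Some i" if "x \<in> ball a r0" for x i s
    unfolding f_def using tractor_parallel_hess(2)[OF open_ball CA(1) F that] .
  have ph: "partial_deriv i (h s) x = H s x $ Some i" if "x \<in> ball a r0" for x i s
    unfolding h_def using tractor_parallel_hess(2)[OF open_ball CA(2) H that] .
  have dif: "f s differentiable (at x)" "h s differentiable (at x)" "partial_deriv i (f s) differentiable (at x)" if "x \<in> ?B0" for s x i
    using C_k_on_SucD(1)[OF Cf that] C_k_on_SucD(1)[OF Ch that] C_k_on_SucD(1)[OF C_k_on_partial_deriv[OF Cf] that]
    by (blast intro: differentiableI)+
  let ?P = "\<lambda>x y. pairing \<alpha> (\<lambda>s. f s x) (\<lambda>s. h s y)"
  have I1: "?P x x = 1" and I2: "pairing \<alpha> (\<lambda>s. partial_deriv i (f s) x) (\<lambda>s. h s x) = 0"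
    and I3: "pairing \<alpha> (\<lambda>s. f s x) (\<lambda>s. partial_deriv j (h s) x) = 0"
    and I4: "pairing \<alpha> (\<lambda>s. partial_deriv i (f s) x) (\<lambda>s. partial_deriv j (h s) x) = k * g i j x"
    if "x \<in> ?B0" for x i j
    using pair[OF that, of None None] pair[OF that, of "Some i" None] pair[OF that, of None "Some j"]
      pair[OF that, of "Some i" "Some j"] by (simp_all add: pf[OF that] ph[OF that]) (simp_all add: f_def h_def)
  have d1: "partial_deriv i (\<lambda>x. - k * ?P x y) x = - k * pairing \<alpha> (\<lambda>s. partial_deriv i (f s) x) (\<lambda>s. h s y)"
    if "x \<in> ?B0" for i x y
  proof -
    have "(\<lambda>x. ?P x y) differentiable (at x)"
      using dif(1)[OF that] unfolding pairing_eq_sum by simp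
    then show ?thesis by (simp only: partial_deriv_scale pairing_partial_left[OF dif(1)[OF that]])
  qed
  have d2: "partial_deriv i (partial_deriv j (\<lambda>x. - k * ?P x y)) x
      = - k * pairing \<alpha> (\<lambda>s. partial_deriv i (partial_deriv j (f s)) x) (\<lambda>s. h s y)"
    if "x \<in> ?B0" for i j x y
  proof -
    have "partial_deriv i (partial_deriv j (\<lambda>x. - k * ?P x y)) x =
       partial_deriv i (\<lambda>x. - k * pairing \<alpha> (\<lambda>s. partial_deriv j (f s) x) (\<lambda>s. h s y)) x"
      by (rule partial_deriv_cong_open[OF open_ball that d1])
    moreover have "(\<lambda>x. pairing \<alpha> (\<lambda>s. partial_deriv j (f s) x) (\<lambda>s. h s y)) differentiable (at x)"
      using dif(3)[OF that] unfolding pairing_eq_sum by simp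
    ultimately show ?thesis by (simp only: partial_deriv_scale pairing_partial_left[OF dif(3)[OF that]])
  qed
  \<comment> \<open>The Hessian in coordinates differs from the covariant one by a Christoffel term
    in the differential of \<open>P\<close>, which is known to vanish on the diagonal only. So
    positivity is established at \<open>(a, a)\<close>, where the form is \<open>k^2 * g\<close>,
    and carried to nearby pairs of points by continuity in both variables.\<close>
  define Q where "Q i j z = - k * pairing \<alpha> (\<lambda>s. partial_deriv i (partial_deriv j (f s)) (fst z)) (\<lambda>s. h s (snd z))" for i j z
  have a0: "a \<in> ?B0" using r0 by simp
  have cc: "continuous_on (?B0 \<times> ?B0) (\<lambda>z. u (fst z))" "continuous_on (?B0 \<times> ?B0) (\<lambda>z. u (snd z))" if "continuous_on ?B0 u" for u :: "real^'n \<Rightarrow> real"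
    by (rule continuous_on_compose2[OF that], auto intro!: continuous_intros)+
  have cQ: "continuous_on (?B0 \<times> ?B0) (Q i j)" for i j
    unfolding Q_def pairing_eq_sum
    by (intro continuous_intros cc(1)[OF C_k_on_imp_continuous[OF C_k_on_partial_deriv[OF C_k_on_partial_deriv[OF Cf]]]]
        cc(2)[OF C_k_on_imp_continuous[OF Ch]])
  have Qa: "Q i j (a, a) = k^2 * g i j a" for i j
  proof -
    have "pairing \<alpha> (\<lambda>s. partial_deriv i (partial_deriv j (f s)) a) (\<lambda>s. h s a)
      = pairing \<alpha> (\<lambda>s. (\<Sum>l\<in>UNIV. \<Gamma> l i j a * partial_deriv l (f s) a) - k * f s a * g i j a) (\<lambda>s. h s a)"
      using hf a0 by (simp add: hess_solution_def)
    also have "\<dots> = (\<Sum>l\<in>UNIV. \<Gamma> l i j a * pairing \<alpha> (\<lambda>s. partial_deriv l (f s) a) (\<lambda>s. h s a))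
        - k * g i j a * ?P a a"
      unfolding pairing_eq_sum by (simp add: left_diff_distrib right_diff_distrib sum_subtractf sum_distrib_left sum_distrib_right)
        (subst sum.swap, simp add: ac_simps)
    also have "\<dots> = - k * g i j a" using I1[OF a0] I2[OF a0] by simp
    finally show ?thesis by (simp add: Q_def power2_eq_square)
  qed
  have "0 < (\<Sum>i\<in>UNIV. \<Sum>j\<in>UNIV. v $ i * v $ j * Q i j (a, a))" if "v \<noteq> 0" for v :: "real^'n"
  proof -
    have "(\<Sum>i\<in>UNIV. \<Sum>j\<in>UNIV. v $ i * v $ j * Q i j (a, a)) = k^2 * (\<Sum>i\<in>UNIV. \<Sum>j\<in>UNIV. v $ i * v $ j * g i j a)"
      by (simp add: Qa sum_distrib_left mult.left_commute)
    then show ?thesis using g_pos[OF a that] k by simp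
  qed
  note pos = this
  have aa: "(a, a) \<in> ?B0 \<times> ?B0" using a0 by simp
  obtain d where d: "0 < d" "\<And>z (v::real^'n). dist z (a, a) < d \<Longrightarrow> v \<noteq> 0 \<Longrightarrow> 0 < (\<Sum>i\<in>UNIV. \<Sum>j\<in>UNIV. v $ i * v $ j * Q i j z)"
    by (rule positive_quadratic_form_near[OF open_Times[OF open_ball open_ball] aa cQ pos]) (assumption, blast)
  have cP: "continuous_on (?B0 \<times> ?B0) (\<lambda>z. ?P (fst z) (snd z))"
    unfolding pairing_eq_sum
    by (intro continuous_intros cc(1)[OF C_k_on_imp_continuous[OF Cf]] cc(2)[OF C_k_on_imp_continuous[OF Ch]])
  obtain e1 where e1: "e1 > 0" "\<And>x. dist x a < e1 \<Longrightarrow> 0 < f None x"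
    using positive_near[OF open_ball a0 C_k_on_imp_continuous[OF Cf], of None] F0 by (auto simp: f_def)
  obtain e2 where e2: "e2 > 0" "\<And>x. dist x a < e2 \<Longrightarrow> 0 < h None x"
    using positive_near[OF open_ball a0 C_k_on_imp_continuous[OF Ch], of None] H0 by (auto simp: h_def)
  obtain e3 where e3: "e3 > 0" "\<And>z. dist z (a, a) < e3 \<Longrightarrow> 0 < ?P (fst z) (snd z)"
    using positive_near[OF open_Times[OF open_ball open_ball] aa cP] I1[OF a0] by auto
  \<comment> \<open>Halved, because a pair of points of the ball of radius \<open>r\<close> has
    distance less than \<open>2 * r\<close> from \<open>(a, a)\<close>.\<close>
  define r where "r = Min {r0, e1, e2, d / 2, e3 / 2}"
  have r: "0 < r" "r \<le> r0" "r \<le> e1" "r \<le> e2" "r \<le> d / 2" "r \<le> e3 / 2"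
    using r0 d e1 e2 e3 by (auto simp: r_def)
  have sub: "ball a r \<subseteq> ?B0" using r by (simp add: subset_ball)
  have close: "dist (x, y) (a, a) < 2 * r" if "x \<in> ball a r" "y \<in> ball a r" for x y
  proof -
    have "dist (x, y) (a, a) \<le> dist x a + dist y a" by (simp add: dist_prod_def sqrt_sum_squares_le_sum)
    then show ?thesis using that by (simp add: dist_commute)
  qed
  have strict: "0 < - k * (?P x y - 1)" if x: "x \<in> ball a r" and y: "y \<in> ball a r" and "x \<noteq> y" for x y
  proof -
    \<comment> \<open>The factor \<open>- k\<close> makes the Hessian close to
      \<open>k^2 * g\<close>, so that the diagonal is a minimum for either sign of
      \<open>k\<close>.\<close>
    have "- k * ?P y y < - k * ?P x y"
    proof (rule strict_minimum_of_positive_hessian[OF open_ball convex_ball _ y _ _ x \<open>x \<noteq> y\<close>])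
      show "C_k_on 2 (ball a r) (\<lambda>x. - k * ?P x y)"
        by (rule C_k_on_mult[OF open_ball C_k_on_const C_k_on_pairing[OF open_ball C_k_on_subset[OF Cf sub] C_k_on_const]])
      show "partial_deriv i (\<lambda>x. - k * ?P x y) y = 0" for i
        using d1[of y i y] I2[of y i] y sub by auto
      fix z and v :: "real^'n" assume z: "z \<in> ball a r" and "v \<noteq> 0"
      then show "0 < (\<Sum>i\<in>UNIV. \<Sum>j\<in>UNIV. v $ i * v $ j * partial_deriv i (partial_deriv j (\<lambda>x. - k * ?P x y)) z)"
        using d(2)[of "(z, y)" v] close[OF z y] r(5) subsetD[OF sub z] by (simp only: d2 Q_def fst_conv snd_conv) simp
    qed
    then show ?thesis using I1[of y] subsetD[OF sub y] by (simp add: algebra_simps)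
  qed
  show thesis
  proof (rule that[OF r(1), of f h])
    show "ball a r \<subseteq> S" using sub r0(2) by blast
    show "hess_solution \<Gamma> g k (ball a r) (f s)" "hess_solution \<Gamma>' g k (ball a r) (h s)" for s
      using hf[of s] hh[of s] sub C_k_on_subset[OF _ sub] unfolding hess_solution_def smooth_on_def by blast+
    show "0 < f None x" "0 < h None x" if "x \<in> ball a r" for x
      using e1(2)[of x] e2(2)[of x] that r by (auto simp: dist_commute)
    show "0 < ?P x y" if "x \<in> ball a r" "y \<in> ball a r" for x y
      using e3(2)[of "(x, y)"] close[OF that] r by auto
  qed (use I1 I2 I3 I4 sub strict in auto)
qed

section \<open>Charts, tangent vectors and vector fields\<close>

lemma smooth_onD: "smooth_on S f \<Longrightarrow> C_k_on m S f"
  by (simp add: smooth_on_def)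

lemma topological_chartD:
  assumes "topological_chart (U, x)"
  shows "open U" "open (x ` U)" "inj_on x U" "continuous_on U x" "continuous_on (x ` U) (inv_into U x)"
    "p \<in> U \<Longrightarrow> inv_into U x (x p) = p" "z \<in> x ` U \<Longrightarrow> x (inv_into U x z) = z" "z \<in> x ` U \<Longrightarrow> inv_into U x z \<in> U"
  using assms by (auto simp: topological_chart_def homeomorphism_def f_inv_into_f inv_into_into intro: inj_on_inverseI)

lemma chart_open_image:
  assumes c: "topological_chart (U, x)" and W: "open W" "W \<subseteq> U"
  shows "open (x ` W)"
proof -
  note c = topological_chartD[OF c]
  have "x ` W = x ` U \<inter> inv_into U x -` W" using W(2) c(6) by (auto simp: image_iff subset_iff)
  then show ?thesis using continuous_open_preimage[OF c(5) c(2) W(1)] by simp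
qed

lemma chart_change:
  assumes c: "topological_chart (U, x)" "topological_chart (V, y)"
    and t: "smooth_on (x ` (U \<inter> V)) (y \<circ> inv_into U x)" and W: "open W" "W \<subseteq> U \<inter> V"
    and f: "C_k_on m (y ` W) (f \<circ> inv_into V y)"
  shows "C_k_on m (x ` W) (f \<circ> inv_into U x)"
proof -
  have o: "open (x ` W)" "open (y ` W)" using chart_open_image[OF c(1) W(1)] chart_open_image[OF c(2) W(1)] W by auto
  have "C_k_on m (x ` W) (\<lambda>z. (f \<circ> inv_into V y) ((y \<circ> inv_into U x) z))"
  proof (rule C_k_on_compose[OF o _ f])
    show "(y \<circ> inv_into U x) z \<in> y ` W" if "z \<in> x ` W" for z
      using that W topological_chartD(6)[OF c(1)] by auto
    show "C_k_on m (x ` W) (y \<circ> inv_into U x)" using C_k_on_subset[OF smooth_onD[OF t]] W(2) by (simp add: image_mono)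
  qed
  then show ?thesis
    using W topological_chartD(6)[OF c(1)] topological_chartD(6)[OF c(2)]
    by (elim C_k_on_cong[OF o(1), rotated]) (auto dest!: subsetD)
qed

section \<open>Smooth functions tested in arbitrary charts\<close>

locale smooth_manifold =
  fixes A :: "('a::{t2_space, second_countable_topology}, 'n::finite) chart set"
  assumes atlas: "smooth_atlas A"
begin

lemma atlas_local_coords: "c \<in> A \<Longrightarrow> local_coords A c"
  using atlas by (auto simp: smooth_atlas_def local_coords_def)

lemma atlas_cover: obtains V x where "(V, x) \<in> A" "p \<in> V"
  using atlas unfolding smooth_atlas_def by (metis UNIV_I UN_iff prod.collapse)

lemma local_coords_chart: "local_coords A c \<Longrightarrow> topological_chart c"
  by (simp add: local_coords_def)

lemma local_coords_compatible:
  assumes "local_coords A (U, x)" "(W, w) \<in> A"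
  shows "smooth_on (x ` (U \<inter> W)) (w \<circ> inv_into U x)" "smooth_on (w ` (W \<inter> U)) (x \<circ> inv_into W w)"
  using assms unfolding local_coords_def smoothly_compatible_def by (auto simp: Int_commute)

text \<open>Both charts are known to be compatible with the charts of \<open>A\<close>; near each
  point the transition map is factored through one of these.\<close>

lemma transition:
  assumes U: "local_coords A (U, x)" and V: "local_coords A (V, y)"
  shows "smooth_on (x ` (U \<inter> V)) (y \<circ> inv_into U x)"
  unfolding smooth_on_def
proof (intro allI C_k_on_local)
  fix m z assume "z \<in> x ` (U \<inter> V)"
  then obtain q where q: "q \<in> U" "q \<in> V" "z = x q" by auto
  obtain W w where W: "(W, w) \<in> A" "q \<in> W" by (rule atlas_cover)
  note c = local_coords_chart[OF U] local_coords_chart[OF V] local_coords_chart[OF atlas_local_coords[OF W(1)]]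
  note o = topological_chartD(1)[OF c(1)] topological_chartD(1)[OF c(2)] topological_chartD(1)[OF c(3)]
  have "C_k_on m (w ` (U \<inter> V \<inter> W)) (y \<circ> inv_into W w)"
    by (rule C_k_on_subset[OF smooth_onD[OF local_coords_compatible(2)[OF V W(1)]]]) auto
  then have "C_k_on m (x ` (U \<inter> V \<inter> W)) (y \<circ> inv_into U x)"
    using o by (intro chart_change[OF c(1,3) local_coords_compatible(1)[OF U W(1)]]) auto
  moreover have "open (x ` (U \<inter> V \<inter> W))" using o by (intro chart_open_image[OF c(1)]) auto
  ultimately show "\<exists>T. open T \<and> z \<in> T \<and> C_k_on m T (y \<circ> inv_into U x)" using q W(2) by blast
qed

lemma smooth_fun_chart:
  assumes f: "smooth_fun A W f" and V: "local_coords A (V, x)"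
  shows "smooth_on (x ` (W \<inter> V)) (f \<circ> inv_into V x)"
  unfolding smooth_on_def
proof (intro allI C_k_on_local)
  fix m z assume "z \<in> x ` (W \<inter> V)"
  then obtain q where q: "q \<in> W" "q \<in> V" "z = x q" by auto
  obtain U u where U: "(U, u) \<in> A" "q \<in> U" by (rule atlas_cover)
  note c = local_coords_chart[OF V] local_coords_chart[OF atlas_local_coords[OF U(1)]]
  have o: "open (W \<inter> V \<inter> U)"
    using f topological_chartD(1)[OF c(1)] topological_chartD(1)[OF c(2)] by (auto simp: smooth_fun_def)
  have "smooth_on (u ` (W \<inter> U)) (f \<circ> inv_into U u)" using f U unfolding smooth_fun_def by auto
  then have "C_k_on m (u ` (W \<inter> V \<inter> U)) (f \<circ> inv_into U u)"
    by (rule C_k_on_subset[OF smooth_onD]) auto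
  then have "C_k_on m (x ` (W \<inter> V \<inter> U)) (f \<circ> inv_into V x)"
    using o by (intro chart_change[OF c local_coords_compatible(1)[OF V U(1)]]) auto
  moreover have "open (x ` (W \<inter> V \<inter> U))" using o by (intro chart_open_image[OF c(1)]) auto
  ultimately show "\<exists>T. open T \<and> z \<in> T \<and> C_k_on m T (f \<circ> inv_into V x)" using q U(2) by blast
qed

text \<open>As all transition maps are smooth, one chart around \<open>W\<close>, possibly from the
  maximal atlas only, decides for all charts of \<open>A\<close>.\<close>

lemma smooth_funI:
  assumes W: "open W" "W \<subseteq> V" and V: "local_coords A (V, x)" and f: "smooth_on (x ` W) (f \<circ> inv_into V x)"
  shows "smooth_fun A W f"
  unfolding smooth_fun_def
proof (intro conjI W(1) ballI, clarify)
  fix U u assume U: "(U, u) \<in> A"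
  note c = local_coords_chart[OF atlas_local_coords[OF U]] local_coords_chart[OF V]
  have "C_k_on m (u ` (W \<inter> U)) (f \<circ> inv_into U u)" for m
  proof (rule chart_change[OF c transition[OF atlas_local_coords[OF U] V]])
    show "open (W \<inter> U)" "W \<inter> U \<subseteq> U \<inter> V" using W topological_chartD(1)[OF c(1)] by auto
    show "C_k_on m (x ` (W \<inter> U)) (f \<circ> inv_into V x)"
      by (rule C_k_on_subset[OF smooth_onD[OF f]]) auto
  qed
  then show "smooth_on (u ` (W \<inter> U)) (f \<circ> inv_into U u)" by (simp add: smooth_on_def)
qed

lemma smooth_fun_open: "smooth_fun A W f \<Longrightarrow> open W"
  by (simp add: smooth_fun_def)

lemma chart_image_open:
  assumes "(U, u) \<in> A" "open W" shows "open (u ` (W \<inter> U))"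
  using chart_open_image[OF local_coords_chart[OF atlas_local_coords[OF assms(1)]]] assms(2)
    topological_chartD(1)[OF local_coords_chart[OF atlas_local_coords[OF assms(1)]]] by auto

lemma smooth_fun_iff: "smooth_fun A W f \<longleftrightarrow> open W \<and> (\<forall>U u m. (U, u) \<in> A \<longrightarrow> C_k_on m (u ` (W \<inter> U)) (\<lambda>z. f (inv_into U u z)))"
  unfolding smooth_fun_def smooth_on_def comp_def by fast

lemma smooth_fun_subset: "smooth_fun A W f \<Longrightarrow> open W' \<Longrightarrow> W' \<subseteq> W \<Longrightarrow> smooth_fun A W' f"
  unfolding smooth_fun_iff by (meson C_k_on_subset Int_mono image_mono order_refl)

lemma smooth_fun_cong:
  assumes "smooth_fun A W f" "\<And>q. q \<in> W \<Longrightarrow> f q = h q"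
  shows "smooth_fun A W h"
  unfolding smooth_fun_iff
proof (intro conjI allI impI)
  show o: "open W" using smooth_fun_open[OF assms(1)] .
  fix U u m assume U: "(U, u) \<in> A"
  have inv: "inv_into U u (u q) = q" if "q \<in> U" for q
    using topological_chartD(6)[OF local_coords_chart[OF atlas_local_coords[OF U]]] that by blast
  show "C_k_on m (u ` (W \<inter> U)) (\<lambda>z. h (inv_into U u z))"
  proof (rule C_k_on_cong[OF chart_image_open[OF U o]])
    show "C_k_on m (u ` (W \<inter> U)) (\<lambda>z. f (inv_into U u z))" using assms(1) U by (simp add: smooth_fun_iff)
  qed (auto simp: inv assms(2))
qed

lemma smooth_fun_const: "open W \<Longrightarrow> smooth_fun A W (\<lambda>q. c)"
  by (simp add: smooth_fun_iff)

lemma smooth_fun_add: "smooth_fun A W f \<Longrightarrow> smooth_fun A W h \<Longrightarrow> smooth_fun A W (\<lambda>q. f q + h q)"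
  using chart_image_open by (simp add: smooth_fun_iff C_k_on_add)

lemma smooth_fun_mult: "smooth_fun A W f \<Longrightarrow> smooth_fun A W h \<Longrightarrow> smooth_fun A W (\<lambda>q. f q * h q)"
  using chart_image_open by (simp add: smooth_fun_iff C_k_on_mult)

lemma smooth_fun_sum:
  "open W \<Longrightarrow> (\<And>i. i \<in> I \<Longrightarrow> smooth_fun A W (f i)) \<Longrightarrow> smooth_fun A W (\<lambda>q. \<Sum>i\<in>I. f i q)"
  by (induction I rule: infinite_finite_induct) (auto intro: smooth_fun_const smooth_fun_add)

lemma smooth_nearI: "smooth_fun A W f \<Longrightarrow> p \<in> W \<Longrightarrow> smooth_near A p f"
  by (auto simp: smooth_near_def)

lemma smooth_near_common:
  assumes "smooth_near A p f" "smooth_near A p h"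
  obtains W where "p \<in> W" "smooth_fun A W f" "smooth_fun A W h"
proof -
  obtain U U' where U: "p \<in> U" "smooth_fun A U f" "p \<in> U'" "smooth_fun A U' h" using assms by (auto simp: smooth_near_def)
  then have "open (U \<inter> U')" using smooth_fun_open by blast
  then show thesis using that[of "U \<inter> U'"] U smooth_fun_subset by auto
qed

lemma smooth_fun_coord:
  assumes "local_coords A (V, x)" shows "smooth_fun A V (\<lambda>q. x q $ i)"
proof (rule smooth_funI[OF _ order_refl assms])
  note c = topological_chartD[OF local_coords_chart[OF assms]]
  show "open V" by (rule c(1))
  have "C_k_on m (x ` V) ((\<lambda>q. x q $ i) \<circ> inv_into V x)" for m
    by (rule C_k_on_cong[OF c(2) _ C_k_on_bounded_linear[OF bounded_linear_vec_nth[of i]]]) (simp add: c(7))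
  then show "smooth_on (x ` V) ((\<lambda>q. x q $ i) \<circ> inv_into V x)" by (simp add: smooth_on_def)
qed

lemma smooth_near_differentiable:
  assumes f: "smooth_near A p f" and V: "local_coords A (V, x)" "p \<in> V"
  shows "(f \<circ> inv_into V x) differentiable (at (x p))"
proof -
  obtain W where W: "p \<in> W" "smooth_fun A W f" using f by (auto simp: smooth_near_def)
  have "x p \<in> x ` (W \<inter> V)" using W V by auto
  from C_k_on_SucD(1)[OF smooth_onD[OF smooth_fun_chart[OF W(2) V(1)]] this]
  show ?thesis by (rule differentiableI)
qed

lemma smooth_fun_derivative:
  assumes f: "smooth_fun A W f" and W: "W \<subseteq> V" and V: "local_coords A (V, x)"
  shows "smooth_fun A W (\<lambda>q. frechet_derivative (f \<circ> inv_into V x) (at (x q)) w)"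
proof (rule smooth_funI[OF smooth_fun_open[OF f] W V])
  note c = topological_chartD[OF local_coords_chart[OF V]]
  have WV: "W \<inter> V = W" using W by auto
  have "C_k_on m (x ` W) ((\<lambda>q. frechet_derivative (f \<circ> inv_into V x) (at (x q)) w) \<circ> inv_into V x)" for m
  proof (rule C_k_on_cong)
    show "open (x ` W)" using chart_open_image[OF local_coords_chart[OF V] smooth_fun_open[OF f] W] .
    show "C_k_on m (x ` W) (\<lambda>z. frechet_derivative (f \<circ> inv_into V x) (at z) w)"
      using C_k_on_SucD(2)[OF smooth_onD[OF smooth_fun_chart[OF f V]]] unfolding WV .
  qed (use W c(7) in auto)
  then show "smooth_on (x ` W) ((\<lambda>q. frechet_derivative (f \<circ> inv_into V x) (at (x q)) w) \<circ> inv_into V x)"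
    by (simp add: smooth_on_def)
qed

section \<open>Tangent vectors in coordinates\<close>

lemma chart_vec_smooth: "smooth_near A p f \<Longrightarrow> chart_vec A (V, x) w p f = frechet_derivative (f \<circ> inv_into V x) (at (x p)) w"
  by (simp add: chart_vec_def)

lemma chart_vec_not_smooth: "\<not> smooth_near A p f \<Longrightarrow> chart_vec A (V, x) w p f = 0"
  by (simp add: chart_vec_def)

lemma chart_vec_linear:
  assumes V: "local_coords A (V, x)" "p \<in> V"
  shows "chart_vec A (V, x) (a *\<^sub>R v + b *\<^sub>R w) p = (\<lambda>f. a * chart_vec A (V, x) v p f + b * chart_vec A (V, x) w p f)"
proof
  fix f
  show "chart_vec A (V, x) (a *\<^sub>R v + b *\<^sub>R w) p f = a * chart_vec A (V, x) v p f + b * chart_vec A (V, x) w p f"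
  proof (cases "smooth_near A p f")
    case True
    then show ?thesis
      using linear_frechet_derivative[OF smooth_near_differentiable[OF True V]]
      by (simp add: chart_vec_smooth linear_add linear_cmul)
  qed (simp add: chart_vec_not_smooth)
qed

text \<open>Chain rule on the functions smooth near \<open>p\<close>. On all others both sides have
  the default value 0, so the two vectors are equal as functionals.\<close>

lemma chart_vec_change:
  assumes U: "local_coords A (U, x)" "p \<in> U" and V: "local_coords A (V, y)" "p \<in> V"
  shows "chart_vec A (U, x) w p = chart_vec A (V, y) (frechet_derivative (y \<circ> inv_into U x) (at (x p)) w) p"
proof
  fix f
  note c = topological_chartD[OF local_coords_chart[OF U(1)]] and d = topological_chartD[OF local_coords_chart[OF V(1)]]
  show "chart_vec A (U, x) w p f = chart_vec A (V, y) (frechet_derivative (y \<circ> inv_into U x) (at (x p)) w) p f"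
  proof (cases "smooth_near A p f")
    case True
    have o: "open (x ` (U \<inter> V))" using c(1) d(1) by (intro chart_open_image[OF local_coords_chart[OF U(1)]]) auto
    have xp: "x p \<in> x ` (U \<inter> V)" using U V by auto
    have "(y \<circ> inv_into U x has_derivative frechet_derivative (y \<circ> inv_into U x) (at (x p))) (at (x p))"
      by (rule C_k_on_SucD(1)[OF smooth_onD[OF transition[OF U(1) V(1)]] xp])
    moreover have "(f \<circ> inv_into V y has_derivative frechet_derivative (f \<circ> inv_into V y) (at (y p))) (at ((y \<circ> inv_into U x) (x p)))"
      using has_derivative_frechet[OF smooth_near_differentiable[OF True V]] c(6)[OF U(2)] by simp
    ultimately have "((\<lambda>z. (f \<circ> inv_into V y) ((y \<circ> inv_into U x) z)) has_derivative
        (\<lambda>w. frechet_derivative (f \<circ> inv_into V y) (at (y p)) (frechet_derivative (y \<circ> inv_into U x) (at (x p)) w))) (at (x p))"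
      by (rule has_derivative_compose)
    then have "((f \<circ> inv_into U x) has_derivative
        (\<lambda>w. frechet_derivative (f \<circ> inv_into V y) (at (y p)) (frechet_derivative (y \<circ> inv_into U x) (at (x p)) w))) (at (x p))"
      by (rule has_derivative_transform_within_open[OF _ o xp]) (auto simp: c(6) d(6))
    then show ?thesis using True by (simp add: chart_vec_smooth frechet_derivative_eqI)
  qed (simp add: chart_vec_not_smooth)
qed

lemma tangent_space_eq:
  assumes V: "local_coords A (V, x)" "p \<in> V"
  shows "tangent_space A p = range (\<lambda>w. chart_vec A (V, x) w p)"
proof
  show "tangent_space A p \<subseteq> range (\<lambda>w. chart_vec A (V, x) w p)"
    unfolding tangent_space_def using chart_vec_change[OF atlas_local_coords _ V] by fastforce
  obtain U u where U: "(U, u) \<in> A" "p \<in> U" by (rule atlas_cover)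
  have "chart_vec A (V, x) w p \<in> tangent_space A p" for w
    unfolding tangent_space_def chart_vec_change[OF V atlas_local_coords[OF U(1)] U(2)] using U by fastforce
  then show "range (\<lambda>w. chart_vec A (V, x) w p) \<subseteq> tangent_space A p" by auto
qed

lemma chart_vec_coord:
  assumes V: "local_coords A (V, x)" "p \<in> V"
  shows "chart_vec A (V, x) w p (\<lambda>q. x q $ i) = w $ i"
proof -
  note c = topological_chartD[OF local_coords_chart[OF V(1)]]
  have "frechet_derivative ((\<lambda>q. x q $ i) \<circ> inv_into V x) (at (x p)) = frechet_derivative (\<lambda>z. z $ i) (at (x p))"
    by (rule frechet_derivative_cong_open[OF c(2)]) (use V c(7) in auto)
  also have "\<dots> = (\<lambda>v. v $ i)"
    by (rule frechet_derivative_eqI[OF bounded_linear_imp_has_derivative[OF bounded_linear_vec_nth]])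
  finally show ?thesis using chart_vec_smooth[OF smooth_nearI[OF smooth_fun_coord[OF V(1)] V(2)]] by simp
qed

lemma tangent_chart_vec:
  assumes V: "local_coords A (V, x)" "p \<in> V" and v: "v \<in> tangent_space A p"
  shows "v = chart_vec A (V, x) (\<chi> i. v (\<lambda>q. x q $ i)) p"
proof -
  obtain w where w: "v = chart_vec A (V, x) w p" using v tangent_space_eq[OF V] by auto
  then have "w = (\<chi> i. v (\<lambda>q. x q $ i))" using chart_vec_coord[OF V] by (simp add: vec_eq_iff)
  then show ?thesis using w by simp
qed

lemma coord_field_tangent: "local_coords A (V, x) \<Longrightarrow> p \<in> V \<Longrightarrow> coord_field A (V, x) i p \<in> tangent_space A p"
  by (simp add: coord_field_def tangent_space_eq)

lemma chart_vec_sum: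
  assumes V: "local_coords A (V, x)" "p \<in> V"
  shows "chart_vec A (V, x) w p f = (\<Sum>i\<in>UNIV. w $ i * coord_field A (V, x) i p f)"
proof -
  have "linear (\<lambda>w. chart_vec A (V, x) w p f)"
    using chart_vec_linear[OF V, of 1 _ 1] chart_vec_linear[OF V, of _ _ 0 0]
    by (intro linearI) (simp_all add: fun_eq_iff)
  from linear_eq_sum_axis[OF this, of w] show ?thesis by (simp add: coord_field_def)
qed

lemma tangent_lincomb:
  assumes "v \<in> tangent_space A p" "w \<in> tangent_space A p"
  shows "(\<lambda>f. a * v f + b * w f) \<in> tangent_space A p"
proof -
  obtain U u where U: "(U, u) \<in> A" "p \<in> U" by (rule atlas_cover)
  note T = tangent_space_eq[OF atlas_local_coords[OF U(1)] U(2)]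
  show ?thesis using assms unfolding T by (auto simp flip: chart_vec_linear[OF atlas_local_coords[OF U(1)] U(2)])
qed

text \<open>Besides the locality of the derivative, smoothness near \<open>p\<close> has to be
  transferred from one function to the other, as a tangent vector has the default value 0 on
  functions that are not smooth there.\<close>

lemma tangent_local:
  assumes v: "v \<in> tangent_space A p" and W: "open W" "p \<in> W" "\<And>q. q \<in> W \<Longrightarrow> f q = h q"
  shows "v f = v h"
proof -
  obtain U u where U: "(U, u) \<in> A" "p \<in> U" by (rule atlas_cover)
  note L = atlas_local_coords[OF U(1)]
  note c = topological_chartD[OF local_coords_chart[OF L]]
  have sn: "smooth_near A p f \<Longrightarrow> smooth_near A p h" if "\<And>q. q \<in> W \<Longrightarrow> f q = h q" for f h
  proof -
    assume "smooth_near A p f"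
    then obtain O' where O': "p \<in> O'" "smooth_fun A O' f" by (auto simp: smooth_near_def)
    have "smooth_fun A (O' \<inter> W) f" using smooth_fun_subset[OF O'(2)] smooth_fun_open[OF O'(2)] W(1) by auto
    then have "smooth_fun A (O' \<inter> W) h" by (rule smooth_fun_cong) (use that in auto)
    then show "smooth_near A p h" using O' W by (auto intro: smooth_nearI)
  qed
  have "smooth_near A p f = smooth_near A p h" using sn[of f h] sn[of h f] W(3) by auto
  moreover have "frechet_derivative (f \<circ> inv_into U u) (at (u p)) = frechet_derivative (h \<circ> inv_into U u) (at (u p))"
    using chart_image_open[OF U(1) W(1)] by (rule frechet_derivative_cong_open) (use U W c(6) in auto)
  ultimately show ?thesis using v unfolding tangent_space_eq[OF L U(2)] by (auto simp: chart_vec_def)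
qed

lemma tangent_ops:
  assumes v: "v \<in> tangent_space A p"
  shows "v (\<lambda>q. c) = 0"
    and "smooth_near A p f \<Longrightarrow> smooth_near A p h \<Longrightarrow> v (\<lambda>q. f q + h q) = v f + v h"
    and "smooth_near A p f \<Longrightarrow> smooth_near A p h \<Longrightarrow> v (\<lambda>q. f q * h q) = v f * h p + f p * v h"
proof -
  obtain U u where U: "(U, u) \<in> A" "p \<in> U" by (rule atlas_cover)
  note L = atlas_local_coords[OF U(1)]
  obtain w where w: "v = chart_vec A (U, u) w p" using v unfolding tangent_space_eq[OF L U(2)] by auto
  note inv = topological_chartD(6)[OF local_coords_chart[OF L] U(2)]
  have "smooth_near A p (\<lambda>q. c)" using smooth_nearI[OF smooth_fun_const[OF open_UNIV]] by auto
  then show "v (\<lambda>q. c) = 0" by (simp add: w chart_vec_smooth comp_def)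
  assume f: "smooth_near A p f" and h: "smooth_near A p h"
  note d = has_derivative_frechet[OF smooth_near_differentiable[OF f L U(2)]]
    has_derivative_frechet[OF smooth_near_differentiable[OF h L U(2)]]
  obtain W where W: "p \<in> W" "smooth_fun A W f" "smooth_fun A W h" by (rule smooth_near_common[OF f h])
  have s: "smooth_near A p (\<lambda>q. f q + h q)" "smooth_near A p (\<lambda>q. f q * h q)"
    using smooth_nearI[OF smooth_fun_add[OF W(2,3)] W(1)] smooth_nearI[OF smooth_fun_mult[OF W(2,3)] W(1)] .
  show "v (\<lambda>q. f q + h q) = v f + v h"
    unfolding w chart_vec_smooth[OF s(1)] chart_vec_smooth[OF f] chart_vec_smooth[OF h]
    using frechet_derivative_eqI[OF has_derivative_add[OF d]] by (simp add: comp_def)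
  show "v (\<lambda>q. f q * h q) = v f * h p + f p * v h"
    unfolding w chart_vec_smooth[OF s(2)] chart_vec_smooth[OF f] chart_vec_smooth[OF h]
    using frechet_derivative_eqI[OF has_derivative_mult[OF d]] inv by (simp add: comp_def add.commute)
qed

lemma tangent_sum:
  assumes v: "v \<in> tangent_space A p" and W: "p \<in> W" "open W" and f: "\<And>i. i \<in> I \<Longrightarrow> smooth_fun A W (f i)"
  shows "v (\<lambda>q. \<Sum>i\<in>I. f i q) = (\<Sum>i\<in>I. v (f i))"
  using f
proof (induction I rule: infinite_finite_induct)
  case (insert i I)
  have "smooth_near A p (\<lambda>q. \<Sum>i\<in>I. f i q)" using insert W by (intro smooth_nearI[OF smooth_fun_sum W(1)]) auto
  moreover have "smooth_near A p (f i)" using insert W by (intro smooth_nearI[OF _ W(1)]) auto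
  ultimately show ?case using insert tangent_ops(2)[OF v] by simp
qed (simp_all add: tangent_ops(1)[OF v])

section \<open>Vector fields and their components\<close>

lemma vector_field_tangent: "vector_field A U X \<Longrightarrow> p \<in> U \<Longrightarrow> X p \<in> tangent_space A p"
  by (simp add: vector_field_def)

lemma vector_field_open: "vector_field A U X \<Longrightarrow> open U"
  by (simp add: vector_field_def)

lemma vector_field_smooth: "vector_field A U X \<Longrightarrow> smooth_fun A V f \<Longrightarrow> V \<subseteq> U \<Longrightarrow> smooth_fun A V (\<lambda>p. X p f)"
  by (simp add: vector_field_def)

lemma vector_field_subset: "vector_field A U X \<Longrightarrow> open V \<Longrightarrow> V \<subseteq> U \<Longrightarrow> vector_field A V X"
  unfolding vector_field_def by (meson order_trans subsetD)

lemma vector_field_lincomb: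
  assumes "vector_field A U X" "vector_field A U Y" "smooth_fun A U h" "smooth_fun A U h'"
  shows "vector_field A U (\<lambda>q f. h q * X q f + h' q * Y q f)"
  unfolding vector_field_def
proof (intro conjI allI impI ballI)
  show "open U" using vector_field_open[OF assms(1)] .
  show "(\<lambda>f. h p * X p f + h' p * Y p f) \<in> tangent_space A p" if "p \<in> U" for p
    using that assms by (intro tangent_lincomb) (auto dest: vector_field_tangent)
  fix V f assume "V \<subseteq> U \<and> smooth_fun A V f"
  then show "smooth_fun A V (\<lambda>p. h p * X p f + h' p * Y p f)"
    using assms by (intro smooth_fun_add smooth_fun_mult) (auto intro: vector_field_smooth smooth_fun_subset dest: smooth_fun_open)
qed

lemma vector_field_scale:
  assumes "vector_field A U X" "smooth_fun A U h"
  shows "vector_field A U (\<lambda>q f. h q * X q f)"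
  using vector_field_lincomb[OF assms(1,1) assms(2) smooth_fun_const[of U 0]] vector_field_open[OF assms(1)] by simp

lemma vector_field_add:
  assumes "vector_field A U X" "vector_field A U Y"
  shows "vector_field A U (\<lambda>q f. X q f + Y q f)"
  using vector_field_lincomb[OF assms smooth_fun_const[of U 1] smooth_fun_const[of U 1]] vector_field_open[OF assms(1)] by simp

lemma coord_field_vector_field:
  assumes V: "local_coords A (V, x)"
  shows "vector_field A V (coord_field A (V, x) i)"
  unfolding vector_field_def
proof (intro conjI allI impI ballI)
  show "open V" using topological_chartD(1)[OF local_coords_chart[OF V]] .
  show "coord_field A (V, x) i p \<in> tangent_space A p" if "p \<in> V" for p by (rule coord_field_tangent[OF V that])
  fix W f assume W: "W \<subseteq> V \<and> smooth_fun A W f"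
  then have "smooth_fun A W (\<lambda>q. frechet_derivative (f \<circ> inv_into V x) (at (x q)) (axis i 1))"
    using V by (intro smooth_fun_derivative) auto
  then show "smooth_fun A W (\<lambda>p. coord_field A (V, x) i p f)"
  proof (rule smooth_fun_cong)
    fix q assume "q \<in> W"
    then have "smooth_near A q f" using W smooth_nearI by blast
    then show "frechet_derivative (f \<circ> inv_into V x) (at (x q)) (axis i 1) = coord_field A (V, x) i q f"
      by (simp add: coord_field_def chart_vec_smooth)
  qed
qed

lemma coord_field_partial:
  assumes "smooth_near A p f"
  shows "coord_field A (V, x) i p f = partial_deriv i (f \<circ> inv_into V x) (x p)"
  using assms by (simp add: coord_field_def chart_vec_smooth partial_deriv_def)

lemma vector_field_component:
  assumes X: "vector_field A U X" and V: "local_coords A (V, x)"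
  shows "smooth_fun A (U \<inter> V) (\<lambda>q. X q (\<lambda>q. x q $ i))"
    and "p \<in> U \<Longrightarrow> p \<in> V \<Longrightarrow> X p f = (\<Sum>i\<in>UNIV. X p (\<lambda>q. x q $ i) * coord_field A (V, x) i p f)"
proof -
  have "smooth_fun A (U \<inter> V) (\<lambda>q. x q $ i)"
    using vector_field_open[OF X] topological_chartD(1)[OF local_coords_chart[OF V]]
    by (intro smooth_fun_subset[OF smooth_fun_coord[OF V]]) auto
  then show "smooth_fun A (U \<inter> V) (\<lambda>q. X q (\<lambda>q. x q $ i))" by (rule vector_field_smooth[OF X]) auto
  assume p: "p \<in> U" "p \<in> V"
  show "X p f = (\<Sum>i\<in>UNIV. X p (\<lambda>q. x q $ i) * coord_field A (V, x) i p f)"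
    using fun_cong[OF tangent_chart_vec[OF V p(2) vector_field_tangent[OF X p(1)]], of f]
    unfolding chart_vec_sum[OF V p(2)] by simp
qed

end

section \<open>Connections in coordinates\<close>

lemma partial_deriv_commute:
  assumes "open S" "C_k_on 2 S f" "x \<in> S"
  shows "partial_deriv i (partial_deriv j f) x = partial_deriv j (partial_deriv i f) x"
  unfolding partial_deriv_def[abs_def] by (rule second_derivative_symmetric[OF assms])

context smooth_manifold
begin

lemma coord_field_second:
  assumes V: "local_coords A (V, x)" "p \<in> V" and f: "smooth_near A p f"
  shows "coord_field A (V, x) i p (\<lambda>q. coord_field A (V, x) j q f)
       = partial_deriv i (partial_deriv j (f \<circ> inv_into V x)) (x p)"
proof -
  note c = topological_chartD[OF local_coords_chart[OF V(1)]]
  obtain W where W: "p \<in> W" "smooth_fun A W f" using f by (auto simp: smooth_near_def)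
  have W': "p \<in> W \<inter> V" "smooth_fun A (W \<inter> V) f"
    using W V smooth_fun_subset[OF W(2)] smooth_fun_open[OF W(2)] c(1) by auto
  have "smooth_fun A (W \<inter> V) (\<lambda>q. coord_field A (V, x) j q f)"
    by (rule vector_field_smooth[OF coord_field_vector_field[OF V(1)] W'(2)]) auto
  then have "coord_field A (V, x) i p (\<lambda>q. coord_field A (V, x) j q f)
      = partial_deriv i ((\<lambda>q. coord_field A (V, x) j q f) \<circ> inv_into V x) (x p)"
    by (intro coord_field_partial smooth_nearI[OF _ W'(1)])
  also have "\<dots> = partial_deriv i (partial_deriv j (f \<circ> inv_into V x)) (x p)"
  proof (rule partial_deriv_cong_open)
    show "open (x ` (W \<inter> V))" using chart_open_image[OF local_coords_chart[OF V(1)] smooth_fun_open[OF W'(2)]] by simp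
    show "x p \<in> x ` (W \<inter> V)" using W'(1) by simp
    fix z assume "z \<in> x ` (W \<inter> V)"
    then obtain q where q: "q \<in> W" "q \<in> V" "z = x q" by auto
    then show "((\<lambda>q. coord_field A (V, x) j q f) \<circ> inv_into V x) z = partial_deriv j (f \<circ> inv_into V x) z"
      using coord_field_partial[OF smooth_nearI[OF W(2) q(1)]] c(6) by simp
  qed
  finally show ?thesis .
qed

text \<open>Symmetry of second derivatives; on functions not smooth near \<open>p\<close> the
  bracket is 0 by definition.\<close>

lemma coord_fields_commute:
  assumes V: "local_coords A (V, x)" "p \<in> V"
  shows "lie_bracket A (coord_field A (V, x) i) (coord_field A (V, x) j) p = (\<lambda>f. 0)"
proof
  fix f
  show "lie_bracket A (coord_field A (V, x) i) (coord_field A (V, x) j) p f = 0"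
  proof (cases "smooth_near A p f")
    case True
    then obtain W where W: "p \<in> W" "smooth_fun A W f" by (auto simp: smooth_near_def)
    note c = topological_chartD[OF local_coords_chart[OF V(1)]]
    have o: "open (x ` (W \<inter> V))"
      using smooth_fun_open[OF W(2)] c(1) by (intro chart_open_image[OF local_coords_chart[OF V(1)]]) auto
    have "x p \<in> x ` (W \<inter> V)" using W V by blast
    from partial_deriv_commute[OF o smooth_onD[OF smooth_fun_chart[OF W(2) V(1)]] this]
    have "partial_deriv i (partial_deriv j (f \<circ> inv_into V x)) (x p) = partial_deriv j (partial_deriv i (f \<circ> inv_into V x)) (x p)" .
    then show ?thesis using True by (simp add: lie_bracket_def coord_field_second[OF V True])
  qed (simp add: lie_bracket_def)
qed

lemma vector_field_sum:
  assumes "finite J" "J \<noteq> {}" "\<And>j. j \<in> J \<Longrightarrow> vector_field A U (E j)" "\<And>j. j \<in> J \<Longrightarrow> smooth_fun A U (h j)"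
  shows "vector_field A U (\<lambda>q f. \<Sum>j\<in>J. h j q * E j q f)"
  using assms by (induction J rule: finite_ne_induct) (auto intro!: vector_field_scale vector_field_add)

end

section \<open>A torsion-free connection and its curvature in a chart\<close>

locale manifold_connection = smooth_manifold A
  for A :: "('a::{t2_space, second_countable_topology}, 'n::finite) chart set" +
  fixes nab :: "'a connection"
  assumes conn: "affine_connection A nab" and torsion_free: "torsion_free A nab"
begin

lemmas conn_axioms = conn[unfolded affine_connection_def]

lemma conn_field: "vector_field A U X \<Longrightarrow> vector_field A U Y \<Longrightarrow> vector_field A U (cov nab X Y)"
  by (rule conn_axioms[THEN conjunct1, rule_format, OF conjI])

lemma conn_lincomb:
  "vector_field A U Y \<Longrightarrow> p \<in> U \<Longrightarrow> v \<in> tangent_space A p \<Longrightarrow> w \<in> tangent_space A p \<Longrightarrow>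
    nab p (\<lambda>f. a * v f + b * w f) Y = (\<lambda>f. a * nab p v Y f + b * nab p w Y f)"
  by (rule conn_axioms[THEN conjunct2, THEN conjunct1, rule_format])

lemma conn_add:
  "vector_field A U Y \<Longrightarrow> vector_field A U Z \<Longrightarrow> p \<in> U \<Longrightarrow> v \<in> tangent_space A p \<Longrightarrow>
    nab p v (\<lambda>q f. Y q f + Z q f) = (\<lambda>f. nab p v Y f + nab p v Z f)"
  by (rule conn_axioms[THEN conjunct2, THEN conjunct2, THEN conjunct1, rule_format, OF conjI])

lemma conn_leibniz:
  "smooth_fun A U h \<Longrightarrow> vector_field A U Y \<Longrightarrow> p \<in> U \<Longrightarrow> v \<in> tangent_space A p \<Longrightarrow>
    nab p v (\<lambda>q f. h q * Y q f) = (\<lambda>f. v h * Y p f + h p * nab p v Y f)"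
  by (rule conn_axioms[THEN conjunct2, THEN conjunct2, THEN conjunct2, THEN conjunct1, rule_format, OF conjI])

lemma conn_local:
  "vector_field A U Y \<Longrightarrow> vector_field A U Z \<Longrightarrow> (\<And>q. q \<in> U \<Longrightarrow> Y q = Z q) \<Longrightarrow> p \<in> U \<Longrightarrow>
    v \<in> tangent_space A p \<Longrightarrow> nab p v Y = nab p v Z"
  by (rule conn_axioms[THEN conjunct2, THEN conjunct2, THEN conjunct2, THEN conjunct2, rule_format, of U Y Z p v]) simp_all

lemma conn_sum:
  assumes "finite J" "J \<noteq> {}" "\<And>j. j \<in> J \<Longrightarrow> vector_field A U (E j)" "\<And>j. j \<in> J \<Longrightarrow> smooth_fun A U (h j)"
    and p: "p \<in> U" "v \<in> tangent_space A p"
  shows "nab p v (\<lambda>q f. \<Sum>j\<in>J. h j q * E j q f) = (\<lambda>f. \<Sum>j\<in>J. v (h j) * E j p f + h j p * nab p v (E j) f)"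
  using assms(1-4)
proof (induction J rule: finite_ne_induct)
  case (singleton j)
  then show ?case using conn_leibniz[OF _ _ p] by simp
next
  case (insert j J)
  have "vector_field A U (\<lambda>q f. h j q * E j q f)" using insert.prems by (intro vector_field_scale) auto
  moreover have "vector_field A U (\<lambda>q f. \<Sum>j\<in>J. h j q * E j q f)" using insert by (intro vector_field_sum) auto
  moreover have "nab p v (\<lambda>q f. h j q * E j q f) = (\<lambda>f. v (h j) * E j p f + h j p * nab p v (E j) f)"
    using insert.prems by (intro conn_leibniz[OF _ _ p]) auto
  ultimately show ?case using insert conn_add[OF _ _ p] by simp
qed

lemma conn_chart_vec:
  assumes V: "local_coords A (V, x)" "p \<in> V" and Y: "vector_field A U Y" "p \<in> U"
  shows "nab p (chart_vec A (V, x) w p) Y f = (\<Sum>i\<in>UNIV. w $ i * nab p (coord_field A (V, x) i p) Y f)"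
proof -
  have T: "chart_vec A (V, x) w p \<in> tangent_space A p" for w by (simp add: tangent_space_eq[OF V])
  have "nab p (chart_vec A (V, x) (a *\<^sub>R v + b *\<^sub>R w) p) Y f =
      a * nab p (chart_vec A (V, x) v p) Y f + b * nab p (chart_vec A (V, x) w p) Y f" for a v b w
    unfolding chart_vec_linear[OF V] conn_lincomb[OF Y T T] ..
  from this[of 1 _ 1] this[of _ _ 0 0]
  have "linear (\<lambda>w. nab p (chart_vec A (V, x) w p) Y f)" by (intro linearI) simp_all
  from linear_eq_sum_axis[OF this, of w] show ?thesis by (simp add: coord_field_def)
qed

lemma christoffel_smooth:
  assumes V: "local_coords A (V, x)"
  shows "smooth_fun A V (christoffel A nab (V, x) l i j)"
proof -
  note E = coord_field_vector_field[OF V]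
  have "christoffel A nab (V, x) l i j = (\<lambda>q. cov nab (coord_field A (V, x) i) (coord_field A (V, x) j) q (\<lambda>q. x q $ l))"
    by (simp add: christoffel_def fun_eq_iff)
  then show ?thesis using vector_field_component(1)[OF conn_field[OF E E] V, of i j l] by simp
qed

lemma cov_coord_fields:
  assumes V: "local_coords A (V, x)" "p \<in> V"
  shows "cov nab (coord_field A (V, x) i) (coord_field A (V, x) j) p f
      = (\<Sum>l\<in>UNIV. christoffel A nab (V, x) l i j p * coord_field A (V, x) l p f)"
  using vector_field_component(2)[OF conn_field[OF coord_field_vector_field[OF V(1), of i]
      coord_field_vector_field[OF V(1), of j]] V(1) V(2) V(2)]
  unfolding christoffel_def snd_conv .

lemma christoffel_symmetric:
  assumes V: "local_coords A (V, x)" "p \<in> V"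
  shows "christoffel A nab (V, x) l i j p = christoffel A nab (V, x) l j i p"
proof -
  let ?E = "coord_field A (V, x)"
  have "cov nab (?E i) (?E j) p f - cov nab (?E j) (?E i) p f = lie_bracket A (?E i) (?E j) p f" for f
    using torsion_free[unfolded torsion_free_def, rule_format, OF conjI, OF coord_field_vector_field[OF V(1)] coord_field_vector_field[OF V(1)] V(2)] .
  then show ?thesis by (simp add: coord_fields_commute[OF V] christoffel_def)
qed

lemma cov_cov_coord_fields:
  assumes V: "local_coords A (V, x)" "p \<in> V"
  defines "E \<equiv> coord_field A (V, x)" and "\<Gamma> \<equiv> christoffel A nab (V, x)"
  shows "cov nab (E a) (cov nab (E i) (E j)) p f
      = (\<Sum>n\<in>UNIV. (E a p (\<Gamma> n i j) + (\<Sum>l\<in>UNIV. \<Gamma> l i j p * \<Gamma> n a l p)) * E n p f)"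
proof -
  note E = coord_field_vector_field[OF V(1), folded E_def]
  note C = cov_coord_fields[OF V(1), folded E_def \<Gamma>_def] and S = christoffel_smooth[OF V(1), folded \<Gamma>_def]
  have T: "E a p \<in> tangent_space A p" using coord_field_tangent[OF V] by (simp add: E_def)
  \<comment> \<open>The expansion of the inner derivative in the coordinate fields holds on
    \<open>V\<close>; since a connection is local, it may be inserted before the Leibniz rule is
    applied.\<close>
  have "cov nab (E a) (cov nab (E i) (E j)) p = nab p (E a p) (\<lambda>q f. \<Sum>l\<in>UNIV. \<Gamma> l i j q * E l q f)"
    unfolding cov_def[of nab "E a"]
    by (rule conn_local[OF conn_field[OF E E] vector_field_sum _ V(2) T]) (auto simp: C E S fun_eq_iff)
  also have "\<dots> = (\<lambda>f. \<Sum>l\<in>UNIV. E a p (\<Gamma> l i j) * E l p f + \<Gamma> l i j p * nab p (E a p) (E l) f)"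
    by (rule conn_sum[OF _ _ _ _ V(2) T]) (auto simp: E S)
  finally have "cov nab (E a) (cov nab (E i) (E j)) p f =
      (\<Sum>l\<in>UNIV. E a p (\<Gamma> l i j) * E l p f) + (\<Sum>l\<in>UNIV. \<Gamma> l i j p * (\<Sum>n\<in>UNIV. \<Gamma> n a l p * E n p f))"
    using C[OF V(2), of a] by (simp add: cov_def sum.distrib)
  also have "(\<Sum>l\<in>UNIV. \<Gamma> l i j p * (\<Sum>n\<in>UNIV. \<Gamma> n a l p * E n p f)) = (\<Sum>n\<in>UNIV. (\<Sum>l\<in>UNIV. \<Gamma> l i j p * \<Gamma> n a l p) * E n p f)"
    unfolding sum_distrib_left sum_distrib_right by (subst sum.swap) (simp add: mult.assoc)
  finally show ?thesis by (simp add: sum.distrib distrib_right)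
qed

lemma curvature_christoffel:
  assumes V: "local_coords A (V, x)" "p \<in> V"
  defines "E \<equiv> coord_field A (V, x)" and "\<Gamma> \<equiv> christoffel A nab (V, x)"
  shows "curvature A nab (E a) (E i) (E j) p (\<lambda>q. x q $ n) =
      E a p (\<Gamma> n i j) - E i p (\<Gamma> n a j) + (\<Sum>l\<in>UNIV. \<Gamma> l i j p * \<Gamma> n a l p - \<Gamma> l a j p * \<Gamma> n i l p)"
proof -
  note E = coord_field_vector_field[OF V(1), folded E_def]
  note CC = cov_cov_coord_fields[OF V, folded E_def \<Gamma>_def]
  have T: "E a p \<in> tangent_space A p" using coord_field_tangent[OF V] by (simp add: E_def)
  \<comment> \<open>The bracket of coordinate fields is the zero vector at \<open>p\<close>; writing
    it as a combination with coefficients 0 evaluates the connection on it.\<close>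
  have "nab p (\<lambda>f. 0) (E j) = (\<lambda>f. 0)" using conn_lincomb[OF E V(2) T T, of 0 0] by simp
  then have "cov nab (lie_bracket A (E a) (E i)) (E j) p f = 0" for f
    by (simp add: cov_def E_def coord_fields_commute[OF V])
  moreover have "E m p (\<lambda>q. x q $ n) = (if m = n then 1 else 0)" for m
    unfolding E_def coord_field_def chart_vec_coord[OF V] by (simp add: axis_def)
  ultimately show ?thesis
    by (simp add: curvature_def CC if_distrib[where f = "\<lambda>c. _ * c"] sum_subtractf cong: if_cong)
qed

end

section \<open>The metric and the duality in a chart\<close>

locale dualistic_manifold = smooth_manifold A
  for A :: "('a::{t2_space, second_countable_topology}, 'n::finite) chart set" +
  fixes g :: "'a \<Rightarrow> 'a tangent \<Rightarrow> 'a tangent \<Rightarrow> real" and nab nab' :: "'a connection"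
  assumes dualistic: "dualistic_structure A g nab nab'"
begin

sublocale manifold_connection A nab
  using dualistic by unfold_locales (auto simp: dualistic_structure_def)

lemmas metric_axioms = dualistic[unfolded dualistic_structure_def, THEN conjunct1, unfolded riemannian_metric_def]

lemma metric_lincomb:
  "u \<in> tangent_space A p \<Longrightarrow> v \<in> tangent_space A p \<Longrightarrow> w \<in> tangent_space A p \<Longrightarrow>
     g p (\<lambda>f. a * u f + b * v f) w = a * g p u w + b * g p v w"
  by (rule metric_axioms[THEN conjunct1, rule_format])

lemma metric_sym: "v \<in> tangent_space A p \<Longrightarrow> w \<in> tangent_space A p \<Longrightarrow> g p v w = g p w v"
  by (rule metric_axioms[THEN conjunct2, THEN conjunct1, rule_format])

lemma metric_pos: "v \<in> tangent_space A p \<Longrightarrow> v \<noteq> (\<lambda>f. 0) \<Longrightarrow> 0 < g p v v"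
  by (rule metric_axioms[THEN conjunct2, THEN conjunct2, THEN conjunct1, rule_format])

lemma metric_smooth: "vector_field A U X \<Longrightarrow> vector_field A U Y \<Longrightarrow> smooth_fun A U (\<lambda>p. g p (X p) (Y p))"
  by (rule metric_axioms[THEN conjunct2, THEN conjunct2, THEN conjunct2, rule_format, OF conjI])

lemma duality:
  assumes "vector_field A U X" "vector_field A U Y" "vector_field A U Z" "p \<in> U"
  shows "Z p (\<lambda>q. g q (X q) (Y q)) = g p (cov nab Z X p) (Y p) + g p (X p) (cov nab' Z Y p)"
  using assms
  by (intro dualistic[unfolded dualistic_structure_def, THEN conjunct2, THEN conjunct2, THEN conjunct2, THEN conjunct2, THEN conjunct2, rule_format, of U X Y Z p]) simp_all

lemma dual_affine: "affine_connection A nab'" "torsion_free A nab'"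
  using dualistic unfolding dualistic_structure_def by simp_all

text \<open>Duality is invariant under exchange of the connections together with the arguments of
  the metric. Facts on \<open>nab\<close> thereby become facts on \<open>nab'\<close>.\<close>

lemma swap: "dualistic_manifold A g nab' nab"
proof
  have "Z p (\<lambda>q. g q (X q) (Y q)) = g p (cov nab' Z X p) (Y p) + g p (X p) (cov nab Z Y p)"
    if F: "vector_field A U X" "vector_field A U Y" "vector_field A U Z" and p: "p \<in> U" for U X Y Z p
  proof -
    have c: "vector_field A U (cov nab Z Y)" using F by (intro conn_field)
    have c': "vector_field A U (cov nab' Z X)"
      using dual_affine(1)[unfolded affine_connection_def, THEN conjunct1, rule_format, OF conjI, OF F(3,1)] .
    have "Z p (\<lambda>q. g q (X q) (Y q)) = Z p (\<lambda>q. g q (Y q) (X q))"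
      using F by (intro tangent_local[OF vector_field_tangent[OF F(3) p] vector_field_open[OF F(1)] p])
        (auto intro!: metric_sym vector_field_tangent)
    also have "\<dots> = g p (cov nab Z Y p) (X p) + g p (Y p) (cov nab' Z X p)"
      by (rule duality[OF F(2,1,3) p])
    also have "g p (cov nab Z Y p) (X p) = g p (X p) (cov nab Z Y p)"
      using c F p by (intro metric_sym) (auto intro: vector_field_tangent)
    also have "g p (Y p) (cov nab' Z X p) = g p (cov nab' Z X p) (Y p)"
      using c' F p by (intro metric_sym) (auto intro: vector_field_tangent)
    finally show ?thesis by simp
  qed
  then have "\<forall>U X Y Z. vector_field A U X \<and> vector_field A U Y \<and> vector_field A U Z \<longrightarrow>
     (\<forall>p\<in>U. Z p (\<lambda>q. g q (X q) (Y q)) = g p (cov nab' Z X p) (Y p) + g p (X p) (cov nab Z Y p))"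
    by (intro allI impI ballI) (elim conjE)
  then show "dualistic_structure A g nab' nab"
    unfolding dualistic_structure_def
    by (intro conjI dualistic[unfolded dualistic_structure_def, THEN conjunct1] dual_affine conn torsion_free)
qed

lemma metric_chart_vec_left:
  assumes V: "local_coords A (V, x)" "p \<in> V" and u: "u \<in> tangent_space A p"
  shows "g p (chart_vec A (V, x) w p) u = (\<Sum>i\<in>UNIV. w $ i * g p (coord_field A (V, x) i p) u)"
proof -
  have T: "chart_vec A (V, x) w p \<in> tangent_space A p" for w by (simp add: tangent_space_eq[OF V])
  have "g p (chart_vec A (V, x) (a *\<^sub>R v + b *\<^sub>R w) p) u =
      a * g p (chart_vec A (V, x) v p) u + b * g p (chart_vec A (V, x) w p) u" for a v b w
    unfolding chart_vec_linear[OF V] metric_lincomb[OF T T u] ..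
  from this[of 1 _ 1] this[of _ _ 0 0]
  have "linear (\<lambda>w. g p (chart_vec A (V, x) w p) u)" by (intro linearI) simp_all
  from linear_eq_sum_axis[OF this, of w] show ?thesis by (simp add: coord_field_def)
qed

lemma metric_chart_vec:
  assumes V: "local_coords A (V, x)" "p \<in> V"
  shows "g p (chart_vec A (V, x) v p) (chart_vec A (V, x) w p)
      = (\<Sum>i\<in>UNIV. \<Sum>j\<in>UNIV. v $ i * w $ j * g p (coord_field A (V, x) i p) (coord_field A (V, x) j p))"
proof -
  have T: "chart_vec A (V, x) w p \<in> tangent_space A p" for w by (simp add: tangent_space_eq[OF V])
  note E = coord_field_tangent[OF V]
  have "g p (coord_field A (V, x) i p) (chart_vec A (V, x) w p)
     = (\<Sum>j\<in>UNIV. w $ j * g p (coord_field A (V, x) i p) (coord_field A (V, x) j p))" for i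
    using metric_sym[OF E T] metric_chart_vec_left[OF V E] metric_sym[OF E E] by simp
  then show ?thesis by (simp add: metric_chart_vec_left[OF V T] sum_distrib_left mult.assoc)
qed

text \<open>The passage to the coordinate model: its equations are those on the manifold, evaluated
  on coordinate fields, whose brackets vanish.\<close>

lemma chart_dual_model:
  assumes V: "local_coords A (V, x)"
    and csc: "constant_sectional_curvature A g nab k" "constant_sectional_curvature A g nab' k"
  shows "dual_model (x ` V) (\<lambda>l i j z. christoffel A nab (V, x) l i j (inv_into V x z))
     (\<lambda>l i j z. christoffel A nab' (V, x) l i j (inv_into V x z))
     (\<lambda>i j z. g (inv_into V x z) (coord_field A (V, x) i (inv_into V x z)) (coord_field A (V, x) j (inv_into V x z))) k"
proof -
  interpret D': dualistic_manifold A g nab' nab by (rule swap)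
  note c = topological_chartD[OF local_coords_chart[OF V]]
  let ?E = "coord_field A (V, x)" and ?\<Gamma> = "christoffel A nab (V, x)" and ?\<Gamma>' = "christoffel A nab' (V, x)"
  note E = coord_field_vector_field[OF V]
  have smooth: "C_k_on m (x ` V) (\<lambda>z. f (inv_into V x z))" if "smooth_fun A V f" for m f
    using smooth_onD[OF smooth_fun_chart[OF that V]] by (simp add: comp_def)
  have pd: "partial_deriv i (\<lambda>z. f (inv_into V x z)) (x p) = ?E i p f" if "smooth_fun A V f" "p \<in> V" for i p f
    using coord_field_partial[OF smooth_nearI[OF that]] by (simp add: comp_def)
  have curv: "?E a p (christoffel A n (V, x) m i j) - ?E i p (christoffel A n (V, x) m a j)
      + (\<Sum>l\<in>UNIV. christoffel A n (V, x) l i j p * christoffel A n (V, x) m a l p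
           - christoffel A n (V, x) l a j p * christoffel A n (V, x) m i l p)
      = k * (g p (?E i p) (?E j p) * (if a = m then 1 else 0) - g p (?E a p) (?E j p) * (if i = m then 1 else 0))"
    if "manifold_connection A n" "constant_sectional_curvature A g n k" "p \<in> V" for n p a i j m
  proof -
    have "curvature A n (?E a) (?E i) (?E j) p f = k * (g p (?E i p) (?E j p) * ?E a p f - g p (?E a p) (?E j p) * ?E i p f)" for f
      using that(2)[unfolded constant_sectional_curvature_def, rule_format, of V "?E a" "?E i" "?E j" p f] that(3) E by simp
    then show ?thesis
      unfolding manifold_connection.curvature_christoffel[OF that(1) V that(3), symmetric]
      by (simp add: coord_field_def chart_vec_coord[OF V that(3)]) (simp add: axis_def)
  qed
  show ?thesis
  proof
    fix z assume "z \<in> x ` V"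
    then obtain p where p: "p \<in> V" "z = x p" by auto
    show "?\<Gamma> l i j (inv_into V x z) = ?\<Gamma> l j i (inv_into V x z)" "?\<Gamma>' l i j (inv_into V x z) = ?\<Gamma>' l j i (inv_into V x z)" for l i j
      using p c(6) christoffel_symmetric[OF V p(1), of l i j] D'.christoffel_symmetric[OF V p(1), of l i j] by simp_all
    show "g (inv_into V x z) (?E i (inv_into V x z)) (?E j (inv_into V x z)) = g (inv_into V x z) (?E j (inv_into V x z)) (?E i (inv_into V x z))" for i j
      using p c(6) by (simp add: metric_sym coord_field_tangent[OF V])
    show "0 < (\<Sum>i\<in>UNIV. \<Sum>j\<in>UNIV. v $ i * v $ j * g (inv_into V x z) (?E i (inv_into V x z)) (?E j (inv_into V x z)))" if v: "v \<noteq> 0" for v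
    proof -
      \<comment> \<open>A nonzero coordinate vector is a nonzero functional, being nonzero on one of
        the coordinate functions.\<close>
      obtain i where "v $ i \<noteq> 0" using v by (auto simp: vec_eq_iff)
      then have "chart_vec A (V, x) v p \<noteq> (\<lambda>f. 0)" using chart_vec_coord[OF V p(1), of v i] by auto
      then have "0 < g p (chart_vec A (V, x) v p) (chart_vec A (V, x) v p)"
        by (intro metric_pos) (simp_all add: tangent_space_eq[OF V p(1)])
      then show ?thesis using p c(6) by (simp add: metric_chart_vec[OF V p(1)])
    qed
    have rep: "cov n (?E q) (?E i) p = chart_vec A (V, x) (\<chi> l. christoffel A n (V, x) l q i p) p" if "manifold_connection A n" for n q i
      using manifold_connection.cov_coord_fields[OF that V p(1)] chart_vec_sum[OF V p(1)] by (simp add: fun_eq_iff)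
    have "?E q p (\<lambda>r. g r (?E i r) (?E j r)) = g p (cov nab (?E q) (?E i) p) (?E j p) + g p (?E i p) (cov nab' (?E q) (?E j) p)" for q i j
      by (rule duality[OF E E E p(1)])
    moreover have "g p (cov nab (?E q) (?E i) p) (?E j p) = (\<Sum>l\<in>UNIV. ?\<Gamma> l q i p * g p (?E l p) (?E j p))" for q i j
      unfolding rep[OF manifold_connection_axioms] by (simp add: metric_chart_vec_left[OF V p(1) coord_field_tangent[OF V p(1)]])
    moreover have "g p (?E i p) (cov nab' (?E q) (?E j) p) = (\<Sum>l\<in>UNIV. ?\<Gamma>' l q j p * g p (?E i p) (?E l p))" for q i j
    proof -
      have "g p (?E i p) (cov nab' (?E q) (?E j) p) = g p (cov nab' (?E q) (?E j) p) (?E i p)"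
        by (rule metric_sym[OF coord_field_tangent[OF V p(1)] vector_field_tangent[OF D'.conn_field[OF E E] p(1)]])
      then show ?thesis
        unfolding rep[OF D'.manifold_connection_axioms]
        by (simp add: metric_chart_vec_left[OF V p(1) coord_field_tangent[OF V p(1)]] metric_sym[OF coord_field_tangent[OF V p(1)] coord_field_tangent[OF V p(1)], of i])
    qed
    ultimately show "partial_deriv q (\<lambda>z. g (inv_into V x z) (?E i (inv_into V x z)) (?E j (inv_into V x z))) z =
        (\<Sum>l\<in>UNIV. ?\<Gamma> l q i (inv_into V x z) * g (inv_into V x z) (?E l (inv_into V x z)) (?E j (inv_into V x z))) +
        (\<Sum>l\<in>UNIV. ?\<Gamma>' l q j (inv_into V x z) * g (inv_into V x z) (?E i (inv_into V x z)) (?E l (inv_into V x z)))" for q i j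
      using pd[OF metric_smooth[OF E E] p(1)] p(2) c(6)[OF p(1)] by simp
    show "partial_deriv j (\<lambda>z. ?\<Gamma> n i q (inv_into V x z)) z - partial_deriv i (\<lambda>z. ?\<Gamma> n j q (inv_into V x z)) z +
       (\<Sum>l\<in>UNIV. ?\<Gamma> l i q (inv_into V x z) * ?\<Gamma> n j l (inv_into V x z) - ?\<Gamma> l j q (inv_into V x z) * ?\<Gamma> n i l (inv_into V x z)) =
       k * (g (inv_into V x z) (?E i (inv_into V x z)) (?E q (inv_into V x z)) * (if j = n then 1 else 0) -
            g (inv_into V x z) (?E j (inv_into V x z)) (?E q (inv_into V x z)) * (if i = n then 1 else 0))" for i j n q
      using curv[OF manifold_connection_axioms csc(1) p(1), of j n i q] pd[OF christoffel_smooth[OF V] p(1)] p(2) c(6)[OF p(1)] by simp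
    show "partial_deriv j (\<lambda>z. ?\<Gamma>' n i q (inv_into V x z)) z - partial_deriv i (\<lambda>z. ?\<Gamma>' n j q (inv_into V x z)) z +
       (\<Sum>l\<in>UNIV. ?\<Gamma>' l i q (inv_into V x z) * ?\<Gamma>' n j l (inv_into V x z) - ?\<Gamma>' l j q (inv_into V x z) * ?\<Gamma>' n i l (inv_into V x z)) =
       k * (g (inv_into V x z) (?E i (inv_into V x z)) (?E q (inv_into V x z)) * (if j = n then 1 else 0) -
            g (inv_into V x z) (?E j (inv_into V x z)) (?E q (inv_into V x z)) * (if i = n then 1 else 0))" for i j n q
      using curv[OF D'.manifold_connection_axioms csc(2) p(1), of j n i q] pd[OF D'.christoffel_smooth[OF V] p(1)] p(2) c(6)[OF p(1)] by simp
  next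
    show "open (x ` V)" by (rule c(2))
    show "C_k_on m (x ` V) (\<lambda>z. ?\<Gamma> l i j (inv_into V x z))" "C_k_on m (x ` V) (\<lambda>z. ?\<Gamma>' l i j (inv_into V x z))" for m l i j
      by (rule smooth[OF christoffel_smooth[OF V]] smooth[OF D'.christoffel_smooth[OF V]])+
    show "C_k_on m (x ` V) (\<lambda>z. g (inv_into V x z) (?E i (inv_into V x z)) (?E j (inv_into V x z)))" for m i j
      by (rule smooth[OF metric_smooth[OF E E]])
  qed
qed

text \<open>The equation \<open>Hess f = - k f g\<close> is tensorial, hence passes from the coordinate fields of one
  chart to all vector fields.\<close>

lemma hess_general:
  assumes V: "local_coords A (V, x)" and f: "smooth_fun A U f" "U \<subseteq> V"
    and hess: "\<And>q i j. q \<in> U \<Longrightarrow> coord_field A (V, x) i q (\<lambda>q. coord_field A (V, x) j q f) =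
       cov nab (coord_field A (V, x) i) (coord_field A (V, x) j) q f
         - k * f q * g q (coord_field A (V, x) i q) (coord_field A (V, x) j q)"
    and X: "vector_field A W X" and Y: "vector_field A W Y" and p: "p \<in> W" "p \<in> U"
  shows "X p (\<lambda>q. Y q f) = cov nab X Y p f - k * f p * g p (X p) (Y p)"
proof -
  let ?E = "coord_field A (V, x)"
  define O' where "O' = W \<inter> U"
  have O': "open O'" "p \<in> O'" "O' \<subseteq> W" "O' \<subseteq> U" "O' \<subseteq> V"
    using vector_field_open[OF X] smooth_fun_open[OF f(1)] p f(2) by (auto simp: O'_def)
  have pV: "p \<in> V" using O' by auto
  define Yc where "Yc j q = Y q (\<lambda>q. x q $ j)" for j q
  have Yc: "smooth_fun A O' (Yc j)" for j
    unfolding Yc_def by (rule smooth_fun_subset[OF vector_field_component(1)[OF Y V]]) (use O' in auto)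
  have EO: "vector_field A O' (?E j)" for j by (rule vector_field_subset[OF coord_field_vector_field[OF V] O'(1,5)])
  have fO: "smooth_fun A O' f" by (rule smooth_fun_subset[OF f(1) O'(1,4)])
  have Ef: "smooth_fun A O' (\<lambda>q. ?E j q f)" for j by (rule vector_field_smooth[OF EO fO order_refl])
  have Yrep: "Y q = (\<lambda>f. \<Sum>j\<in>UNIV. Yc j q * ?E j q f)" if "q \<in> O'" for q
    unfolding Yc_def by (rule ext, rule vector_field_component(2)[OF Y V]) (use that O' in auto)
  have TX: "X p \<in> tangent_space A p" by (rule vector_field_tangent[OF X p(1)])
  define w where "w = (\<chi> i. X p (\<lambda>q. x q $ i))"
  have Xw: "X p = chart_vec A (V, x) w p" unfolding w_def by (rule tangent_chart_vec[OF V pV TX])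
  have Yw: "Y p = chart_vec A (V, x) (\<chi> j. Yc j p) p"
    unfolding Yc_def by (rule tangent_chart_vec[OF V pV vector_field_tangent[OF Y p(1)]])
  have "X p (\<lambda>q. Y q f) = X p (\<lambda>q. \<Sum>j\<in>UNIV. Yc j q * ?E j q f)"
    by (rule tangent_local[OF TX O'(1,2)]) (simp add: Yrep)
  also have "\<dots> = (\<Sum>j\<in>UNIV. X p (\<lambda>q. Yc j q * ?E j q f))"
    by (rule tangent_sum[OF TX O'(2,1)]) (rule smooth_fun_mult[OF Yc Ef])
  also have "\<dots> = (\<Sum>j\<in>UNIV. X p (Yc j) * ?E j p f + Yc j p * X p (\<lambda>q. ?E j q f))"
    using tangent_ops(3)[OF TX smooth_nearI[OF Yc O'(2)] smooth_nearI[OF Ef O'(2)]] by simp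
  finally have 1: "X p (\<lambda>q. Y q f) = (\<Sum>j\<in>UNIV. X p (Yc j) * ?E j p f + Yc j p * X p (\<lambda>q. ?E j q f))" .
  have "nab p (X p) Y = nab p (X p) (\<lambda>q f. \<Sum>j\<in>UNIV. Yc j q * ?E j q f)"
    by (rule conn_local[OF vector_field_subset[OF Y O'(1,3)] vector_field_sum _ O'(2) TX]) (auto simp: EO Yc Yrep)
  also have "\<dots> = (\<lambda>f. \<Sum>j\<in>UNIV. X p (Yc j) * ?E j p f + Yc j p * nab p (X p) (?E j) f)"
    by (rule conn_sum[OF _ _ EO Yc O'(2) TX]) auto
  finally have 2: "cov nab X Y p f = (\<Sum>j\<in>UNIV. X p (Yc j) * ?E j p f + Yc j p * nab p (X p) (?E j) f)"
    by (simp add: cov_def)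
  \<comment> \<open>The derivatives of the coefficients of \<open>Y\<close> occur identically in
    both expansions and cancel; what is left is the equation for coordinate fields, contracted with
    the components of \<open>X\<close>.\<close>
  have "X p (\<lambda>q. ?E j q f) - nab p (X p) (?E j) f = (\<Sum>i\<in>UNIV. w $ i * (- k * f p * g p (?E i p) (?E j p)))" for j
    unfolding Xw chart_vec_sum[OF V pV] conn_chart_vec[OF V pV coord_field_vector_field[OF V] pV]
      sum_subtractf[symmetric] right_diff_distrib[symmetric]
    by (intro sum.cong refl) (simp add: hess[OF p(2)] cov_def)
  then have "X p (\<lambda>q. Y q f) - cov nab X Y p f = (\<Sum>j\<in>UNIV. Yc j p * (\<Sum>i\<in>UNIV. w $ i * (- k * f p * g p (?E i p) (?E j p))))"
    unfolding 1 2 by (simp flip: sum_subtractf right_diff_distrib)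
  also have "\<dots> = - k * f p * g p (X p) (Y p)"
    unfolding Xw Yw metric_chart_vec[OF V pV] sum_distrib_left by (subst sum.swap) (simp add: ac_simps)
  finally show ?thesis by simp
qed

end

section \<open>Projective coordinates from solutions of the Hessian equation\<close>

lemma pairing_scale_left: "pairing \<alpha> (\<lambda>s. c * u s) v = c * pairing \<alpha> u v"
  by (simp add: pairing_def sum_distrib_left algebra_simps)

lemma (in smooth_manifold) smooth_fun_divide:
  assumes "smooth_fun A W f" "smooth_fun A W h" "\<And>q. q \<in> W \<Longrightarrow> h q \<noteq> 0"
  shows "smooth_fun A W (\<lambda>q. f q / h q)"
  unfolding smooth_fun_iff
proof (intro conjI allI impI)
  show o: "open W" using smooth_fun_open[OF assms(1)] .
  fix U u m assume U: "(U, u) \<in> A"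
  note c = topological_chartD[OF local_coords_chart[OF atlas_local_coords[OF U]]]
  show "C_k_on m (u ` (W \<inter> U)) (\<lambda>z. f (inv_into U u z) / h (inv_into U u z))"
    using assms U c(6) by (intro C_k_on_divide chart_image_open[OF U o]) (auto simp: smooth_fun_iff)
qed

text \<open>What is used of the solutions, expressed by tangent vectors and vector fields, because
  the divergence has to be differentiated in arbitrary local coordinates. The chart
  \<open>(V, x)\<close> is kept for arguments on topology and smoothness and for the geodesic
  equation.\<close>

locale projective_frame = dualistic_manifold A g nab nab'
  for A :: "('a::{t2_space, second_countable_topology}, 'n::finite) chart set" and g nab nab' +
  fixes k \<alpha> :: real and V U :: "'a set" and x :: "'a \<Rightarrow> real^'n" and f h :: "'n option \<Rightarrow> 'a \<Rightarrow> real"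
  assumes k: "k \<noteq> 0" and chart: "(V, x) \<in> A" and U: "open U" "U \<subseteq> V"
    and smooth_f: "\<And>s. smooth_fun A U (f s)" and smooth_h: "\<And>s. smooth_fun A U (h s)"
    and hess_f: "\<And>s W X Y p. vector_field A W X \<Longrightarrow> vector_field A W Y \<Longrightarrow> p \<in> W \<Longrightarrow> p \<in> U \<Longrightarrow>
        X p (\<lambda>q. Y q (f s)) = cov nab X Y p (f s) - k * f s p * g p (X p) (Y p)"
    and hess_h: "\<And>s W X Y p. vector_field A W X \<Longrightarrow> vector_field A W Y \<Longrightarrow> p \<in> W \<Longrightarrow> p \<in> U \<Longrightarrow>
        X p (\<lambda>q. Y q (h s)) = cov nab' X Y p (h s) - k * h s p * g p (X p) (Y p)"
    and f_pos: "\<And>q. q \<in> U \<Longrightarrow> 0 < f None q" and h_pos: "\<And>q. q \<in> U \<Longrightarrow> 0 < h None q"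
    and pair_1: "\<And>q. q \<in> U \<Longrightarrow> pairing \<alpha> (\<lambda>s. f s q) (\<lambda>s. h s q) = 1"
    and pair_df: "\<And>q v. q \<in> U \<Longrightarrow> v \<in> tangent_space A q \<Longrightarrow> pairing \<alpha> (\<lambda>s. v (f s)) (\<lambda>s. h s q) = 0"
    and pair_dh: "\<And>q v. q \<in> U \<Longrightarrow> v \<in> tangent_space A q \<Longrightarrow> pairing \<alpha> (\<lambda>s. f s q) (\<lambda>s. v (h s)) = 0"
    and pair_metric: "\<And>q v w. q \<in> U \<Longrightarrow> v \<in> tangent_space A q \<Longrightarrow> w \<in> tangent_space A q \<Longrightarrow>
        pairing \<alpha> (\<lambda>s. v (f s)) (\<lambda>s. w (h s)) = k * g q v w"
    and pair_pos: "\<And>q p. q \<in> U \<Longrightarrow> p \<in> U \<Longrightarrow> 0 < pairing \<alpha> (\<lambda>s. f s q) (\<lambda>s. h s p)"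
    and pair_strict: "\<And>q p. q \<in> U \<Longrightarrow> p \<in> U \<Longrightarrow> q \<noteq> p \<Longrightarrow> 0 < - k * (pairing \<alpha> (\<lambda>s. f s q) (\<lambda>s. h s p) - 1)"
begin

text \<open>By symmetry of the pairing and of the metric, the conditions persist when the
  connections and the two families of solutions are exchanged; results on \<xi> become results on
  \<eta>.\<close>

lemma swap_frame: "projective_frame A g nab' nab k \<alpha> V U x h f"
proof (rule projective_frame.intro[OF swap], unfold_locales)
  fix q p v w
  note c = pairing_commute[of \<alpha> "\<lambda>s. h s _" "\<lambda>s. f s _"]
  show "q \<in> U \<Longrightarrow> pairing \<alpha> (\<lambda>s. h s q) (\<lambda>s. f s q) = 1" unfolding c by (rule pair_1)
  show "q \<in> U \<Longrightarrow> p \<in> U \<Longrightarrow> 0 < pairing \<alpha> (\<lambda>s. h s q) (\<lambda>s. f s p)" unfolding c by (rule pair_pos)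
  show "q \<in> U \<Longrightarrow> p \<in> U \<Longrightarrow> q \<noteq> p \<Longrightarrow> 0 < - k * (pairing \<alpha> (\<lambda>s. h s q) (\<lambda>s. f s p) - 1)"
    unfolding c by (rule pair_strict) auto
  show "q \<in> U \<Longrightarrow> v \<in> tangent_space A q \<Longrightarrow> pairing \<alpha> (\<lambda>s. v (h s)) (\<lambda>s. f s q) = 0"
    unfolding pairing_commute[of \<alpha> "\<lambda>s. v (h s)"] by (rule pair_dh)
  show "q \<in> U \<Longrightarrow> v \<in> tangent_space A q \<Longrightarrow> pairing \<alpha> (\<lambda>s. h s q) (\<lambda>s. v (f s)) = 0"
    unfolding pairing_commute[of \<alpha> "\<lambda>s. h s q"] by (rule pair_df)
  show "q \<in> U \<Longrightarrow> v \<in> tangent_space A q \<Longrightarrow> w \<in> tangent_space A q \<Longrightarrow>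
      pairing \<alpha> (\<lambda>s. v (h s)) (\<lambda>s. w (f s)) = k * g q v w"
    unfolding pairing_commute[of \<alpha> "\<lambda>s. v (h s)"] using pair_metric[of q w v] metric_sym[of v q w] by simp
qed (rule k chart U smooth_f smooth_h hess_f hess_h f_pos h_pos; assumption)+

section \<open>The ratios of solutions as a chart of the maximal atlas\<close>

definition proj :: "'a \<Rightarrow> real^'n" where
  "proj q = (\<chi> i. f (Some i) q / f None q)"

lemma chart_local: "local_coords A (V, x)"
  using atlas_local_coords[OF chart] .

lemma proj_f: "q \<in> U \<Longrightarrow> f (Some i) q = f None q * proj q $ i"
  using f_pos[of q] by (simp add: proj_def)

text \<open>Equal ratios make the values of \<open>f\<close> at \<open>q\<close> proportional to
  those at \<open>p\<close>, with a factor \<open>c > 0\<close>. The pairing is then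
  \<open>c\<close> at \<open>(q, p)\<close> and \<open>1 / c\<close> at \<open>(p, q)\<close>, but
  \<open>c - 1\<close> and \<open>1 / c - 1\<close> cannot both have the sign of
  \<open>- k\<close>.\<close>

lemma proj_inj: "inj_on proj U"
proof (rule inj_onI, rule ccontr)
  fix q p assume q: "q \<in> U" and p: "p \<in> U" and e: "proj q = proj p" and ne: "q \<noteq> p"
  define c where "c = f None q / f None p"
  have c: "0 < c" using f_pos q p by (simp add: c_def)
  have fq: "f s q = c * f s p" for s
    using f_pos[OF p] f_pos[OF q] proj_f[OF q] proj_f[OF p] e by (cases s) (simp_all add: c_def)
  have fp: "f s p = (1 / c) * f s q" for s using fq c by simp
  have "pairing \<alpha> (\<lambda>s. f s q) (\<lambda>s. h s p) = c"
    unfolding fq pairing_scale_left pair_1[OF p] by simp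
  then have 1: "0 < - k * (c - 1)" using pair_strict[OF q p ne] by simp
  have "pairing \<alpha> (\<lambda>s. f s p) (\<lambda>s. h s q) = 1 / c"
    unfolding fp pairing_scale_left pair_1[OF q] by simp
  then have "0 < - k * (1 / c - 1)" using pair_strict[OF p q] ne by simp
  then have "0 < c * (- k * (1 / c - 1))" using c by (rule mult_pos_pos[rotated])
  then have "0 < k * (c - 1)" using c by (simp add: field_simps)
  then show False using 1 by simp
qed

lemma chart_image: "open (x ` U)" "\<And>p. p \<in> U \<Longrightarrow> inv_into V x (x p) = p"
  using chart_open_image[OF local_coords_chart[OF chart_local] U] topological_chartD(6)[OF local_coords_chart[OF chart_local]] U
  by auto

lemma f_chart: "C_k_on m (x ` U) (\<lambda>z. f s (inv_into V x z))"
proof -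
  have "U \<inter> V = U" using U by auto
  then show ?thesis using smooth_onD[OF smooth_fun_chart[OF smooth_f chart_local, of s], of m] by (simp add: comp_def)
qed

lemma proj_smooth: "smooth_fun A U (\<lambda>q. proj q $ i)"
  unfolding proj_def vec_lambda_beta by (rule smooth_fun_divide[OF smooth_f smooth_f]) (use f_pos in force)

lemma proj_chart: "C_k_on m (x ` U) (\<lambda>z. proj (inv_into V x z))"
proof (rule C_k_on_vec[OF chart_image(1)])
  fix i
  have "U \<inter> V = U" using U by auto
  then show "C_k_on m (x ` U) (\<lambda>z. proj (inv_into V x z) $ i)"
    using smooth_onD[OF smooth_fun_chart[OF proj_smooth chart_local, of i], of m] by (simp add: comp_def)
qed

text \<open>If \<open>v\<close> annihilates all ratios, then \<open>v (f s) = l * f s p\<close> with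
  one \<open>l\<close> for all \<open>s\<close>. Pairing with \<open>h\<close> gives
  \<open>l = 0\<close>, so all \<open>v (f s)\<close> vanish and \<open>pair_metric\<close> yields
  \<open>g p v v = 0\<close>.\<close>

lemma proj_nondegenerate:
  assumes z: "z \<in> x ` U" and w: "frechet_derivative (\<lambda>z. proj (inv_into V x z)) (at z) w = 0"
  shows "w = 0"
proof -
  obtain p where p: "p \<in> U" "z = x p" using z by auto
  have pV: "p \<in> V" using p U by auto
  define v where "v = chart_vec A (V, x) w p"
  have v: "v \<in> tangent_space A p" by (simp add: v_def tangent_space_eq[OF chart_local pV])
  have vf: "v (f s) = frechet_derivative (\<lambda>z. f s (inv_into V x z)) (at z) w" for s
    unfolding v_def chart_vec_smooth[OF smooth_nearI[OF smooth_f p(1)]] by (simp add: comp_def p)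
  have fp: "f s (inv_into V x z) = f s p" for s using chart_image(2)[OF p(1)] p by simp
  define l where "l = v (f None) / f None p"
  have "v (f (Some i)) = l * f (Some i) p" for i
  proof -
    have "((\<lambda>z. f (Some i) (inv_into V x z) / f None (inv_into V x z)) has_derivative
       (\<lambda>w. (frechet_derivative (\<lambda>z. f (Some i) (inv_into V x z)) (at z) w * f None (inv_into V x z) -
         f (Some i) (inv_into V x z) * frechet_derivative (\<lambda>z. f None (inv_into V x z)) (at z) w)
          / (f None (inv_into V x z) * f None (inv_into V x z)))) (at z)"
      using f_pos[OF p(1)] fp by (intro has_derivative_divide' C_k_on_SucD(1)[OF f_chart z]) simp
    from frechet_derivative_eqI[OF this]
    have "frechet_derivative (\<lambda>z. proj (inv_into V x z) $ i) (at z) w =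
       (v (f (Some i)) * f None p - f (Some i) p * v (f None)) / (f None p * f None p)"
      by (simp add: proj_def vf fp)
    moreover have "frechet_derivative (\<lambda>z. proj (inv_into V x z) $ i) (at z) w = 0"
      using frechet_derivative_vec_nth[OF C_k_on_SucD(1)[OF proj_chart z], of i] w by simp
    ultimately show ?thesis using f_pos[OF p(1)] by (simp add: l_def field_simps)
  qed
  moreover have "v (f None) = l * f None p" using f_pos[OF p(1)] by (simp add: l_def)
  ultimately have vl: "v (f s) = l * f s p" for s by (cases s) auto
  have "l = 0" using pair_df[OF p(1) v] unfolding vl pairing_scale_left pair_1[OF p(1)] by simp
  then have "k * g p v v = 0" using pair_metric[OF p(1) v v] vl by (simp add: pairing_def)
  then have "v = (\<lambda>f. 0)" using metric_pos[OF v] k by force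
  then show ?thesis using chart_vec_coord[OF chart_local pV, of w] by (simp add: v_def vec_eq_iff)
qed

text \<open>The image is open by invariance of domain, the map being continuous and injective; its
  inverse is smooth because the derivative is injective at each point. Compatibility with the atlas
  is verified through \<open>(V, x)\<close>.\<close>

theorem proj_local_coords: "local_coords A (U, proj)"
proof -
  let ?B = "x ` U" and ?P = "\<lambda>z. proj (inv_into V x z)"
  note c = topological_chartD[OF local_coords_chart[OF chart_local]]
  have img: "?P ` ?B = proj ` U" using chart_image(2) by (force simp: image_image)
  have contP: "continuous_on ?B ?P" using C_k_on_imp_continuous[OF proj_chart] .
  have injP: "inj_on ?P ?B"
    using proj_inj chart_image(2) by (auto simp: inj_on_def)
  have o: "open (proj ` U)" using invariance_of_domain[OF contP chart_image(1) injP] img by simp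
  define G where "G = inv_into ?B ?P"
  have G: "G y \<in> ?B" "?P (G y) = y" if "y \<in> proj ` U" for y
    using that unfolding G_def img[symmetric] by (auto intro: inv_into_into f_inv_into_f)
  have contG: "continuous_on (proj ` U) G"
    unfolding img[symmetric]
    by (rule continuous_on_inverse_open[OF chart_image(1) contP]) (simp_all add: G_def inv_into_f_f[OF injP])
  have smoothG: "C_k_on m (proj ` U) G" for m
    by (rule C_k_on_inverse_map[OF chart_image(1) o proj_chart contG G proj_nondegenerate])
  have invG: "inv_into U proj y = inv_into V x (G y)" if y: "y \<in> proj ` U" for y
  proof -
    obtain p where p: "p \<in> U" "G y = x p" using G(1)[OF y] by auto
    then have "proj p = y" using G(2)[OF y] chart_image(2) by simp
    then show ?thesis using p chart_image(2) inv_into_f_f[OF proj_inj p(1)] by simp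
  qed
  have homeo: "homeomorphism U (proj ` U) proj (inv_into U proj)"
  proof (rule homeomorphismI)
    have "continuous_on U (\<lambda>q. ?P (x q))"
      by (rule continuous_on_compose2[OF contP continuous_on_subset[OF c(4) U(2)]]) auto
    then show "continuous_on U proj" by (rule continuous_on_eq) (simp add: chart_image(2))
    have "continuous_on (proj ` U) (\<lambda>y. inv_into V x (G y))"
      by (rule continuous_on_compose2[OF c(5) contG]) (use G(1) U(2) in blast)
    then show "continuous_on (proj ` U) (inv_into U proj)" by (rule continuous_on_eq) (simp add: invG)
  qed (auto simp: inv_into_f_f[OF proj_inj])
  have "smoothly_compatible (U, proj) (W, y)" if W: "(W, y) \<in> A" for W y
    unfolding smoothly_compatible_def split_conv
  proof
    note d = topological_chartD[OF local_coords_chart[OF atlas_local_coords[OF W]]]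
    have oW: "open (U \<inter> W)" using U(1) d(1) by auto
    have oxW: "open (x ` (U \<inter> W))" using U by (intro chart_open_image[OF local_coords_chart[OF chart_local] oW]) auto
    have "topological_chart (U, proj)" using U(1) o homeo by (simp add: topological_chart_def)
    then have opW: "open (proj ` (U \<inter> W))" by (rule chart_open_image[OF _ oW]) auto
    have "C_k_on m (proj ` (U \<inter> W)) (y \<circ> inv_into U proj)" for m
    proof (rule C_k_on_cong[OF opW])
      show "C_k_on m (proj ` (U \<inter> W)) (\<lambda>z. (y \<circ> inv_into V x) (G z))"
      proof (rule C_k_on_compose[where f = "y \<circ> inv_into V x" and g = G, OF opW oxW])
        show "C_k_on m (proj ` (U \<inter> W)) G" by (rule C_k_on_subset[OF smoothG]) auto
        show "C_k_on m (x ` (U \<inter> W)) (y \<circ> inv_into V x)"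
          by (rule C_k_on_subset[OF smooth_onD[OF local_coords_compatible(1)[OF chart_local W]]]) (use U in auto)
        fix z assume "z \<in> proj ` (U \<inter> W)"
        then obtain p where p: "p \<in> U" "p \<in> W" "z = proj p" by auto
        obtain p' where p': "p' \<in> U" "G z = x p'" using G(1)[of z] p by auto
        then have "proj p' = proj p" using G(2)[of z] p chart_image(2) by simp
        then have "p' = p" using proj_inj p p' by (simp add: inj_on_def)
        then show "G z \<in> x ` (U \<inter> W)" using p p' by auto
      qed
    qed (auto simp: invG)
    then show "smooth_on (proj ` (U \<inter> W)) (y \<circ> inv_into U proj)" by (simp add: smooth_on_def)
    have "C_k_on m (y ` (U \<inter> W)) (proj \<circ> inv_into W y)" for m
    proof (rule C_k_on_vec)
      show "open (y ` (U \<inter> W))" by (rule chart_image_open[OF W U(1)])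
      show "C_k_on m (y ` (U \<inter> W)) (\<lambda>z. (proj \<circ> inv_into W y) z $ i)" for i
        using smooth_onD[OF smooth_fun_chart[OF proj_smooth atlas_local_coords[OF W], of i], of m] by (simp add: comp_def)
    qed
    then show "smooth_on (y ` (U \<inter> W)) (proj \<circ> inv_into W y)" by (simp add: smooth_on_def)
  qed
  then show ?thesis unfolding local_coords_def topological_chart_def using U(1) o homeo by auto
qed

text \<open>Along a geodesic all \<open>f s\<close> satisfy one and the same linear equation \<open>F'' = \<rho> F\<close>; hence the
  Wronskians \<open>F' F_0 - F F_0'\<close> are constant.\<close>

lemma geodesic_second_derivative:
  assumes \<gamma>: "geodesic A nab I \<gamma>" "\<gamma> ` I \<subseteq> U"
  obtains F' \<rho> where
    "\<And>s t. t \<in> I \<Longrightarrow> ((\<lambda>t. f s (\<gamma> t)) has_real_derivative F' s t) (at t)"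
    "\<And>s t. t \<in> I \<Longrightarrow> (F' s has_real_derivative \<rho> t * f s (\<gamma> t)) (at t)"
proof -
  let ?E = "coord_field A (V, x)" and ?\<Gamma> = "christoffel A nab (V, x)"
  have "open I" using \<gamma>(1) by (simp add: geodesic_def)
  obtain \<gamma>1 \<gamma>2 where G: "\<And>t. t \<in> I \<Longrightarrow> ((x \<circ> \<gamma>) has_vector_derivative \<gamma>1 t) (at t)"
      "\<And>t. t \<in> I \<Longrightarrow> (\<gamma>1 has_vector_derivative \<gamma>2 t) (at t)"
      "\<And>t l. t \<in> I \<Longrightarrow> \<gamma>2 t $ l + (\<Sum>i\<in>UNIV. \<Sum>j\<in>UNIV. ?\<Gamma> l i j (\<gamma> t) * \<gamma>1 t $ i * \<gamma>1 t $ j) = 0"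
  proof -
    from bspec[OF \<gamma>(1)[unfolded geodesic_def, THEN conjunct2, THEN conjunct2, THEN conjunct2] chart]
    obtain \<gamma>1 \<gamma>2 where G: "\<forall>t\<in>I. \<gamma> t \<in> V \<longrightarrow> ((x \<circ> \<gamma>) has_vector_derivative \<gamma>1 t) (at t) \<and>
        (\<gamma>1 has_vector_derivative \<gamma>2 t) (at t) \<and>
        (\<forall>k. \<gamma>2 t $ k + (\<Sum>i\<in>UNIV. \<Sum>j\<in>UNIV. ?\<Gamma> k i j (\<gamma> t) * \<gamma>1 t $ i * \<gamma>1 t $ j) = 0)"
      unfolding split_conv by (elim exE)
    have V: "\<gamma> t \<in> V" if "t \<in> I" for t using \<gamma>(2) U(2) that by blast
    show thesis
    proof (rule that)
      fix t l assume t: "t \<in> I"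
      note G' = bspec[OF G t, THEN mp, OF V[OF t]]
      show "((x \<circ> \<gamma>) has_vector_derivative \<gamma>1 t) (at t)" "(\<gamma>1 has_vector_derivative \<gamma>2 t) (at t)"
        using G' by simp_all
      show "\<gamma>2 t $ l + (\<Sum>i\<in>UNIV. \<Sum>j\<in>UNIV. ?\<Gamma> l i j (\<gamma> t) * \<gamma>1 t $ i * \<gamma>1 t $ j) = 0"
        by (rule G'[THEN conjunct2, THEN conjunct2, rule_format])
    qed
  qed
  define fz where "fz s z = f s (inv_into V x z)" for s z
  have Cfz: "C_k_on m (x ` U) (fz s)" for m s unfolding fz_def by (rule f_chart)
  have mem: "(x \<circ> \<gamma>) t \<in> x ` U" if "t \<in> I" for t using \<gamma>(2) that by auto
  have chain: "((\<lambda>t. u ((x \<circ> \<gamma>) t)) has_real_derivative (\<Sum>i\<in>UNIV. \<gamma>1 t $ i * partial_deriv i u ((x \<circ> \<gamma>) t))) (at t)"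
    if t: "t \<in> I" and u: "C_k_on (Suc m) (x ` U) u" for u m t
  proof -
    have "((\<lambda>t. u ((x \<circ> \<gamma>) t)) has_derivative (\<lambda>r. \<Sum>i\<in>UNIV. (r *\<^sub>R \<gamma>1 t) $ i * partial_deriv i u ((x \<circ> \<gamma>) t))) (at t)"
      by (rule has_derivative_compose[where f = "x \<circ> \<gamma>" and g = u, OF _ has_derivative_partial[OF u mem[OF t]]])
        (use G(1)[OF t] in \<open>simp add: has_vector_derivative_def\<close>)
    also have "(\<lambda>r. \<Sum>i\<in>UNIV. (r *\<^sub>R \<gamma>1 t) $ i * partial_deriv i u ((x \<circ> \<gamma>) t)) =
        (*) (\<Sum>i\<in>UNIV. \<gamma>1 t $ i * partial_deriv i u ((x \<circ> \<gamma>) t))"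
      unfolding sum_distrib_right by (rule ext, rule sum.cong) auto
    finally show ?thesis by (simp add: has_field_derivative_def)
  qed
  define F' where "F' s t = (\<Sum>i\<in>UNIV. \<gamma>1 t $ i * partial_deriv i (fz s) ((x \<circ> \<gamma>) t))" for s t
  \<comment> \<open>Minus \<open>k\<close> times the squared speed. In the second derivative of
    \<open>f s\<close> along the curve, the Christoffel terms of the Hessian equation cancel against
    the acceleration by the geodesic equation, and only this multiple of \<open>f s\<close>
    survives.\<close>
  define \<rho> where "\<rho> t = - k * (\<Sum>i\<in>UNIV. \<Sum>j\<in>UNIV. \<gamma>1 t $ i * \<gamma>1 t $ j * g (\<gamma> t) (?E i (\<gamma> t)) (?E j (\<gamma> t)))" for t
  show thesis
  proof (rule that)
    fix s t assume t: "t \<in> I"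
    have \<gamma>U: "\<gamma> t \<in> U" "\<gamma> t \<in> V" using t \<gamma>(2) U(2) by auto
    have fzx: "fz s ((x \<circ> \<gamma>) t) = f s (\<gamma> t)" if "t \<in> I" for s t
      using that \<gamma>(2) chart_image(2) by (auto simp: fz_def)
    show "((\<lambda>t. f s (\<gamma> t)) has_real_derivative F' s t) (at t)"
      using chain[OF t Cfz, of s] unfolding F'_def
      by (rule has_field_derivative_transform_within_open[OF _ \<open>open I\<close> t]) (rule fzx)
    let ?z = "(x \<circ> \<gamma>) t" and ?v = "\<gamma>1 t"
    have p1: "partial_deriv i (fz s) ?z = ?E i (\<gamma> t) (f s)" for i
      using coord_field_partial[OF smooth_nearI[OF smooth_f \<gamma>U(1)]] by (simp add: fz_def[abs_def] comp_def)
    have p2: "partial_deriv j (partial_deriv i (fz s)) ?z = (\<Sum>l\<in>UNIV. ?\<Gamma> l j i (\<gamma> t) * partial_deriv l (fz s) ?z)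
       - k * f s (\<gamma> t) * g (\<gamma> t) (?E j (\<gamma> t)) (?E i (\<gamma> t))" for i j
      using hess_f[where s = s, OF coord_field_vector_field[OF chart_local, of j] coord_field_vector_field[OF chart_local, of i] \<gamma>U(2,1)]
        coord_field_second[OF chart_local \<gamma>U(2) smooth_nearI[OF smooth_f[of s] \<gamma>U(1)], of j i]
      unfolding cov_coord_fields[OF chart_local \<gamma>U(2)] p1 by (simp add: fz_def[abs_def] comp_def)
    have "((\<lambda>t. \<gamma>1 t $ i) has_real_derivative \<gamma>2 t $ i) (at t)" for i
      using bounded_linear.has_vector_derivative[OF bounded_linear_vec_nth G(2)[OF t]]
      by (simp add: has_real_derivative_iff_has_vector_derivative)
    then have "(F' s has_real_derivative (\<Sum>i\<in>UNIV. ?v $ i * (\<Sum>j\<in>UNIV. ?v $ j * partial_deriv j (partial_deriv i (fz s)) ?z)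
        + \<gamma>2 t $ i * partial_deriv i (fz s) ?z)) (at t)"
      unfolding F'_def[abs_def] by (intro DERIV_sum DERIV_mult' chain[OF t C_k_on_partial_deriv[OF Cfz]])
    also have "(\<Sum>i\<in>UNIV. ?v $ i * (\<Sum>j\<in>UNIV. ?v $ j * partial_deriv j (partial_deriv i (fz s)) ?z) + \<gamma>2 t $ i * partial_deriv i (fz s) ?z)
       = (\<Sum>j\<in>UNIV. \<Sum>i\<in>UNIV. ?v $ j * ?v $ i * partial_deriv j (partial_deriv i (fz s)) ?z)
         + (\<Sum>l\<in>UNIV. \<gamma>2 t $ l * partial_deriv l (fz s) ?z)"
      unfolding sum.distrib sum_distrib_left by (subst sum.swap) (simp add: ac_simps)
    also have "(\<Sum>j\<in>UNIV. \<Sum>i\<in>UNIV. ?v $ j * ?v $ i * partial_deriv j (partial_deriv i (fz s)) ?z) =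
       (\<Sum>j\<in>UNIV. \<Sum>i\<in>UNIV. \<Sum>l\<in>UNIV. ?\<Gamma> l j i (\<gamma> t) * ?v $ j * ?v $ i * partial_deriv l (fz s) ?z) + \<rho> t * f s (\<gamma> t)"
      unfolding p2 \<rho>_def sum_distrib_left sum_distrib_right sum.distrib[symmetric]
      by (intro sum.cong refl) (simp add: right_diff_distrib sum_distrib_left ac_simps)
    also have "(\<Sum>j\<in>UNIV. \<Sum>i\<in>UNIV. \<Sum>l\<in>UNIV. ?\<Gamma> l j i (\<gamma> t) * ?v $ j * ?v $ i * partial_deriv l (fz s) ?z) =
       (\<Sum>l\<in>UNIV. (\<Sum>j\<in>UNIV. \<Sum>i\<in>UNIV. ?\<Gamma> l j i (\<gamma> t) * ?v $ j * ?v $ i) * partial_deriv l (fz s) ?z)"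
    proof -
      have "(\<Sum>j\<in>UNIV. \<Sum>i\<in>UNIV. \<Sum>l\<in>UNIV. ?\<Gamma> l j i (\<gamma> t) * ?v $ j * ?v $ i * partial_deriv l (fz s) ?z) =
         (\<Sum>j\<in>UNIV. \<Sum>l\<in>UNIV. \<Sum>i\<in>UNIV. ?\<Gamma> l j i (\<gamma> t) * ?v $ j * ?v $ i * partial_deriv l (fz s) ?z)"
        by (intro sum.cong refl sum.swap)
      also have "\<dots> = (\<Sum>l\<in>UNIV. \<Sum>j\<in>UNIV. \<Sum>i\<in>UNIV. ?\<Gamma> l j i (\<gamma> t) * ?v $ j * ?v $ i * partial_deriv l (fz s) ?z)"
        by (rule sum.swap)
      finally show ?thesis by (simp add: sum_distrib_right)
    qed
    also have "\<dots> = (\<Sum>l\<in>UNIV. - \<gamma>2 t $ l * partial_deriv l (fz s) ?z)"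
      using G(3)[OF t] by (intro sum.cong refl) (metis (no_types, lifting) add_eq_0_iff vector_uminus_component)
    finally show "(F' s has_real_derivative \<rho> t * f s (\<gamma> t)) (at t)" by (simp add: sum_negf)
  qed
qed

text \<open>The derivative of each ratio is a constant Wronskian divided by the square of
  \<open>f None\<close>. So the velocity in the new coordinates has a constant direction, and the
  time change has derivative \<open>1 / (f None)^2 > 0\<close>.\<close>

theorem proj_affine_coords: "affine_coords A nab (U, proj)"
  unfolding affine_coords_def fst_conv snd_conv
proof (intro conjI proj_local_coords allI impI, elim conjE)
  fix I \<gamma> assume \<gamma>: "geodesic A nab I \<gamma>" "\<gamma> ` I \<subseteq> U"
  have I: "open I" "convex I" using \<gamma>(1) by (auto simp: geodesic_def is_interval_convex)
  show "\<exists>a v s. (\<forall>t\<in>I. proj (\<gamma> t) = a + s t *\<^sub>R v) \<and> (\<forall>t\<in>I. \<exists>s'>0. (s has_real_derivative s') (at t))"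
  proof (cases "I = {}")
    case False
    then obtain t0 where t0: "t0 \<in> I" by blast
    obtain F' \<rho> where F: "\<And>s t. t \<in> I \<Longrightarrow> ((\<lambda>t. f s (\<gamma> t)) has_real_derivative F' s t) (at t)"
      and F': "\<And>s t. t \<in> I \<Longrightarrow> (F' s has_real_derivative \<rho> t * f s (\<gamma> t)) (at t)"
      by (rule geodesic_second_derivative[OF \<gamma>]) blast
    have pos: "0 < f None (\<gamma> t)" if "t \<in> I" for t using f_pos \<gamma>(2) that by auto
    have const: "\<exists>c. \<forall>t\<in>I. u t = c" if "\<And>t. t \<in> I \<Longrightarrow> (u has_real_derivative 0) (at t)" for u
      using has_field_derivative_zero_constant[OF I(2), of u] that has_field_derivative_at_within by blast
    have "\<exists>c. \<forall>t\<in>I. F' (Some i) t * f None (\<gamma> t) - f (Some i) (\<gamma> t) * F' None t = c" for i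
    proof (rule const)
      fix t assume t: "t \<in> I"
      show "((\<lambda>t. F' (Some i) t * f None (\<gamma> t) - f (Some i) (\<gamma> t) * F' None t) has_real_derivative 0) (at t)"
        by (rule DERIV_cong[OF DERIV_diff[OF DERIV_mult'[OF F'[OF t] F[OF t]] DERIV_mult'[OF F[OF t] F'[OF t]]]]) (simp add: algebra_simps)
    qed
    then obtain W where W: "\<And>i t. t \<in> I \<Longrightarrow> F' (Some i) t * f None (\<gamma> t) - f (Some i) (\<gamma> t) * F' None t = W i" by metis
    have dp: "((\<lambda>t. proj (\<gamma> t) $ i) has_real_derivative W i / (f None (\<gamma> t))\<^sup>2) (at t)" if t: "t \<in> I" for i t
    proof -
      have "((\<lambda>t. f (Some i) (\<gamma> t) / f None (\<gamma> t)) has_real_derivative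
         (F' (Some i) t * f None (\<gamma> t) - f (Some i) (\<gamma> t) * F' None t) / (f None (\<gamma> t) * f None (\<gamma> t))) (at t)"
        using pos[OF t] by (intro DERIV_divide F[OF t]) simp
      then show ?thesis by (simp add: W[OF t] proj_def power2_eq_square)
    qed
    show ?thesis
    proof (cases "\<exists>j. W j \<noteq> 0")
      \<comment> \<open>All Wronskians vanish: the curve is constant in the coordinates, and with
        \<open>v = 0\<close> any increasing time change will do.\<close>
      case False
      have "\<exists>c. \<forall>t\<in>I. proj (\<gamma> t) $ i = c" for i using dp[of _ i] False by (intro const) simp
      then have "proj (\<gamma> t) = proj (\<gamma> t0)" if "t \<in> I" for t using that t0 by (metis vec_eq_iff)
      then show ?thesis
        by (intro exI[of _ "proj (\<gamma> t0)"] exI[of _ 0] exI[of _ "\<lambda>t. t"]) (auto intro!: exI[of _ 1])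
    next
      case True
      then obtain j where j: "W j \<noteq> 0" by blast
      \<comment> \<open>Any coordinate with nonzero Wronskian yields the time parameter; the
        division by \<open>W j\<close> removes the dependence of its derivative on
        \<open>j\<close>.\<close>
      define s where "s t = (proj (\<gamma> t) $ j - proj (\<gamma> t0) $ j) / W j" for t
      have ds: "(s has_real_derivative 1 / (f None (\<gamma> t))\<^sup>2) (at t)" if t: "t \<in> I" for t
        unfolding s_def[abs_def]
        by (rule DERIV_cong[OF DERIV_cdivide[OF DERIV_diff[OF dp[OF t] DERIV_const]]]) (use j in simp)
      have "proj (\<gamma> t) $ i = proj (\<gamma> t0) $ i + s t * W i" if t: "t \<in> I" for i t
      proof -
        have "\<exists>c. \<forall>t\<in>I. proj (\<gamma> t) $ i - s t * W i = c"
        proof (rule const)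
          fix t assume t: "t \<in> I"
          show "((\<lambda>t. proj (\<gamma> t) $ i - s t * W i) has_real_derivative 0) (at t)"
            by (rule DERIV_cong[OF DERIV_diff[OF dp[OF t] DERIV_cmult_right[OF ds[OF t]]]]) simp
        qed
        then have "proj (\<gamma> t) $ i - s t * W i = proj (\<gamma> t0) $ i - s t0 * W i" using t t0 by metis
        then show ?thesis by (simp add: s_def)
      qed
      then have "\<forall>t\<in>I. proj (\<gamma> t) = proj (\<gamma> t0) + s t *\<^sub>R (\<chi> i. W i)" by (simp add: vec_eq_iff)
      moreover have "\<forall>t\<in>I. \<exists>s'>0. (s has_real_derivative s') (at t)"
      proof
        fix t assume t: "t \<in> I"
        then show "\<exists>s'>0. (s has_real_derivative s') (at t)"
          using ds[OF t] pos[OF t] by (intro exI[of _ "1 / (f None (\<gamma> t))\<^sup>2"]) simp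
      qed
      ultimately show ?thesis by blast
    qed
  qed simp
qed

end

section \<open>The logarithmic divergence\<close>

lemma partial_deriv_mult:
  assumes "f differentiable (at x)" "h differentiable (at x)"
  shows "partial_deriv i (\<lambda>x. f x * h x) x = partial_deriv i f x * h x + f x * partial_deriv i h x"
  by (rule partial_deriv_eqI[THEN trans, OF has_derivative_mult[OF assms[THEN has_derivative_frechet]]])
    (simp add: partial_deriv_def)

lemma partial_deriv_diff:
  assumes "f differentiable (at x)" "h differentiable (at x)"
  shows "partial_deriv i (\<lambda>x. f x - h x) x = partial_deriv i f x - partial_deriv i h x"
  by (rule partial_deriv_eqI[THEN trans, OF has_derivative_diff[OF assms[THEN has_derivative_frechet]]])
    (simp add: partial_deriv_def)

lemma partial_deriv_divide:
  assumes "f differentiable (at x)" "h differentiable (at x)" "h x \<noteq> 0"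
  shows "partial_deriv i (\<lambda>x. f x / h x) x = (partial_deriv i f x * h x - f x * partial_deriv i h x) / (h x * h x)"
  by (rule partial_deriv_eqI[THEN trans, OF has_derivative_divide'[OF assms(1,2)[THEN has_derivative_frechet] assms(3)]])
    (simp add: partial_deriv_def)

lemma partial_deriv_ln:
  assumes "f differentiable (at x)" "0 < f x"
  shows "partial_deriv i (\<lambda>x. ln (f x)) x = partial_deriv i f x / f x"
  by (rule partial_deriv_eqI[THEN trans, OF has_derivative_ln[OF assms(2) has_derivative_frechet[OF assms(1)]]])
    (simp add: partial_deriv_def divide_inverse)

lemma pairing_sum_left:
  "pairing \<alpha> (\<lambda>s. \<Sum>i\<in>I. w i * u i s) v = (\<Sum>i\<in>I. w i * pairing \<alpha> (u i) v)"
  unfolding pairing_eq_sum sum_distrib_left sum_distrib_right by (subst sum.swap) (simp add: ac_simps)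

lemma pairing_sum_right:
  "pairing \<alpha> v (\<lambda>s. \<Sum>i\<in>I. w i * u i s) = (\<Sum>i\<in>I. w i * pairing \<alpha> v (u i))"
  unfolding pairing_commute[of \<alpha> v] by (rule pairing_sum_left)

text \<open>At the base point the pairing is 1 and both its first differentials vanish. Each term by
  which these mixed derivatives of a logarithm differ from those of its argument contains such a
  differential, so the logarithm drops out.\<close>

lemma partial_deriv_log_pairing:
  fixes F H :: "'n::finite option \<Rightarrow> real^'n \<Rightarrow> real" and \<delta> :: "real^'n \<Rightarrow> real^'n \<Rightarrow> real"
  assumes Z: "open Z" "z0 \<in> Z" and CF: "\<And>m s. C_k_on m Z (F s)" and CH: "\<And>m s. C_k_on m Z (H s)"
    and \<delta>: "\<And>a b. a \<in> Z \<Longrightarrow> b \<in> Z \<Longrightarrow> \<delta> a b = c * ln (pairing \<alpha> (\<lambda>s. F s a) (\<lambda>s. H s b))"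
    and pos: "\<And>a b. a \<in> Z \<Longrightarrow> b \<in> Z \<Longrightarrow> 0 < pairing \<alpha> (\<lambda>s. F s a) (\<lambda>s. H s b)"
    and I1: "pairing \<alpha> (\<lambda>s. F s z0) (\<lambda>s. H s z0) = 1"
    and I2: "\<And>i. pairing \<alpha> (\<lambda>s. partial_deriv i (F s) z0) (\<lambda>s. H s z0) = 0"
    and I3: "\<And>i. pairing \<alpha> (\<lambda>s. F s z0) (\<lambda>s. partial_deriv i (H s) z0) = 0"
  shows "partial_deriv i (\<lambda>a. partial_deriv j (\<lambda>b. \<delta> a b) z0) z0 =
      c * pairing \<alpha> (\<lambda>s. partial_deriv i (F s) z0) (\<lambda>s. partial_deriv j (H s) z0)"
    and "partial_deriv i (\<lambda>a. partial_deriv j (\<lambda>a'. partial_deriv l (\<lambda>b. \<delta> a' b) z0) a) z0 =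
      c * pairing \<alpha> (\<lambda>s. partial_deriv i (partial_deriv j (F s)) z0) (\<lambda>s. partial_deriv l (H s) z0)"
proof -
  have dF: "F s differentiable (at a)" "partial_deriv i (F s) differentiable (at a)" if "a \<in> Z" for s a i
    using C_k_on_SucD(1)[OF CF that] C_k_on_SucD(1)[OF C_k_on_partial_deriv[OF CF] that]
    by (blast intro: differentiableI)+
  have dH: "H s differentiable (at a)" if "a \<in> Z" for s a
    using C_k_on_SucD(1)[OF CH that] by (rule differentiableI)
  have dpair: "(\<lambda>a. pairing \<alpha> (\<lambda>s. u s a) v) differentiable (at a)"
    if "\<And>s. u s differentiable (at a)" for u :: "'n option \<Rightarrow> real^'n \<Rightarrow> real" and v a
    unfolding pairing_eq_sum using that by simp
  define P where "P a = pairing \<alpha> (\<lambda>s. F s a) (\<lambda>s. H s z0)" for a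
  define P1 where "P1 i a = pairing \<alpha> (\<lambda>s. partial_deriv i (F s) a) (\<lambda>s. H s z0)" for i a
  define N where "N l a = pairing \<alpha> (\<lambda>s. F s a) (\<lambda>s. partial_deriv l (H s) z0)" for l a
  define N1 where "N1 i l a = pairing \<alpha> (\<lambda>s. partial_deriv i (F s) a) (\<lambda>s. partial_deriv l (H s) z0)" for i l a
  note defs = P_def[abs_def] P1_def[abs_def] N_def[abs_def] N1_def[abs_def]
  have d: "P differentiable (at a)" "P1 i differentiable (at a)" "N l differentiable (at a)" "N1 i l differentiable (at a)"
    if "a \<in> Z" for a i l
    unfolding defs by (rule dpair dF[OF that])+
  have pd: "partial_deriv i P a = P1 i a" "partial_deriv i (N l) a = N1 i l a"
    "partial_deriv i (P1 j) a = pairing \<alpha> (\<lambda>s. partial_deriv i (partial_deriv j (F s)) a) (\<lambda>s. H s z0)"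
    "partial_deriv i (N1 j l) a = pairing \<alpha> (\<lambda>s. partial_deriv i (partial_deriv j (F s)) a) (\<lambda>s. partial_deriv l (H s) z0)"
    if "a \<in> Z" for a i j l
    unfolding defs by (rule pairing_partial_left dF[OF that])+
  have Pos: "0 < P a" if "a \<in> Z" for a unfolding P_def by (rule pos[OF that Z(2)])
  have z0: "P z0 = 1" "P1 i z0 = 0" "N l z0 = 0" for i l by (simp_all add: P_def P1_def N_def I1 I2 I3)
  \<comment> \<open>After this derivative the second argument is fixed at \<open>z0\<close>, and
    only quotients of functions of the first argument are left to differentiate.\<close>
  have s1: "partial_deriv l (\<lambda>b. \<delta> a b) z0 = c * (N l a / P a)" if a: "a \<in> Z" for a l
  proof -
    let ?Q = "\<lambda>b. pairing \<alpha> (\<lambda>s. H s b) (\<lambda>s. F s a)"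
    have Q: "?Q differentiable (at z0)" by (rule dpair dH[OF Z(2)])+
    have "partial_deriv l (\<lambda>b. \<delta> a b) z0 = partial_deriv l (\<lambda>b. c * ln (?Q b)) z0"
      by (rule partial_deriv_cong_open[OF Z]) (simp add: \<delta>[OF a] pairing_commute[of \<alpha> "\<lambda>s. F s a"])
    also have "\<dots> = c * (partial_deriv l ?Q z0 / ?Q z0)"
    proof -
      have pq: "0 < ?Q z0" using pos[OF a Z(2)] by (simp add: pairing_commute[of \<alpha> "\<lambda>s. F s a"])
      have "(\<lambda>b. ln (?Q b)) differentiable (at z0)"
        by (rule differentiableI[OF has_derivative_ln[OF pq has_derivative_frechet[OF Q]]])
      then show ?thesis by (simp add: partial_deriv_scale partial_deriv_ln[OF Q pq])
    qed
    also have "partial_deriv l ?Q z0 = N l a"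
      using pairing_partial_left[of H z0 l \<alpha> "\<lambda>s. F s a", OF dH[OF Z(2)]]
      by (simp add: N_def pairing_commute[of \<alpha> "\<lambda>s. F s a"])
    also have "?Q z0 = P a" by (simp add: P_def pairing_commute[of \<alpha> "\<lambda>s. F s a"])
    finally show ?thesis .
  qed
  have s2: "partial_deriv j (\<lambda>a'. partial_deriv l (\<lambda>b. \<delta> a' b) z0) a =
      c * ((N1 j l a * P a - N l a * P1 j a) / (P a * P a))" if a: "a \<in> Z" for a j l
  proof -
    have nz: "P a \<noteq> 0" using Pos[OF a] by simp
    have "partial_deriv j (\<lambda>a'. partial_deriv l (\<lambda>b. \<delta> a' b) z0) a = partial_deriv j (\<lambda>a. c * (N l a / P a)) a"
      by (rule partial_deriv_cong_open[OF Z(1) a s1])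
    also have "\<dots> = c * partial_deriv j (\<lambda>a. N l a / P a) a"
      by (rule partial_deriv_scale) (simp add: d[OF a] nz)
    also have "partial_deriv j (\<lambda>a. N l a / P a) a = (N1 j l a * P a - N l a * P1 j a) / (P a * P a)"
      by (simp only: partial_deriv_divide[OF d(3,1)[OF a] nz] pd[OF a])
    finally show ?thesis .
  qed
  show "partial_deriv i (\<lambda>a. partial_deriv j (\<lambda>b. \<delta> a b) z0) z0 =
      c * pairing \<alpha> (\<lambda>s. partial_deriv i (F s) z0) (\<lambda>s. partial_deriv j (H s) z0)"
    unfolding s2[OF Z(2)] z0 by (simp add: N1_def)
  let ?M = "\<lambda>a. N1 j l a * P a - N l a * P1 j a" and ?Q = "\<lambda>a. P a * P a"
  note dz = d[OF Z(2)] and pz = pd[OF Z(2)]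
  have dM1: "(\<lambda>a. N1 j l a * P a) differentiable (at z0)" "(\<lambda>a. N l a * P1 j a) differentiable (at z0)"
    by (intro differentiable_mult dz)+
  have dM: "?M differentiable (at z0)" by (intro differentiable_diff dM1)
  have dQ: "?Q differentiable (at z0)" by (intro differentiable_mult dz)
  have Q0: "?Q z0 \<noteq> 0" by (simp add: z0)
  have "partial_deriv i (\<lambda>a. partial_deriv j (\<lambda>a'. partial_deriv l (\<lambda>b. \<delta> a' b) z0) a) z0 =
     partial_deriv i (\<lambda>a. c * (?M a / ?Q a)) z0"
    by (rule partial_deriv_cong_open[OF Z s2])
  also have "\<dots> = c * partial_deriv i (\<lambda>a. ?M a / ?Q a) z0"
    by (rule partial_deriv_scale) (rule differentiable_divide[OF dM dQ Q0])
  also have "partial_deriv i (\<lambda>a. ?M a / ?Q a) z0 = partial_deriv i (N1 j l) z0"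
    unfolding partial_deriv_divide[OF dM dQ Q0] partial_deriv_diff[OF dM1]
      partial_deriv_mult[OF dz(4) dz(1)] partial_deriv_mult[OF dz(3) dz(2)] partial_deriv_mult[OF dz(1) dz(1)]
    by (simp add: z0 pz(1))
  finally show "partial_deriv i (\<lambda>a. partial_deriv j (\<lambda>a'. partial_deriv l (\<lambda>b. \<delta> a' b) z0) a) z0 =
      c * pairing \<alpha> (\<lambda>s. partial_deriv i (partial_deriv j (F s)) z0) (\<lambda>s. partial_deriv l (H s) z0)"
    by (simp only: pz)
qed

text \<open>The affine function that touches \<open>u\<close> at a convex combination bounds
  \<open>u\<close> at both end points.\<close>

lemma concave_on_supported:
  fixes u :: "'e::real_inner \<Rightarrow> real"
  assumes N: "convex N" and sup: "\<And>z. z \<in> N \<Longrightarrow> \<exists>c b. u z = c + b \<bullet> z \<and> (\<forall>y\<in>N. u y \<le> c + b \<bullet> y)"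
  shows "concave_on N u"
  unfolding concave_on_iff
proof (intro conjI N ballI allI impI)
  fix y y' and s t :: real assume y: "y \<in> N" "y' \<in> N" and st: "0 \<le> s" "0 \<le> t" "s + t = 1"
  have "s *\<^sub>R y + t *\<^sub>R y' \<in> N" using N y st by (auto simp: convex_def)
  from sup[OF this] obtain c b where cb: "u (s *\<^sub>R y + t *\<^sub>R y') = c + b \<bullet> (s *\<^sub>R y + t *\<^sub>R y')"
    "\<forall>y\<in>N. u y \<le> c + b \<bullet> y" by blast
  have "s * u y + t * u y' \<le> s * (c + b \<bullet> y) + t * (c + b \<bullet> y')"
    using cb(2) y st by (intro add_mono mult_left_mono) auto
  also have "\<dots> = (s + t) * c + b \<bullet> (s *\<^sub>R y + t *\<^sub>R y')" by (simp add: algebra_simps inner_add_right)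
  finally show "s * u y + t * u y' \<le> u (s *\<^sub>R y + t *\<^sub>R y')" using cb(1) st by simp
qed

lemma convex_on_supported:
  fixes u :: "'e::real_inner \<Rightarrow> real"
  assumes N: "convex N" and sup: "\<And>z. z \<in> N \<Longrightarrow> \<exists>c b. u z = c + b \<bullet> z \<and> (\<forall>y\<in>N. c + b \<bullet> y \<le> u y)"
  shows "convex_on N u"
proof -
  have "concave_on N (\<lambda>y. - u y)"
  proof (rule concave_on_supported[OF N])
    fix z assume "z \<in> N"
    then obtain c b where "u z = c + b \<bullet> z" "\<forall>y\<in>N. c + b \<bullet> y \<le> u y" using sup by blast
    then show "\<exists>c b. - u z = c + b \<bullet> z \<and> (\<forall>y\<in>N. - u y \<le> c + b \<bullet> y)"
      by (intro exI[of _ "- c"] exI[of _ "- b"]) auto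
  qed
  then show ?thesis by (simp add: concave_on_def)
qed

text \<open>Solutions found on a coordinate ball are lifted to the manifold. Partial derivatives
  become values of tangent vectors by linearity, and the Hessian equation for coordinate fields
  extends to all fields by \<open>hess_general\<close>.\<close>

theorem (in dualistic_manifold) projective_frame_exists:
  assumes csc: "constant_sectional_curvature A g nab k" "constant_sectional_curvature A g nab' k"
    and k: "k \<noteq> 0" and \<alpha>: "\<alpha> \<noteq> 0"
  obtains V U x f h where "p0 \<in> U" "projective_frame A g nab nab' k \<alpha> V U x f h"
proof -
  interpret D': dualistic_manifold A g nab' nab by (rule swap)
  obtain V x where V: "(V, x) \<in> A" "p0 \<in> V" by (rule atlas_cover)
  note L = atlas_local_coords[OF V(1)]
  note c = topological_chartD[OF local_coords_chart[OF L]]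
  let ?E = "coord_field A (V, x)"
  let ?\<Gamma> = "\<lambda>l i j z. christoffel A nab (V, x) l i j (inv_into V x z)"
  let ?\<Gamma>' = "\<lambda>l i j z. christoffel A nab' (V, x) l i j (inv_into V x z)"
  let ?g = "\<lambda>i j z. g (inv_into V x z) (?E i (inv_into V x z)) (?E j (inv_into V x z))"
  interpret M: dual_model "x ` V" ?\<Gamma> ?\<Gamma>' ?g k by (rule chart_dual_model[OF L csc])
  have xp0: "x p0 \<in> x ` V" using V by simp
  obtain r and fl hl :: "'n option \<Rightarrow> real^'n \<Rightarrow> real" where
    r: "0 < r" "ball (x p0) r \<subseteq> x ` V"
    and hf: "\<And>s. hess_solution ?\<Gamma> ?g k (ball (x p0) r) (fl s)"
    and hh: "\<And>s. hess_solution ?\<Gamma>' ?g k (ball (x p0) r) (hl s)"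
    and pos: "\<And>z. z \<in> ball (x p0) r \<Longrightarrow> 0 < fl None z" "\<And>z. z \<in> ball (x p0) r \<Longrightarrow> 0 < hl None z"
    and I1: "\<And>z. z \<in> ball (x p0) r \<Longrightarrow> pairing \<alpha> (\<lambda>s. fl s z) (\<lambda>s. hl s z) = 1"
    and I2: "\<And>z i. z \<in> ball (x p0) r \<Longrightarrow> pairing \<alpha> (\<lambda>s. partial_deriv i (fl s) z) (\<lambda>s. hl s z) = 0"
    and I3: "\<And>z j. z \<in> ball (x p0) r \<Longrightarrow> pairing \<alpha> (\<lambda>s. fl s z) (\<lambda>s. partial_deriv j (hl s) z) = 0"
    and I4: "\<And>z i j. z \<in> ball (x p0) r \<Longrightarrow>
        pairing \<alpha> (\<lambda>s. partial_deriv i (fl s) z) (\<lambda>s. partial_deriv j (hl s) z) = k * ?g i j z"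
    and I5: "\<And>z y. z \<in> ball (x p0) r \<Longrightarrow> y \<in> ball (x p0) r \<Longrightarrow> 0 < pairing \<alpha> (\<lambda>s. fl s z) (\<lambda>s. hl s y)"
    and I6: "\<And>z y. z \<in> ball (x p0) r \<Longrightarrow> y \<in> ball (x p0) r \<Longrightarrow> z \<noteq> y \<Longrightarrow>
        0 < - k * (pairing \<alpha> (\<lambda>s. fl s z) (\<lambda>s. hl s y) - 1)"
  proof (rule M.local_solutions[OF xp0 \<alpha> k], goal_cases)
    case (1 r f h)
    show ?case by (rule that[of r f h]) (fact 1)+
  qed
  let ?B = "ball (x p0) r"
  \<comment> \<open>Taking the whole preimage, the chart maps \<open>U\<close> onto the ball on
    which the solutions are defined.\<close>
  define U where "U = V \<inter> x -` ?B"
  have U: "open U" "U \<subseteq> V" "p0 \<in> U"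
    using continuous_open_preimage[OF c(4) c(1) open_ball] V r by (auto simp: U_def)
  have xU: "x q \<in> ?B" "inv_into V x (x q) = q" "q \<in> V" if "q \<in> U" for q using that c(6) by (auto simp: U_def)
  have imgU: "x ` U = ?B" using r(2) by (fastforce simp: U_def image_iff)
  define lift where "lift u q = u (x q)" for u :: "real^'n \<Rightarrow> real" and q
  have lift: "lift u (inv_into V x z) = u z" if "z \<in> ?B" for u z using that r(2) c(7) by (auto simp: lift_def)
  have smooth: "smooth_fun A U (lift u)" if "smooth_on ?B u" for u
  proof (rule smooth_funI[OF U(1,2) L], unfold imgU smooth_on_def, intro allI)
    show "C_k_on m ?B (lift u \<circ> inv_into V x)" for m
      by (rule C_k_on_cong[OF open_ball _ smooth_onD[OF that]]) (simp add: lift)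
  qed
  have pd: "?E i q (lift u) = partial_deriv i u (x q)"
    and pd2: "?E i q (\<lambda>q. ?E j q (lift u)) = partial_deriv i (partial_deriv j u) (x q)"
    if u: "smooth_on ?B u" and q: "q \<in> U" for u q i j
  proof -
    note sn = smooth_nearI[OF smooth[OF u] q]
    have *: "partial_deriv i (lift u \<circ> inv_into V x) z = partial_deriv i u z" if "z \<in> ?B" for i z
      by (rule partial_deriv_cong_open[OF open_ball that]) (simp add: lift)
    show "?E i q (lift u) = partial_deriv i u (x q)"
      unfolding coord_field_partial[OF sn] by (rule *[OF xU(1)[OF q]])
    show "?E i q (\<lambda>q. ?E j q (lift u)) = partial_deriv i (partial_deriv j u) (x q)"
      unfolding coord_field_second[OF L xU(3)[OF q] sn]
      by (rule partial_deriv_cong_open[OF open_ball xU(1)[OF q] *])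
  qed
  have sf: "smooth_on ?B (fl s)" and sh: "smooth_on ?B (hl s)" for s using hf hh by (auto simp: hess_solution_def)
  have vec: "v (lift u) = (\<Sum>i\<in>UNIV. v (\<lambda>q. x q $ i) * partial_deriv i u (x q))"
    if u: "smooth_on ?B u" and q: "q \<in> U" and v: "v \<in> tangent_space A q" for u q v
  proof -
    have "v (lift u) = chart_vec A (V, x) (\<chi> i. v (\<lambda>q. x q $ i)) q (lift u)"
      using tangent_chart_vec[OF L xU(3)[OF q] v] by (rule fun_cong)
    then show ?thesis by (simp add: chart_vec_sum[OF L xU(3)[OF q]] pd[OF u q])
  qed
  have "projective_frame A g nab nab' k \<alpha> V U x (\<lambda>s. lift (fl s)) (\<lambda>s. lift (hl s))"
  proof unfold_locales
    show "k \<noteq> 0" "(V, x) \<in> A" "open U" "U \<subseteq> V" by (rule k V U)+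
    show "smooth_fun A U (lift (fl s))" "smooth_fun A U (lift (hl s))" for s by (rule smooth sf sh)+
    fix q assume q: "q \<in> U"
    note xq = xU[OF q]
    show "0 < lift (fl None) q" "0 < lift (hl None) q" unfolding lift_def by (rule pos xq)+
    show "pairing \<alpha> (\<lambda>s. lift (fl s) q) (\<lambda>s. lift (hl s) q) = 1" unfolding lift_def by (rule I1[OF xq(1)])
    fix v assume v: "v \<in> tangent_space A q"
    show "pairing \<alpha> (\<lambda>s. v (lift (fl s))) (\<lambda>s. lift (hl s) q) = 0"
      unfolding vec[OF sf q v] pairing_sum_left lift_def by (simp add: I2[OF xq(1)])
    show "pairing \<alpha> (\<lambda>s. lift (fl s) q) (\<lambda>s. v (lift (hl s))) = 0"
      unfolding vec[OF sh q v] pairing_sum_right lift_def by (simp add: I3[OF xq(1)])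
    fix w assume w: "w \<in> tangent_space A q"
    show "pairing \<alpha> (\<lambda>s. v (lift (fl s))) (\<lambda>s. w (lift (hl s))) = k * g q v w"
      unfolding vec[OF sf q v] vec[OF sh q w] pairing_sum_left pairing_sum_right I4[OF xq(1)] xq(2)
      using metric_chart_vec[OF L xq(3), of "\<chi> i. v (\<lambda>q. x q $ i)" "\<chi> i. w (\<lambda>q. x q $ i)"]
      unfolding tangent_chart_vec[OF L xq(3) v, symmetric] tangent_chart_vec[OF L xq(3) w, symmetric]
      by (simp add: sum_distrib_left ac_simps)
  next
    fix q p assume q: "q \<in> U" and p: "p \<in> U"
    show "0 < pairing \<alpha> (\<lambda>s. lift (fl s) q) (\<lambda>s. lift (hl s) p)" unfolding lift_def by (rule I5[OF xU(1)[OF q] xU(1)[OF p]])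
    assume "q \<noteq> p"
    then have "x q \<noteq> x p" using xU(2)[OF q] xU(2)[OF p] by metis
    then show "0 < - k * (pairing \<alpha> (\<lambda>s. lift (fl s) q) (\<lambda>s. lift (hl s) p) - 1)"
      unfolding lift_def by (rule I6[OF xU(1)[OF q] xU(1)[OF p]])
  next
    fix s W X Y p assume X: "vector_field A W X" and Y: "vector_field A W Y" and p: "p \<in> W" "p \<in> U"
    have hess: "?E i q (\<lambda>q. ?E j q (lift u)) = cov n (?E i) (?E j) q (lift u) - k * lift u q * g q (?E i q) (?E j q)"
      if n: "manifold_connection A n" and q: "q \<in> U"
        and u: "hess_solution (\<lambda>l i j z. christoffel A n (V, x) l i j (inv_into V x z)) ?g k ?B u" for n u q i j
    proof -
      have su: "smooth_on ?B u" using u by (simp add: hess_solution_def)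
      have "partial_deriv i (partial_deriv j u) (x q) =
          (\<Sum>l\<in>UNIV. christoffel A n (V, x) l i j q * partial_deriv l u (x q)) - k * u (x q) * g q (?E i q) (?E j q)"
        using u xU[OF q] by (simp add: hess_solution_def)
      then show ?thesis
        unfolding pd2[OF su q] manifold_connection.cov_coord_fields[OF n L xU(3)[OF q]] pd[OF su q]
        by (simp add: lift_def)
    qed
    show "X p (\<lambda>q. Y q (lift (fl s))) = cov nab X Y p (lift (fl s)) - k * lift (fl s) p * g p (X p) (Y p)"
      by (rule hess_general[OF L smooth[OF sf] U(2) hess[OF manifold_connection_axioms _ hf] X Y p])
    show "X p (\<lambda>q. Y q (lift (hl s))) = cov nab' X Y p (lift (hl s)) - k * lift (hl s) p * g p (X p) (Y p)"
      by (rule D'.hess_general[OF L smooth[OF sh] U(2) hess[OF D'.manifold_connection_axioms _ hh] X Y p])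
  qed
  then show thesis using that U(3) by blast
qed

section \<open>Potentials and their exponential concavity or convexity\<close>

context projective_frame
begin

definition pot :: "real^'n \<Rightarrow> real" where
  "pot y = - ln (f None (inv_into U proj y)) / \<alpha>"

lemma pot_proj: "q \<in> U \<Longrightarrow> pot (proj q) = - ln (f None q) / \<alpha>"
  by (simp add: pot_def inv_into_f_f[OF proj_inj])

end

context projective_frame
begin

interpretation dual: projective_frame A g nab' nab k \<alpha> V U x h f by (rule swap_frame)

abbreviation "P q p \<equiv> pairing \<alpha> (\<lambda>s. f s q) (\<lambda>s. h s p)"

lemma cost_argument:
  assumes "q \<in> U" "p \<in> U"
  shows "1 + \<alpha> * (proj q \<bullet> dual.proj p) = P q p / (f None q * h None p)"
proof -
  have "P q p = f None q * h None p * (1 + \<alpha> * (proj q \<bullet> dual.proj p))"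
    unfolding pairing_def proj_f[OF assms(1)] dual.proj_f[OF assms(2)]
    by (simp add: inner_vec_def algebra_simps sum_distrib_left)
  then show ?thesis using f_pos[OF assms(1)] h_pos[OF assms(2)] by simp
qed

text \<open>The logarithm separates the quotient in \<open>cost_argument\<close> into
  \<open>P\<close> and the two potentials. On the diagonal, where \<open>P\<close> is 1, this is the
  generalized Fenchel identity.\<close>

lemma log_cost_eq:
  assumes "q \<in> U" "p \<in> U"
  shows "log_cost \<alpha> (proj q) (dual.proj p) = ln (P q p) / \<alpha> + pot (proj q) + dual.pot (dual.proj p)"
  unfolding log_cost_def cost_argument[OF assms] pot_proj[OF assms(1)] dual.pot_proj[OF assms(2)]
  using f_pos[OF assms(1)] h_pos[OF assms(2)] pair_pos[OF assms]
  by (simp add: ln_div ln_mult add_divide_distrib diff_divide_distrib)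

text \<open>Since \<open>P\<close> is at least 1 (at most 1 for \<open>k > 0\<close>) with equality on the diagonal, \<open>1 / f None\<close>
  has supporting affine functions in the coordinates \<open>proj\<close>.\<close>

lemma exp_pot_support:
  assumes \<alpha>: "\<alpha> \<noteq> 0" and z: "z \<in> proj ` U"
  obtains c b where "exp (\<alpha> * pot z) = c + b \<bullet> z"
    "\<And>y. k < 0 \<Longrightarrow> y \<in> proj ` U \<Longrightarrow> exp (\<alpha> * pot y) \<le> c + b \<bullet> y"
    "\<And>y. k > 0 \<Longrightarrow> y \<in> proj ` U \<Longrightarrow> c + b \<bullet> y \<le> exp (\<alpha> * pot y)"
proof -
  obtain p where p: "p \<in> U" "z = proj p" using z by auto
  \<comment> \<open>For fixed \<open>p\<close> the quotient \<open>P q p / f None q\<close> is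
    affine in \<open>proj q\<close>; \<open>c\<close> and \<open>b\<close> are its
    coefficients.\<close>
  define c where "c = h None p"
  define b where "b = (\<alpha> * h None p) *\<^sub>R dual.proj p"
  have e: "exp (\<alpha> * pot (proj q)) = 1 / f None q" if "q \<in> U" for q
    using \<alpha> f_pos[OF that] by (simp add: pot_proj[OF that] exp_minus inverse_eq_divide)
  have l: "c + b \<bullet> proj q = P q p / f None q" if "q \<in> U" for q
  proof -
    have "c + b \<bullet> proj q = h None p * (1 + \<alpha> * (proj q \<bullet> dual.proj p))"
      by (simp add: c_def b_def inner_commute algebra_simps)
    then show ?thesis using h_pos[OF p(1)] by (simp add: cost_argument[OF that p(1)])
  qed
  have P1: "0 \<le> - k * (P q p - 1)" if "q \<in> U" for q
    using pair_strict[OF that p(1)] pair_1[OF p(1)] by (cases "q = p") auto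
  show thesis
  proof (rule that[of c b])
    show "exp (\<alpha> * pot z) = c + b \<bullet> z" using pair_1[OF p(1)] by (simp add: p(2) e l p(1))
    fix y assume "y \<in> proj ` U"
    then obtain q where q: "q \<in> U" "y = proj q" by auto
    show "exp (\<alpha> * pot y) \<le> c + b \<bullet> y" if "k < 0"
    proof -
      have "1 \<le> P q p" using P1[OF q(1)] that by (simp add: mult_le_0_iff)
      then show ?thesis unfolding q(2) e[OF q(1)] l[OF q(1)] using f_pos[OF q(1)] by (intro divide_right_mono) auto
    qed
    show "c + b \<bullet> y \<le> exp (\<alpha> * pot y)" if "k > 0"
    proof -
      have "P q p \<le> 1" using P1[OF q(1)] that by (simp add: mult_le_0_iff)
      then show ?thesis unfolding q(2) e[OF q(1)] l[OF q(1)] using f_pos[OF q(1)] by (intro divide_right_mono) auto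
    qed
  qed
qed

lemma pot_locally_exp_concave:
  assumes \<alpha>: "\<alpha> \<noteq> 0" and "k < 0"
  shows "locally_exp_concave_on \<alpha> (proj ` U) pot"
  unfolding locally_exp_concave_on_def exp_concave_on_def
proof
  fix y assume y: "y \<in> proj ` U"
  have "open (proj ` U)" using topological_chartD(2)[OF local_coords_chart[OF proj_local_coords]] .
  then obtain r where r: "0 < r" "ball y r \<subseteq> proj ` U" using y open_contains_ball by blast
  have "concave_on (ball y r) (\<lambda>x. exp (\<alpha> * pot x))"
  proof (rule concave_on_supported[OF convex_ball])
    fix z assume "z \<in> ball y r"
    then obtain c b where "exp (\<alpha> * pot z) = c + b \<bullet> z" "\<And>y. y \<in> proj ` U \<Longrightarrow> exp (\<alpha> * pot y) \<le> c + b \<bullet> y"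
      using exp_pot_support[OF \<alpha>, of z] r(2) \<open>k < 0\<close> by (metis subsetD)
    then show "\<exists>c b. exp (\<alpha> * pot z) = c + b \<bullet> z \<and> (\<forall>y\<in>ball y r. exp (\<alpha> * pot y) \<le> c + b \<bullet> y)"
      using r(2) by blast
  qed
  then show "\<exists>N. open N \<and> y \<in> N \<and> N \<subseteq> proj ` U \<and> concave_on N (\<lambda>x. exp (\<alpha> * pot x))"
    using r by (intro exI[of _ "ball y r"]) simp
qed

lemma pot_locally_exp_convex:
  assumes \<alpha>: "\<alpha> \<noteq> 0" and "k > 0"
  shows "locally_exp_convex_on \<alpha> (proj ` U) pot"
  unfolding locally_exp_convex_on_def exp_convex_on_def
proof
  fix y assume y: "y \<in> proj ` U"
  have "open (proj ` U)" using topological_chartD(2)[OF local_coords_chart[OF proj_local_coords]] .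
  then obtain r where r: "0 < r" "ball y r \<subseteq> proj ` U" using y open_contains_ball by blast
  have "convex_on (ball y r) (\<lambda>x. exp (\<alpha> * pot x))"
  proof (rule convex_on_supported[OF convex_ball])
    fix z assume "z \<in> ball y r"
    then obtain c b where "exp (\<alpha> * pot z) = c + b \<bullet> z" "\<And>y. y \<in> proj ` U \<Longrightarrow> c + b \<bullet> y \<le> exp (\<alpha> * pot y)"
      using exp_pot_support[OF \<alpha>, of z] r(2) \<open>k > 0\<close> by (metis subsetD)
    then show "\<exists>c b. exp (\<alpha> * pot z) = c + b \<bullet> z \<and> (\<forall>y\<in>ball y r. c + b \<bullet> y \<le> exp (\<alpha> * pot y))"
      using r(2) by blast
  qed
  then show "\<exists>N. open N \<and> y \<in> N \<and> N \<subseteq> proj ` U \<and> convex_on N (\<lambda>x. exp (\<alpha> * pot x))"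
    using r by (intro exI[of _ "ball y r"]) simp
qed

section \<open>The divergence and its derivatives at the diagonal\<close>

lemma log_pairing_divergence:
  assumes D: "\<And>q p. q \<in> U \<Longrightarrow> p \<in> U \<Longrightarrow> D q p = - ln (P q p) / k"
  shows "divergence_on A U D"
  unfolding divergence_on_def
proof (intro conjI U ballI)
  fix q p assume q: "q \<in> U" and p: "p \<in> U"
  \<comment> \<open>By \<open>pair_strict\<close>, \<open>P\<close> is greater than 1 for negative
    \<open>k\<close> and less than 1 for positive \<open>k\<close>; either way
    \<open>- ln P / k\<close> is positive.\<close>
  have "0 < D q p" if "q \<noteq> p"
  proof (cases "k < 0")
    case True
    then have "1 < P q p" using pair_strict[OF q p that] by (simp add: mult_less_0_iff)
    then show ?thesis using True by (simp add: D[OF q p] divide_pos_neg divide_neg_neg)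
  next
    case False
    then have "0 < k" using k by simp
    moreover from this have "P q p < 1" using pair_strict[OF q p that] by (simp add: mult_less_0_iff)
    ultimately show ?thesis using pair_pos[OF q p] by (simp add: D[OF q p] divide_neg_pos)
  qed
  moreover have "D q p = 0" if "q = p" using D[OF q p] pair_1[OF q] that by simp
  ultimately show "0 \<le> D q p" "D q p = 0 \<longleftrightarrow> q = p" by (cases "q = p", force, force)+
next
  have "smooth_on (y ` (U \<inter> Y) \<times> w ` (U \<inter> W)) (\<lambda>(a, b). D (inv_into Y y a) (inv_into W w b))"
    if Y: "(Y, y) \<in> A" and W: "(W, w) \<in> A" for Y y W w
  proof -
    let ?S = "y ` (U \<inter> Y)" and ?T = "w ` (U \<inter> W)"
    have o: "open ?S" "open ?T" "open (?S \<times> ?T)"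
      using chart_image_open[OF Y U(1)] chart_image_open[OF W U(1)] by (auto intro: open_Times)
    note cY = topological_chartD[OF local_coords_chart[OF atlas_local_coords[OF Y]]]
    note cW = topological_chartD[OF local_coords_chart[OF atlas_local_coords[OF W]]]
    have inU: "inv_into Y y a \<in> U" "inv_into W w b \<in> U" if "a \<in> ?S" "b \<in> ?T" for a b
      using that cY(6) cW(6) by auto
    have c1: "C_k_on m (?S \<times> ?T) (\<lambda>z. f s (inv_into Y y (fst z)))" for m s
      by (rule C_k_on_compose[where f = "\<lambda>a. f s (inv_into Y y a)" and g = fst, OF o(3) o(1)])
        (use smooth_f[of s] Y in \<open>auto simp: smooth_fun_iff intro: C_k_on_bounded_linear[OF bounded_linear_fst]\<close>)
    have c2: "C_k_on m (?S \<times> ?T) (\<lambda>z. h s (inv_into W w (snd z)))" for m s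
      by (rule C_k_on_compose[where f = "\<lambda>a. h s (inv_into W w a)" and g = snd, OF o(3) o(2)])
        (use smooth_h[of s] W in \<open>auto simp: smooth_fun_iff intro: C_k_on_bounded_linear[OF bounded_linear_snd]\<close>)
    have pp: "0 < P (inv_into Y y (fst z)) (inv_into W w (snd z))" if "z \<in> ?S \<times> ?T" for z
      using that by (intro pair_pos inU[of "fst z" "snd z"]) auto
    have "C_k_on m (?S \<times> ?T) (\<lambda>z. (- 1 / k) * ln (P (inv_into Y y (fst z)) (inv_into W w (snd z))))" for m
      by (rule C_k_on_mult[OF o(3) C_k_on_const C_k_on_ln[OF o(3) pp C_k_on_pairing[OF o(3) c1 c2]]])
    then have "C_k_on m (?S \<times> ?T) (\<lambda>(a, b). D (inv_into Y y a) (inv_into W w b))" for m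
      by (rule C_k_on_cong[OF o(3), rotated]) (auto simp: D cY(6) cW(6))
    then show ?thesis by (simp add: smooth_on_def)
  qed
  then show "\<And>c. c \<in> A \<Longrightarrow> case c of (V, x) \<Rightarrow> \<forall>(W, y)\<in>A. smooth_on (x ` (U \<inter> V) \<times> y ` (U \<inter> W))
      (\<lambda>(a, b). D (inv_into V x a) (inv_into W y b))" by auto
qed

lemma log_pairing_derivatives:
  assumes D: "\<And>q p. q \<in> U \<Longrightarrow> p \<in> U \<Longrightarrow> D q p = - ln (P q p) / k"
    and W: "local_coords A (W, y)" "r \<in> U" "r \<in> W"
  defines "Dx \<equiv> \<lambda>a b. D (inv_into W y a) (inv_into W y b)" and "E \<equiv> coord_field A (W, y)"
  shows "g r (E i r) (E j r) = - partial_deriv i (\<lambda>a. partial_deriv j (\<lambda>b. Dx a b) (y r)) (y r)"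
    and "g r (cov nab (E i) (E j) r) (E l r) =
      - partial_deriv i (\<lambda>a. partial_deriv j (\<lambda>a'. partial_deriv l (\<lambda>b. Dx a' b) (y r)) a) (y r)"
proof -
  note c = topological_chartD[OF local_coords_chart[OF W(1)]]
  let ?Z = "y ` (U \<inter> W)"
  define F where "F s z = f s (inv_into W y z)" for s z
  define H where "H s z = h s (inv_into W y z)" for s z
  have Z: "open ?Z" "y r \<in> ?Z"
    using chart_open_image[OF local_coords_chart[OF W(1)], of "U \<inter> W"] U(1) c(1) W by auto
  have CF: "C_k_on m ?Z (F s)" and CH: "C_k_on m ?Z (H s)" for m s
    using smooth_onD[OF smooth_fun_chart[OF smooth_f[of s] W(1)]] smooth_onD[OF smooth_fun_chart[OF smooth_h[of s] W(1)]]
    by (simp_all add: F_def[abs_def] H_def[abs_def] comp_def)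
  have inU: "inv_into W y a \<in> U" if "a \<in> ?Z" for a using that c(6) by auto
  have ir: "inv_into W y (y r) = r" using c(6)[OF W(3)] .
  have T: "E i r \<in> tangent_space A r" for i unfolding E_def by (rule coord_field_tangent[OF W(1,3)])
  have pF: "partial_deriv i (F s) (y r) = E i r (f s)" and pH: "partial_deriv i (H s) (y r) = E i r (h s)" for i s
    using coord_field_partial[OF smooth_nearI[OF smooth_f[of s] W(2)]] coord_field_partial[OF smooth_nearI[OF smooth_h[of s] W(2)]]
    by (simp_all add: F_def[abs_def] H_def[abs_def] comp_def E_def)
  have EV: "vector_field A W (E i)" for i unfolding E_def by (rule coord_field_vector_field[OF W(1)])
  have pF2: "partial_deriv i (partial_deriv j (F s)) (y r) = cov nab (E i) (E j) r (f s) - k * f s r * g r (E i r) (E j r)" for i j s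
    using coord_field_second[OF W(1,3) smooth_nearI[OF smooth_f[of s] W(2)], of i j] hess_f[OF EV EV W(3,2), of i j s]
    by (simp add: F_def[abs_def] comp_def E_def)
  have \<delta>: "Dx a b = (- 1 / k) * ln (pairing \<alpha> (\<lambda>s. F s a) (\<lambda>s. H s b))" if "a \<in> ?Z" "b \<in> ?Z" for a b
    using D[OF inU[OF that(1)] inU[OF that(2)]] by (simp add: Dx_def F_def H_def)
  have pos: "0 < pairing \<alpha> (\<lambda>s. F s a) (\<lambda>s. H s b)" if "a \<in> ?Z" "b \<in> ?Z" for a b
    unfolding F_def H_def by (rule pair_pos[OF inU[OF that(1)] inU[OF that(2)]])
  have I1: "pairing \<alpha> (\<lambda>s. F s (y r)) (\<lambda>s. H s (y r)) = 1" using pair_1[OF W(2)] by (simp add: F_def H_def ir)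
  have I2: "pairing \<alpha> (\<lambda>s. partial_deriv i (F s) (y r)) (\<lambda>s. H s (y r)) = 0" for i
    using pair_df[OF W(2) T] by (simp add: pF H_def ir)
  have I3: "pairing \<alpha> (\<lambda>s. F s (y r)) (\<lambda>s. partial_deriv i (H s) (y r)) = 0" for i
    using pair_dh[OF W(2) T] by (simp add: pH F_def ir)
  have pd: "partial_deriv i (\<lambda>a. partial_deriv j (\<lambda>b. Dx a b) (y r)) (y r) =
      (- 1 / k) * pairing \<alpha> (\<lambda>s. partial_deriv i (F s) (y r)) (\<lambda>s. partial_deriv j (H s) (y r))"
    "partial_deriv i (\<lambda>a. partial_deriv j (\<lambda>a'. partial_deriv l (\<lambda>b. Dx a' b) (y r)) a) (y r) =
      (- 1 / k) * pairing \<alpha> (\<lambda>s. partial_deriv i (partial_deriv j (F s)) (y r)) (\<lambda>s. partial_deriv l (H s) (y r))"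
    by (rule partial_deriv_log_pairing[OF Z CF CH \<delta> pos I1 I2 I3]; assumption)+
  show "g r (E i r) (E j r) = - partial_deriv i (\<lambda>a. partial_deriv j (\<lambda>b. Dx a b) (y r)) (y r)"
    unfolding pd(1) pF pH pair_metric[OF W(2) T T] using k by simp
  \<comment> \<open>The term \<open>- k * f * g\<close> of the Hessian equation pairs to 0 with a
    first derivative of \<open>h\<close>; what remains is \<open>pair_metric\<close> for the tangent
    vector \<open>cov nab (E i) (E j) r\<close>.\<close>
  have "pairing \<alpha> (\<lambda>s. cov nab (E i) (E j) r (f s) - k * f s r * g r (E i r) (E j r)) (\<lambda>s. E l r (h s))
     = pairing \<alpha> (\<lambda>s. cov nab (E i) (E j) r (f s)) (\<lambda>s. E l r (h s)) - k * g r (E i r) (E j r) * pairing \<alpha> (\<lambda>s. f s r) (\<lambda>s. E l r (h s))"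
    unfolding pairing_def by (simp add: algebra_simps sum_subtractf sum_distrib_left)
  also have "\<dots> = k * g r (cov nab (E i) (E j) r) (E l r)"
    using pair_metric[OF W(2) vector_field_tangent[OF conn_field[OF EV EV] W(3)] T] pair_dh[OF W(2) T] by simp
  finally show "g r (cov nab (E i) (E j) r) (E l r) =
      - partial_deriv i (\<lambda>a. partial_deriv j (\<lambda>a'. partial_deriv l (\<lambda>b. Dx a' b) (y r)) a) (y r)"
    unfolding pd(2) pF2 pH using k by simp
qed

end

section \<open>The formula for the dual connection, and the two cases of the sign of
  \<open>k\<close>\<close>

context projective_frame
begin

interpretation dual: projective_frame A g nab' nab k \<alpha> V U x h f by (rule swap_frame)

lemma log_pairing_induces:
  assumes D: "\<And>q p. q \<in> U \<Longrightarrow> p \<in> U \<Longrightarrow> D q p = - ln (P q p) / k"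
  shows "induces A U D g nab nab'"
  unfolding induces_def Let_def
proof (intro allI impI ballI conjI)
  fix W y r i j l assume W: "local_coords A (W, y)" and r: "r \<in> U \<inter> W"
  have D': "D q p = - ln (pairing \<alpha> (\<lambda>s. h s p) (\<lambda>s. f s q)) / k" if "p \<in> U" "q \<in> U" for p q
    using D that pairing_commute[of \<alpha> "\<lambda>s. h s p"] by simp
  note L = log_pairing_derivatives[OF D W, of r]
  \<comment> \<open>The exchanged frame has the pairing with its arguments exchanged, hence also the
    divergence with its arguments exchanged. Its formula for the first connection is the formula for
    \<open>nab'\<close> here.\<close>
  note L' = dual.log_pairing_derivatives[of "\<lambda>p q. D q p", OF D' W, of r]
  show "g r (coord_field A (W, y) i r) (coord_field A (W, y) j r) =
     - partial_deriv i (\<lambda>a. partial_deriv j (\<lambda>b. D (inv_into W y a) (inv_into W y b)) (y r)) (y r)"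
    using L(1) r by simp
  show "g r (cov nab (coord_field A (W, y) i) (coord_field A (W, y) j) r) (coord_field A (W, y) l r) =
     - partial_deriv i (\<lambda>a. partial_deriv j (\<lambda>a'. partial_deriv l (\<lambda>b. D (inv_into W y a') (inv_into W y b)) (y r)) a) (y r)"
    using L(2) r by simp
  show "g r (cov nab' (coord_field A (W, y) i) (coord_field A (W, y) j) r) (coord_field A (W, y) l r) =
     - partial_deriv i (\<lambda>b. partial_deriv j (\<lambda>b'. partial_deriv l (\<lambda>a. D (inv_into W y a) (inv_into W y b')) (y r)) b) (y r)"
    using L'(2) r by simp
qed

text \<open>The factor \<open>- (\<alpha> / k)\<close> is 1 for \<open>k = - \<alpha>\<close> and -1
  for \<open>k = \<alpha>\<close>, so \<open>- ln P / k\<close> is the divergence in question in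
  either case. The last conclusion speaks of every \<open>D\<close> with the given values on
  \<open>U\<close>, so that either expression can be substituted.\<close>

theorem representation:
  assumes \<alpha>: "\<alpha> \<noteq> 0"
  obtains \<xi> \<eta> \<phi> \<psi> where
    "affine_coords A nab (U, \<xi>)" "affine_coords A nab' (U, \<eta>)"
    "k < 0 \<Longrightarrow> locally_exp_concave_on \<alpha> (\<xi> ` U) \<phi>" "k < 0 \<Longrightarrow> locally_exp_concave_on \<alpha> (\<eta> ` U) \<psi>"
    "0 < k \<Longrightarrow> locally_exp_convex_on \<alpha> (\<xi> ` U) \<phi>" "0 < k \<Longrightarrow> locally_exp_convex_on \<alpha> (\<eta> ` U) \<psi>"
    "\<forall>q\<in>U. \<forall>p\<in>U. 1 + \<alpha> * (\<xi> q \<bullet> \<eta> p) > 0"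
    "\<forall>q\<in>U. \<phi> (\<xi> q) + \<psi> (\<eta> q) = log_cost \<alpha> (\<xi> q) (\<eta> q)"
    "\<And>D. (\<And>q p. q \<in> U \<Longrightarrow> p \<in> U \<Longrightarrow>
        D q p = - (\<alpha> / k) * (log_cost \<alpha> (\<xi> q) (\<eta> p) - \<phi> (\<xi> q) - \<psi> (\<eta> p))) \<Longrightarrow>
      divergence_on A U D \<and> induces A U D g nab nab'"
proof (rule that[of proj dual.proj pot dual.pot])
  show "affine_coords A nab (U, proj)" "affine_coords A nab' (U, dual.proj)"
    by (rule proj_affine_coords dual.proj_affine_coords)+
  show "k < 0 \<Longrightarrow> locally_exp_concave_on \<alpha> (proj ` U) pot" "k < 0 \<Longrightarrow> locally_exp_concave_on \<alpha> (dual.proj ` U) dual.pot"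
    "0 < k \<Longrightarrow> locally_exp_convex_on \<alpha> (proj ` U) pot" "0 < k \<Longrightarrow> locally_exp_convex_on \<alpha> (dual.proj ` U) dual.pot"
    by (rule pot_locally_exp_concave[OF \<alpha>] dual.pot_locally_exp_concave[OF \<alpha>] pot_locally_exp_convex[OF \<alpha>]
        dual.pot_locally_exp_convex[OF \<alpha>]; assumption)+
  show "\<forall>q\<in>U. \<forall>p\<in>U. 1 + \<alpha> * (proj q \<bullet> dual.proj p) > 0"
    using cost_argument f_pos h_pos pair_pos by simp
  show "\<forall>q\<in>U. pot (proj q) + dual.pot (dual.proj q) = log_cost \<alpha> (proj q) (dual.proj q)"
    using log_cost_eq pair_1 by simp
  fix D assume D: "\<And>q p. q \<in> U \<Longrightarrow> p \<in> U \<Longrightarrow>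
      D q p = - (\<alpha> / k) * (log_cost \<alpha> (proj q) (dual.proj p) - pot (proj q) - dual.pot (dual.proj p))"
  have "D q p = - ln (P q p) / k" if "q \<in> U" "p \<in> U" for q p
    using D[OF that] \<alpha> by (simp add: log_cost_eq[OF that])
  then show "divergence_on A U D \<and> induces A U D g nab nab'"
    using log_pairing_divergence log_pairing_induces by blast
qed

end

theorem theorem3:
  fixes A :: "('a::{t2_space, second_countable_topology}, 'n::finite) chart set"
    and g :: "'a \<Rightarrow> 'a tangent \<Rightarrow> 'a tangent \<Rightarrow> real"
    and nab nab' :: "'a connection"
    and \<alpha> :: real
  assumes "smooth_atlas A"
    and "CARD('n) \<ge> 2"
    and "dualistic_structure A g nab nab'"
    and "\<alpha> > 0"
  shows
    "(projectively_flat A nab \<and> projectively_flat A nab' \<and>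
      constant_sectional_curvature A g nab (- \<alpha>) \<and>
      constant_sectional_curvature A g nab' (- \<alpha>) \<longrightarrow>
      (\<forall>p0. \<exists>U \<xi> \<eta> \<phi> \<psi>.
         p0 \<in> U \<and> affine_coords A nab (U, \<xi>) \<and> affine_coords A nab' (U, \<eta>) \<and>
         locally_exp_concave_on \<alpha> (\<xi> ` U) \<phi> \<and> locally_exp_concave_on \<alpha> (\<eta> ` U) \<psi> \<and>
         (\<forall>q\<in>U. \<forall>p\<in>U. 1 + \<alpha> * (\<xi> q \<bullet> \<eta> p) > 0) \<and>
         (\<forall>q\<in>U. \<phi> (\<xi> q) + \<psi> (\<eta> q) = log_cost \<alpha> (\<xi> q) (\<eta> q)) \<and>
         (let D = (\<lambda>q p. log_cost \<alpha> (\<xi> q) (\<eta> p) - \<phi> (\<xi> q) - \<psi> (\<eta> p)) in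
            divergence_on A U D \<and> induces A U D g nab nab')))
     \<and>
     (projectively_flat A nab \<and> projectively_flat A nab' \<and>
      constant_sectional_curvature A g nab \<alpha> \<and>
      constant_sectional_curvature A g nab' \<alpha> \<longrightarrow>
      (\<forall>p0. \<exists>U \<xi> \<eta> \<phi> \<psi>.
         p0 \<in> U \<and> affine_coords A nab (U, \<xi>) \<and> affine_coords A nab' (U, \<eta>) \<and>
         locally_exp_convex_on \<alpha> (\<xi> ` U) \<phi> \<and> locally_exp_convex_on \<alpha> (\<eta> ` U) \<psi> \<and>
         (\<forall>q\<in>U. \<forall>p\<in>U. 1 + \<alpha> * (\<xi> q \<bullet> \<eta> p) > 0) \<and>
         (\<forall>q\<in>U. \<phi> (\<xi> q) + \<psi> (\<eta> q) = log_cost \<alpha> (\<xi> q) (\<eta> q)) \<and>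
         (let D = (\<lambda>q p. \<phi> (\<xi> q) + \<psi> (\<eta> p) - log_cost \<alpha> (\<xi> q) (\<eta> p)) in
            divergence_on A U D \<and> induces A U D g nab nab')))"
proof (intro conjI impI allI)
  interpret dualistic_manifold A g nab nab' by unfold_locales (rule assms)+
  have \<alpha>: "\<alpha> \<noteq> 0" "- \<alpha> \<noteq> 0" using assms(4) by auto
  {
    fix p0
    assume "projectively_flat A nab \<and> projectively_flat A nab' \<and>
      constant_sectional_curvature A g nab (- \<alpha>) \<and> constant_sectional_curvature A g nab' (- \<alpha>)"
    then obtain V U x f h where U: "p0 \<in> U" and fr: "projective_frame A g nab nab' (- \<alpha>) \<alpha> V U x f h"
      using projective_frame_exists[OF _ _ \<alpha>(2,1)] by metis
    obtain \<xi> \<eta> \<phi> \<psi> where *: "affine_coords A nab (U, \<xi>)" "affine_coords A nab' (U, \<eta>)"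
      "- \<alpha> < 0 \<Longrightarrow> locally_exp_concave_on \<alpha> (\<xi> ` U) \<phi>" "- \<alpha> < 0 \<Longrightarrow> locally_exp_concave_on \<alpha> (\<eta> ` U) \<psi>"
      "\<forall>q\<in>U. \<forall>p\<in>U. 1 + \<alpha> * (\<xi> q \<bullet> \<eta> p) > 0"
      "\<forall>q\<in>U. \<phi> (\<xi> q) + \<psi> (\<eta> q) = log_cost \<alpha> (\<xi> q) (\<eta> q)"
      "\<And>D. (\<And>q p. q \<in> U \<Longrightarrow> p \<in> U \<Longrightarrow>
          D q p = - (\<alpha> / - \<alpha>) * (log_cost \<alpha> (\<xi> q) (\<eta> p) - \<phi> (\<xi> q) - \<psi> (\<eta> p))) \<Longrightarrow>
        divergence_on A U D \<and> induces A U D g nab nab'"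
      by (rule projective_frame.representation[OF fr \<alpha>(1)]) blast
    show "\<exists>U \<xi> \<eta> \<phi> \<psi>.
         p0 \<in> U \<and> affine_coords A nab (U, \<xi>) \<and> affine_coords A nab' (U, \<eta>) \<and>
         locally_exp_concave_on \<alpha> (\<xi> ` U) \<phi> \<and> locally_exp_concave_on \<alpha> (\<eta> ` U) \<psi> \<and>
         (\<forall>q\<in>U. \<forall>p\<in>U. 1 + \<alpha> * (\<xi> q \<bullet> \<eta> p) > 0) \<and>
         (\<forall>q\<in>U. \<phi> (\<xi> q) + \<psi> (\<eta> q) = log_cost \<alpha> (\<xi> q) (\<eta> q)) \<and>
         (let D = (\<lambda>q p. log_cost \<alpha> (\<xi> q) (\<eta> p) - \<phi> (\<xi> q) - \<psi> (\<eta> p)) in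
            divergence_on A U D \<and> induces A U D g nab nab')"
      unfolding Let_def
      by (intro exI[of _ U] exI[of _ \<xi>] exI[of _ \<eta>] exI[of _ \<phi>] exI[of _ \<psi>] conjI U *(1,2,5,6) *(3,4) *(7)[THEN conjunct1] *(7)[THEN conjunct2])
        (use assms(4) in simp_all)
  }
  {
    fix p0
    assume "projectively_flat A nab \<and> projectively_flat A nab' \<and>
      constant_sectional_curvature A g nab \<alpha> \<and> constant_sectional_curvature A g nab' \<alpha>"
    then obtain V U x f h where U: "p0 \<in> U" and fr: "projective_frame A g nab nab' \<alpha> \<alpha> V U x f h"
      using projective_frame_exists[OF _ _ \<alpha>(1,1)] by metis
    obtain \<xi> \<eta> \<phi> \<psi> where *: "affine_coords A nab (U, \<xi>)" "affine_coords A nab' (U, \<eta>)"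
      "0 < \<alpha> \<Longrightarrow> locally_exp_convex_on \<alpha> (\<xi> ` U) \<phi>" "0 < \<alpha> \<Longrightarrow> locally_exp_convex_on \<alpha> (\<eta> ` U) \<psi>"
      "\<forall>q\<in>U. \<forall>p\<in>U. 1 + \<alpha> * (\<xi> q \<bullet> \<eta> p) > 0"
      "\<forall>q\<in>U. \<phi> (\<xi> q) + \<psi> (\<eta> q) = log_cost \<alpha> (\<xi> q) (\<eta> q)"
      "\<And>D. (\<And>q p. q \<in> U \<Longrightarrow> p \<in> U \<Longrightarrow>
          D q p = - (\<alpha> / \<alpha>) * (log_cost \<alpha> (\<xi> q) (\<eta> p) - \<phi> (\<xi> q) - \<psi> (\<eta> p))) \<Longrightarrow>
        divergence_on A U D \<and> induces A U D g nab nab'"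
      by (rule projective_frame.representation[OF fr \<alpha>(1)]) blast
    show "\<exists>U \<xi> \<eta> \<phi> \<psi>.
         p0 \<in> U \<and> affine_coords A nab (U, \<xi>) \<and> affine_coords A nab' (U, \<eta>) \<and>
         locally_exp_convex_on \<alpha> (\<xi> ` U) \<phi> \<and> locally_exp_convex_on \<alpha> (\<eta> ` U) \<psi> \<and>
         (\<forall>q\<in>U. \<forall>p\<in>U. 1 + \<alpha> * (\<xi> q \<bullet> \<eta> p) > 0) \<and>
         (\<forall>q\<in>U. \<phi> (\<xi> q) + \<psi> (\<eta> q) = log_cost \<alpha> (\<xi> q) (\<eta> q)) \<and>
         (let D = (\<lambda>q p. \<phi> (\<xi> q) + \<psi> (\<eta> p) - log_cost \<alpha> (\<xi> q) (\<eta> p)) in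
            divergence_on A U D \<and> induces A U D g nab nab')"
      unfolding Let_def
      by (intro exI[of _ U] exI[of _ \<xi>] exI[of _ \<eta>] exI[of _ \<phi>] exI[of _ \<psi>] conjI U *(1,2,5,6) *(3,4) *(7)[THEN conjunct1] *(7)[THEN conjunct2])
        (use assms(4) in simp_all)
  }
qed

end
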